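(* Let $N$ be a positive integer, and let $a:\mathbb{R}^N\to\mathbb{R}$ and $g:\mathbb{R}^N\times\mathbb{R}\to\mathbb{R}$ satisfy the following hypotheses. (1) $g(x,u)$ is measurable in $x$ and continuous in $u$, and $\sup_{x\in\mathbb{R}^N,\ 0\le u\le M}|g(x,u)|<\infty$ for every $M>0$. (2) There exist two constants $\sigma>\delta>0$ and two functions $b_1,b_2\in L^\infty(\mathbb{R}^N)$ such that $|g(x,u)|\le b_1(x)|u|^{\delta+1}+b_2(x)|u|^{\sigma+1}$. (3) $\lim_{|x|\to\infty}a(x)=k^2$ for some $k>0$, and $k^2-a\in L^2(\mathbb{R}^N)\cap L^\infty(\mathbb{R}^N)$. Suppose moreover that, if $N\ge 5$, the constant $\sigma$ in (2) satisfies $\sigma+1<\frac{N+4}{N-4}$. Let $u$ be a weak solution of $$\Delta^2u+a(x)u=g(x,u),\qquad u\in H^2(\mathbb{R}^N).$$ Then $u\in H^4(\mathbb{R}^N)\cap W^{2,s}(\mathbb{R}^N)$ for all $2\le s\le+\infty$. In particular, $u\in C^2(\mathbb{R}^N)$, $\lim_{|x|\to\infty}u(x)=0$ and $\lim_{|x|\to\infty}\Delta u(x)=0$.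
   Context: All functions are real-valued. $H^m(\mathbb{R}^N)=W^{m,2}(\mathbb{R}^N)$. A weak solution of the equation is a function $u\in H^2(\mathbb{R}^N)$ such that $\int_{\mathbb{R}^N}\Delta u\,\Delta v\,dx+\int_{\mathbb{R}^N}a(x)uv\,dx=\int_{\mathbb{R}^N}g(x,u(x))v\,dx$ for all $v\in C_0^\infty(\mathbb{R}^N)$. As usual, $u\in C^2(\mathbb{R}^N)$ and the statements about limits are understood after choosing the continuous representative. *)

theory Defs
  imports "HOL-Analysis.Analysis"
begin

text \<open>
  All functions are real-valued functions on \<open>real ^ 'n\<close>, so the dimension \<open>N\<close> is \<open>CARD('n)\<close>.
  Measurability and integrals refer to the completed Lebesgue measure. Elements of the function
  spaces are functions rather than classes modulo a.e. equality; membership is invariant under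
  changes on null sets.
\<close>

definition partial :: "'n \<Rightarrow> (real ^ 'n::finite \<Rightarrow> real) \<Rightarrow> real ^ 'n \<Rightarrow> real" where
  "partial i f x = frechet_derivative f (at x) (axis i 1)"

text \<open>
  A multi-index of order \<open>m\<close> is represented by a list of \<open>m\<close> coordinate directions. The order of
  the list is irrelevant for smooth functions, and hence also for weak derivatives.
\<close>

definition partials :: "'n list \<Rightarrow> (real ^ 'n::finite \<Rightarrow> real) \<Rightarrow> real ^ 'n \<Rightarrow> real" where
  "partials is f = foldr partial is f"

fun C_k :: "nat \<Rightarrow> (real ^ 'n::finite \<Rightarrow> real) \<Rightarrow> bool" where
  "C_k 0 f \<longleftrightarrow> continuous_on UNIV f"
| "C_k (Suc k) f \<longleftrightarrow> (\<forall>x. f differentiable (at x)) \<and> (\<forall>i. C_k k (partial i f))"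

definition laplacian :: "(real ^ 'n::finite \<Rightarrow> real) \<Rightarrow> real ^ 'n \<Rightarrow> real" where
  "laplacian f x = (\<Sum>i\<in>UNIV. partials [i, i] f x)"

text \<open>The space \<open>C\<^sub>0\<^sup>\<infinity>\<close> of smooth functions with compact support.\<close>

definition test_functions :: "(real ^ 'n::finite \<Rightarrow> real) set" where
  "test_functions = {v. (\<forall>k. C_k k v) \<and> compact (closure (support_on UNIV v))}"

text \<open>The spaces \<open>L\<^sup>p\<close>; only exponents \<open>1 \<le> p \<le> \<infinity>\<close> are meaningful.\<close>

definition Lp :: "ennreal \<Rightarrow> (real ^ 'n::finite \<Rightarrow> real) set" where
  "Lp p = {f \<in> borel_measurable lebesgue.
     if p = \<infinity> then \<exists>C. AE x in lebesgue. \<bar>f x\<bar> \<le> C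
     else integrable lebesgue (\<lambda>x. \<bar>f x\<bar> powr enn2real p)}"

definition locally_integrable :: "(real ^ 'n::finite \<Rightarrow> real) \<Rightarrow> bool" where
  "locally_integrable f \<longleftrightarrow> (\<forall>K. compact K \<longrightarrow> set_integrable lebesgue K f)"

definition has_weak_deriv ::
    "(real ^ 'n::finite \<Rightarrow> real) \<Rightarrow> 'n list \<Rightarrow> (real ^ 'n \<Rightarrow> real) \<Rightarrow> bool" where
  "has_weak_deriv u is w \<longleftrightarrow> locally_integrable u \<and> locally_integrable w \<and>
     (\<forall>v\<in>test_functions.
        (LINT x|lebesgue. u x * partials is v x) =
        (-1) ^ length is * (LINT x|lebesgue. w x * v x))"

definition sobolev :: "nat \<Rightarrow> ennreal \<Rightarrow> (real ^ 'n::finite \<Rightarrow> real) set" where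
  "sobolev m p = {u \<in> Lp p. \<forall>is. length is \<le> m \<longrightarrow> (\<exists>w\<in>Lp p. has_weak_deriv u is w)}"

abbreviation sobolev_H :: "nat \<Rightarrow> (real ^ 'n::finite \<Rightarrow> real) set" where
  "sobolev_H m \<equiv> sobolev m 2"

text \<open>
  Weak derivatives are unique up to null sets, so the choice made here does not affect integrals;
  pointwise values of \<open>weak_laplacian\<close> are not meaningful.
\<close>

definition weak_deriv ::
    "'n list \<Rightarrow> (real ^ 'n::finite \<Rightarrow> real) \<Rightarrow> real ^ 'n \<Rightarrow> real" where
  "weak_deriv is u = (SOME w. has_weak_deriv u is w)"

definition weak_laplacian :: "(real ^ 'n::finite \<Rightarrow> real) \<Rightarrow> real ^ 'n \<Rightarrow> real" where
  "weak_laplacian u x = (\<Sum>i\<in>UNIV. weak_deriv [i, i] u x)"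

text \<open>Weak solutions of \<open>\<Delta>\<^sup>2 u + a(x) u = g(x, u)\<close> in \<open>H\<^sup>2\<close>.\<close>

definition weak_solution ::
    "(real ^ 'n::finite \<Rightarrow> real) \<Rightarrow> (real ^ 'n \<Rightarrow> real \<Rightarrow> real) \<Rightarrow> (real ^ 'n \<Rightarrow> real) \<Rightarrow> bool" where
  "weak_solution a g u \<longleftrightarrow> u \<in> sobolev_H 2 \<and>
     (\<forall>v\<in>test_functions.
        (LINT x|lebesgue. weak_laplacian u x * laplacian v x) + (LINT x|lebesgue. a x * u x * v x)
        = (LINT x|lebesgue. g x (u x) * v x))"

end

theory Submission
  imports Defs
begin

text \<open>
  Put \<open>w = u - \<Delta>u\<close>. The equation \<open>\<Delta>\<^sup>2 u + a u = g(x, u)\<close> becomes the second-order system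
  \<open>(1 - \<Delta>) u = w\<close>, \<open>(1 - \<Delta>) w = F\<close> with \<open>F = 2 w - (1 + a) u + g(x, u)\<close>, so that everything reduces to
  the operator \<open>1 - \<Delta>\<close>, whose inverse is the convolution with the Bessel kernel \<open>B\<close>. This kernel is
  a superposition of dilated Gaussians, \<open>B(y) = \<integral> 2 s e\<^bsup>-s\<^sup>2\<^esup> s\<^bsup>-N\<^esup> \<gamma>(y / s) ds\<close> over \<open>s > 0\<close>, and each
  of its properties is read off from that formula by Fubini's theorem and integration by parts.

  \<^item> A weak solution \<open>f\<close> of \<open>(1 - \<Delta>) f = h\<close> is the potential \<open>B * h\<close>
    (\<open>bessel_potential_of_weak_helmholtz\<close>): test with \<open>B * \<phi>\<close>. Hence \<open>u = B * w\<close> and \<open>w = B * F\<close>.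

  \<^item> \<open>B\<close> lies in \<open>L\<^sup>q\<close> for finite \<open>q\<close> with \<open>1 - 1/q < 2/N\<close> (\<open>bessel_Lq\<close>), so by Young's inequality
    (\<open>young_conv\<close>) a convolution with \<open>B\<close> lowers the reciprocal of an integrability exponent by any
    \<open>t < 2/N\<close>, as long as it stays positive. The system uses \<open>B\<close> twice for each application of the power
    \<open>\<sigma> + 1\<close>, and for \<open>N \<ge> 5\<close> the subcritical growth condition says exactly that some \<open>t\<close> makes the net
    effect a gain, starting from \<open>w \<in> L\<^sup>2\<close>; for \<open>N \<le> 4\<close> there always is such a \<open>t\<close>. Finitely many rounds
    give bounded \<open>u\<close>, \<open>w\<close> and \<open>F\<close> (\<open>bessel_system_essentially_bounded\<close>).

  \<^item> Then \<open>u = B * B * F\<close> with \<open>F \<in> L\<^sup>2 \<inter> L\<^sup>\<infinity>\<close>. Two derivatives are distributed over the two kernels,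
    \<open>\<partial>\<^sub>j \<partial>\<^sub>i u = (\<partial>\<^sub>j B) * (\<partial>\<^sub>i B) * F\<close>, and \<open>\<partial>\<^sub>i B\<close> is integrable. Convolution of an integrable kernel with a
    function in \<open>L\<^sup>2 \<inter> L\<^sup>\<infinity>\<close> is again in this space, is continuous and vanishes at infinity; this gives
    \<open>C\<^sup>2\<close>, \<open>W\<^bsup>2,s\<^esup>\<close> and both limits (\<open>double_bessel_regularity\<close>).

  \<^item> For the fourth derivatives the kernels are no longer integrable, but only square integrability is
    claimed. If \<open>v = B * f\<close> then \<open>\<integral> f\<^sup>2 = \<integral> v\<^sup>2 + 2 \<Sum>\<^sub>i \<integral> (\<partial>\<^sub>i v)\<^sup>2 + \<Sum>\<^sub>i\<^sub>j \<integral> (\<partial>\<^sub>i \<partial>\<^sub>j v)\<^sup>2\<close> (\<open>bessel_energy\<close>), so derivatives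
    up to order two of \<open>B * f\<close> and up to order four of \<open>B * B * f\<close> are bounded by \<open>f\<close> in \<open>L\<^sup>2\<close>. Density of
    the test functions and completeness of \<open>L\<^sup>2\<close> extend this to \<open>F\<close> (\<open>bessel_bessel_weak_derivative\<close>).
\<close>

section \<open>Partial derivatives and smooth functions\<close>

lemma partial_eq:
  assumes "(f has_derivative D) (at x)"
  shows "partial i f x = D (axis i 1)"
  using frechet_derivative_at[OF assms] by (simp add: partial_def)

lemma has_derivative_partials:
  fixes f :: "real ^ 'n::finite \<Rightarrow> real"
  assumes "f differentiable (at x)"
  shows "(f has_derivative (\<lambda>h. \<Sum>i\<in>UNIV. h $ i * partial i f x)) (at x)"
proof -
  obtain D where D: "(f has_derivative D) (at x)"
    using assms by (auto simp: differentiable_def)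
  then interpret bounded_linear D by (rule has_derivative_bounded_linear)
  have "D h = (\<Sum>i\<in>UNIV. h $ i * partial i f x)" for h
  proof -
    have "D h = D (\<Sum>i\<in>UNIV. h $ i *s axis i 1)" by (simp add: basis_expansion)
    also have "\<dots> = (\<Sum>i\<in>UNIV. h $ i * partial i f x)"
      by (simp add: sum scaleR scalar_mult_eq_scaleR partial_eq[OF D])
    finally show ?thesis .
  qed
  then show ?thesis using D by (metis (no_types, lifting) ext)
qed

lemma partial_mult:
  fixes f g :: "real ^ 'n::finite \<Rightarrow> real"
  assumes "f differentiable (at x)" "g differentiable (at x)"
  shows "partial i (\<lambda>x. f x * g x) x = partial i f x * g x + f x * partial i g x"
proof -
  obtain D E where D: "(f has_derivative D) (at x)" and E: "(g has_derivative E) (at x)"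
    using assms by (auto simp: differentiable_def)
  show ?thesis
    by (subst partial_eq[OF has_derivative_mult[OF D E]]) (simp add: partial_eq[OF D] partial_eq[OF E])
qed

lemma partial_add:
  assumes "f differentiable (at x)" "g differentiable (at x)"
  shows "partial i (\<lambda>x. f x + g x) x = partial i f x + partial i g x"
proof -
  obtain D E where D: "(f has_derivative D) (at x)" and E: "(g has_derivative E) (at x)"
    using assms by (auto simp: differentiable_def)
  show ?thesis
    by (subst partial_eq[OF has_derivative_add[OF D E]]) (simp add: partial_eq[OF D] partial_eq[OF E])
qed

lemma partial_const [simp]: "partial i (\<lambda>x. c) = (\<lambda>x. 0)"
  using partial_eq[OF has_derivative_const] by (auto intro: ext)

lemma partial_scaled:
  fixes f :: "real ^ 'n::finite \<Rightarrow> real"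
  assumes "\<And>x. f differentiable (at x)"
  shows "partial i (\<lambda>x. f (c *\<^sub>R x)) x = c * partial i f (c *\<^sub>R x)"
proof -
  obtain D where D: "(f has_derivative D) (at (c *\<^sub>R x))"
    using assms[of "c *\<^sub>R x"] by (auto simp: differentiable_def)
  then interpret bounded_linear D by (rule has_derivative_bounded_linear)
  have "((\<lambda>x. f (c *\<^sub>R x)) has_derivative (\<lambda>h. D (c *\<^sub>R h))) (at x)"
    by (rule has_derivative_compose[where f="\<lambda>x. c *\<^sub>R x", OF _ D]) (auto intro!: derivative_eq_intros)
  from partial_eq[OF this] show ?thesis by (simp add: scaleR partial_eq[OF D])
qed

lemma partials_Nil [simp]: "partials [] f = f"
  and partials_Cons [simp]: "partials (i # is) f = partial i (partials is f)"
  by (simp_all add: partials_def)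

lemma partials_append: "partials (is @ js) f = partials is (partials js f)"
  by (simp add: partials_def)

lemma C_k_SucD: "C_k (Suc k) f \<Longrightarrow> C_k k f"
proof (induction k arbitrary: f)
  case 0
  then show ?case
    by (auto intro!: continuous_at_imp_continuous_on differentiable_imp_continuous_within)
next
  case (Suc k)
  then show ?case by (metis C_k.simps(2))
qed

lemma C_k_continuous: "C_k k f \<Longrightarrow> continuous_on UNIV f"
  by (induction k) (use C_k_SucD in auto)

lemma C_k_const [simp]: "C_k k (\<lambda>x. c)"
  by (induction k arbitrary: c) auto

lemma C_k_add: "C_k k f \<Longrightarrow> C_k k g \<Longrightarrow> C_k k (\<lambda>x. f x + g x)"
proof (induction k arbitrary: f g)
  case 0
  then show ?case by (auto intro: continuous_intros)
next
  case (Suc k)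
  have "partial i (\<lambda>x. f x + g x) = (\<lambda>x. partial i f x + partial i g x)" for i
    using Suc.prems by (auto intro!: ext partial_add)
  then show ?case using Suc by (auto intro: derivative_intros)
qed

lemma C_k_mult: "C_k k f \<Longrightarrow> C_k k g \<Longrightarrow> C_k k (\<lambda>x. f x * g x)"
proof (induction k arbitrary: f g)
  case 0
  then show ?case by (auto intro: continuous_intros)
next
  case (Suc k)
  have "partial i (\<lambda>x. f x * g x) = (\<lambda>x. partial i f x * g x + f x * partial i g x)" for i
    using Suc.prems by (auto intro!: ext partial_mult)
  moreover have "C_k k f" "C_k k g" using Suc.prems C_k_SucD by blast+
  ultimately show ?case using Suc by (auto intro: derivative_intros C_k_add)
qed

lemma C_k_sum: "(\<And>i. i \<in> A \<Longrightarrow> C_k k (f i)) \<Longrightarrow> C_k k (\<lambda>x. \<Sum>i\<in>A. f i x)"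
  by (induction A rule: infinite_finite_induct) (auto intro: C_k_add)

lemma C_k_bounded_linear:
  assumes "bounded_linear f" shows "C_k k f"
proof -
  have "partial i f = (\<lambda>x. f (axis i 1))" for i
    by (auto intro!: ext partial_eq bounded_linear_imp_has_derivative assms)
  then show ?thesis
    by (cases k) (auto simp: linear_continuous_on assms bounded_linear_imp_differentiable)
qed

definition smooth :: "(real ^ 'n::finite \<Rightarrow> real) \<Rightarrow> bool" where
  "smooth f \<longleftrightarrow> (\<forall>k. C_k k f)"

lemma smooth_mult: "smooth f \<Longrightarrow> smooth g \<Longrightarrow> smooth (\<lambda>x. f x * g x)"
  by (simp add: smooth_def C_k_mult)

lemma smooth_differentiable: "smooth f \<Longrightarrow> f differentiable (at x)"
  unfolding smooth_def by (metis C_k.simps(2))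

lemma smooth_partial: "smooth f \<Longrightarrow> smooth (partial i f)"
  unfolding smooth_def by (metis C_k.simps(2))

lemma smooth_continuous: "smooth f \<Longrightarrow> continuous_on UNIV f"
  unfolding smooth_def using C_k_continuous by blast

text \<open>
  The property is inherited by every partial derivative, so it can be unfolded to any order. This is
  how smoothness is proved for families that are described by a formula and closed under
  differentiation.
\<close>

lemma smooth_coinduct:
  assumes "P f"
    and diff: "\<And>f x. P f \<Longrightarrow> f differentiable (at x)"
    and step: "\<And>f i. P f \<Longrightarrow> P (partial i f)"
  shows "smooth f"
proof -
  have "C_k k f" if "P f" for k f
    using that
  proof (induction k arbitrary: f)
    case 0
    then show ?case
      using diff by (auto intro!: continuous_at_imp_continuous_on differentiable_imp_continuous_within)
  qed (auto intro: diff step)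
  then show ?thesis using assms(1) by (simp add: smooth_def)
qed

lemma smooth_scaled: "smooth f \<Longrightarrow> smooth (\<lambda>x. f (c *\<^sub>R x))"
proof -
  assume f: "smooth f"
  define P where "P h \<longleftrightarrow> (\<exists>g d. smooth g \<and> h = (\<lambda>x. d * g (c *\<^sub>R x)))" for h :: "real ^ 'a \<Rightarrow> real"
  show ?thesis
  proof (rule smooth_coinduct[of P])
    show "P (\<lambda>x. f (c *\<^sub>R x))" unfolding P_def using f by (intro exI[of _ f] exI[of _ 1]) auto
  next
    fix h :: "real ^ 'a \<Rightarrow> real" and x assume "P h"
    then obtain g d where g: "smooth g" and h: "h = (\<lambda>x. d * g (c *\<^sub>R x))" unfolding P_def by auto
    have 1: "(\<lambda>x. g (c *\<^sub>R x)) differentiable (at x)" for x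
      by (rule differentiable_chain_at[unfolded o_def, of "\<lambda>x. c *\<^sub>R x" x g])
        (auto intro: smooth_differentiable g derivative_intros)
    then show "h differentiable (at x)" unfolding h by (auto intro: derivative_intros)
    fix i
    have "partial i h = (\<lambda>x. (d * c) * partial i g (c *\<^sub>R x))"
      unfolding h using 1
      by (intro ext, subst partial_mult)
        (auto simp: partial_scaled smooth_differentiable g)
    then show "P (partial i h)" unfolding P_def using smooth_partial[OF g] by blast
  qed
qed

section \<open>Cutoff functions\<close>

text \<open>
  The derivatives of \<open>e\<^bsup>-1/t\<^esup>\<close> are linear combinations of the functions \<open>e\<^bsup>-1/t\<^esup> / t\<^sup>n\<close>. Treating all \<open>n\<close> at
  once keeps the family closed under differentiation.
\<close>

definition psi :: "nat \<Rightarrow> real \<Rightarrow> real" where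
  "psi n t = (if t > 0 then exp (- (1 / t)) / t ^ n else 0)"

text \<open>
  With \<open>x = 1 / t\<close> this is \<open>x\<^sup>n e\<^bsup>-x\<^esup> \<longlongrightarrow> 0\<close>.
\<close>

lemma psi_tendsto_0: "(psi n \<longlongrightarrow> 0) (at 0)"
proof -
  have 1: "((\<lambda>x. x ^ n / exp x) \<longlongrightarrow> (0::real)) at_top" by (rule tendsto_power_div_exp_0)
  have "((\<lambda>t. (inverse t) ^ n / exp (inverse t)) \<longlongrightarrow> (0::real)) (at_right 0)"
    by (rule filterlim_compose[OF 1 filterlim_inverse_at_top_right])
  then have r: "(psi n \<longlongrightarrow> 0) (at_right 0)"
    by (rule Lim_transform_eventually)
      (auto simp: psi_def eventually_at_right_less exp_minus divide_simps eventually_at intro!: exI[of _ 1])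
  have l: "(psi n \<longlongrightarrow> 0) (at_left 0)"
    by (rule tendsto_eventually) (auto simp: psi_def eventually_at intro!: exI[of _ 1])
  show ?thesis using l r by (simp add: filterlim_split_at_real)
qed

lemma psi_deriv:
  "(psi n has_real_derivative (psi (n + 2) t - n * psi (n + 1) t)) (at t)"
proof (cases "t = 0")
  case True
  have "((\<lambda>h. (psi n (0 + h) - psi n 0) / h) \<longlongrightarrow> 0) (at 0)"
    by (rule Lim_transform_eventually[OF psi_tendsto_0[of "Suc n"]])
      (auto simp: psi_def eventually_at intro!: exI[of _ 1])
  then show ?thesis using True by (simp add: DERIV_def psi_def)
next
  case False
  show ?thesis
  proof (cases "t > 0")
    case True
    have "((\<lambda>t. exp (- (1 / t)) / t ^ n) has_real_derivative
        (exp (- (1 / t)) * (1 / t^2) * t ^ n - exp (- (1 / t)) * (n * t ^ (n - 1))) / (t ^ n * t ^ n)) (at t)"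
      using True by (auto intro!: derivative_eq_intros simp: field_simps power2_eq_square)
    moreover have "(exp (- (1 / t)) * (1 / t^2) * t ^ n - exp (- (1 / t)) * (n * t ^ (n - 1))) / (t ^ n * t ^ n)
        = psi (n + 2) t - n * psi (n + 1) t"
      using True by (cases n) (auto simp: psi_def field_simps power2_eq_square)
    ultimately have "((\<lambda>t. exp (- (1 / t)) / t ^ n) has_real_derivative (psi (n + 2) t - n * psi (n + 1) t)) (at t)"
      by simp
    then show ?thesis
      by (rule DERIV_cong_ev[THEN iffD1, rotated -1])
        (use True in \<open>auto simp: psi_def eventually_nhds intro!: exI[of _ "{0<..}"]\<close>)
  next
    case 2: False
    have "((\<lambda>t. 0::real) has_real_derivative 0) (at t)" by simp
    then have "(psi n has_real_derivative 0) (at t)"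
      by (rule DERIV_cong_ev[THEN iffD1, rotated -1])
        (use False 2 in \<open>auto simp: psi_def eventually_nhds intro!: exI[of _ "{..<0}"]\<close>)
    then show ?thesis using False 2 by (simp add: psi_def)
  qed
qed

text \<open>
  The chain rule stays inside the family \<open>psi\<close>, so the induction on the order is for all \<open>n\<close>
  simultaneously.
\<close>

lemma C_k_psi_comp:
  assumes h: "\<And>k. C_k k h"
  shows "C_k k (\<lambda>x. psi n (h x))"
proof (induction k arbitrary: n)
  case 0
  have "continuous_on UNIV (psi n)"
    by (rule DERIV_continuous_on[OF psi_deriv])
  then show ?case
    using continuous_on_compose2[of UNIV "psi n" UNIV h] C_k_continuous[OF h] by auto
next
  case (Suc k)
  have hd: "h differentiable (at x)" for x using h[of 1] by simp
  have D: "((\<lambda>x. psi n (h x)) has_derivative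
      (\<lambda>v. (psi (n + 2) (h x) - n * psi (n + 1) (h x)) * (\<Sum>i\<in>UNIV. v $ i * partial i h x))) (at x)" for x
    using has_derivative_compose[OF has_derivative_partials[OF hd] psi_deriv[unfolded has_field_derivative_def]]
    by blast
  have "partial i (\<lambda>x. psi n (h x)) = (\<lambda>x. (psi (n + 2) (h x) + (- n) * psi (n + 1) (h x)) * partial i h x)" for i
    by (rule ext, subst partial_eq[OF D]) (simp add: axis_def if_distrib[of "\<lambda>c. c * _"] cong: if_cong)
  moreover have "C_k k (partial i h)" for i using h[of "Suc k"] by simp
  ultimately show ?case
    unfolding C_k.simps using Suc.IH D
    by (simp only: differentiable_def) (intro conjI allI exI C_k_mult C_k_add C_k_const; blast)
qed

text \<open>
  The factor \<open>e\<close> makes the value at the origin \<open>1\<close>, so the dilates \<open>bump (x / n)\<close> tend to \<open>1\<close> pointwise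
  and serve as cutoff functions.
\<close>

definition bump :: "real ^ 'n::finite \<Rightarrow> real" where
  "bump x = exp 1 * psi 0 (1 - x \<bullet> x)"

lemma smooth_bump: "smooth (bump :: real ^ 'n::finite \<Rightarrow> real)"
proof -
  have "C_k k (\<lambda>x::real^'n. x \<bullet> x)" for k
    unfolding inner_vec_def inner_real_def by (intro C_k_sum C_k_mult C_k_bounded_linear bounded_linear_vec_nth)
  then have "C_k k (\<lambda>x::real^'n. 1 + (-1) * (x \<bullet> x))" for k
    by (intro C_k_add C_k_mult) auto
  then have "C_k k (\<lambda>x::real^'n. exp 1 * psi 0 (1 + (-1) * (x \<bullet> x)))" for k
    by (intro C_k_mult C_k_psi_comp) auto
  then show ?thesis by (simp add: smooth_def bump_def[abs_def])
qed

lemma bump_0 [simp]: "bump 0 = 1"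
  by (simp add: bump_def psi_def flip: exp_add)

lemma bump_nonneg: "0 \<le> bump x" and bump_le_1: "bump x \<le> 1"
proof -
  show "0 \<le> bump x" by (simp add: bump_def psi_def)
  show "bump x \<le> 1"
  proof (cases "x \<bullet> x < 1")
    case True
    then have "1 / (1 - x \<bullet> x) \<ge> 1" by (simp add: divide_simps)
    then have "exp 1 * exp (- (1 / (1 - x \<bullet> x))) \<le> (1::real)" by (simp flip: exp_add)
    then show ?thesis using True by (simp add: bump_def psi_def)
  qed (simp add: bump_def psi_def)
qed

lemma bump_pos: "norm x < 1 \<Longrightarrow> 0 < bump x"
  by (simp add: bump_def psi_def power2_norm_eq_inner[symmetric] abs_square_less_1)

lemma bump_outside: "norm x \<ge> 1 \<Longrightarrow> bump x = 0"
  using one_le_power[of "norm x" 2] by (simp add: bump_def psi_def power2_norm_eq_inner[symmetric] del: one_le_power)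

lemma test_functions_iff:
  "v \<in> test_functions \<longleftrightarrow> smooth v \<and> (\<exists>R. \<forall>x. norm x > R \<longrightarrow> v x = 0)"
proof -
  have "compact (closure (support_on UNIV v)) \<longleftrightarrow> (\<exists>R. \<forall>x. norm x > R \<longrightarrow> v x = 0)"
    unfolding compact_closure bounded_iff support_on_def by (auto simp: not_le[symmetric])
  then show ?thesis by (simp add: test_functions_def smooth_def)
qed

lemma test_functions_partial:
  assumes "v \<in> test_functions" shows "partial i v \<in> test_functions"
proof -
  obtain R where R: "\<And>x. norm x > R \<Longrightarrow> v x = 0" and v: "smooth v"
    using assms by (auto simp: test_functions_iff)
  have "partial i v x = 0" if "norm x > R" for x
  proof -
    have "open {x. R < norm x}" by (intro open_Collect_less continuous_intros)
    then have "(v has_derivative (\<lambda>h. 0)) (at x)"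
      by (rule has_derivative_transform_within_open[OF has_derivative_const[of 0]])
        (use that R in auto)
    then show ?thesis by (simp add: partial_eq)
  qed
  then show ?thesis using v by (auto simp: test_functions_iff smooth_partial)
qed

lemma test_functions_partials: "v \<in> test_functions \<Longrightarrow> partials is v \<in> test_functions"
  by (induction "is") (auto intro: test_functions_partial)

lemma test_functions_cutoff:
  assumes "smooth v" shows "(\<lambda>x. bump ((1 / real (Suc n)) *\<^sub>R x) * v x) \<in> test_functions"
  unfolding test_functions_iff
proof (intro conjI exI allI impI smooth_mult smooth_scaled smooth_bump assms)
  fix x :: "real ^ 'a" assume "norm x > real (Suc n)"
  then show "bump ((1 / real (Suc n)) *\<^sub>R x) * v x = 0"
    by (subst bump_outside) (auto simp: divide_simps)
qed

lemma cutoff_tendsto_1: "(\<lambda>n. bump ((1 / real (Suc n)) *\<^sub>R x)) \<longlonglongrightarrow> 1"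
proof -
  have "isCont bump (0::real^'a)"
    using smooth_continuous[OF smooth_bump] continuous_on_eq_continuous_at[OF open_UNIV, of bump] by blast
  moreover have "(\<lambda>n. (1 / real (Suc n)) *\<^sub>R x) \<longlonglongrightarrow> 0 *\<^sub>R x"
    by (intro tendsto_scaleR tendsto_const LIMSEQ_Suc[OF lim_1_over_n])
  ultimately show ?thesis using isCont_tendsto_compose[of 0 bump] by auto
qed

lemma smooth_real_polynomial_function:
  assumes "real_polynomial_function p" shows "smooth p"
  using assms
  by (induction) (auto simp: smooth_def intro: C_k_bounded_linear C_k_add C_k_mult)

text \<open>
  Functions all of whose partial derivatives are bounded and integrable: they contain the test
  functions and, unlike them, are preserved by convolution with an integrable kernel.
\<close>

definition nice :: "(real ^ 'n::finite \<Rightarrow> real) \<Rightarrow> bool" where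
  "nice f \<longleftrightarrow> smooth f \<and>
    (\<forall>is. (\<exists>C. \<forall>x. \<bar>partials is f x\<bar> \<le> C) \<and> integrable lborel (partials is f))"

lemma nice_smooth: "nice f \<Longrightarrow> smooth f"
  and nice_bounded: "nice f \<Longrightarrow> \<exists>C. \<forall>x. \<bar>f x\<bar> \<le> C"
  and nice_integrable: "nice f \<Longrightarrow> integrable lborel f"
  unfolding nice_def by (metis partials_Nil)+

lemma nice_continuous: "nice f \<Longrightarrow> continuous_on UNIV f"
  by (simp add: nice_smooth smooth_continuous)

lemma nice_differentiable: "nice f \<Longrightarrow> f differentiable (at x)"
  by (simp add: nice_smooth smooth_differentiable)

lemma nice_partial: "nice f \<Longrightarrow> nice (partial i f)"
  unfolding nice_def by (metis partials_Cons partials_Nil partials_append smooth_partial)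

lemma nice_partials: "nice f \<Longrightarrow> nice (partials is f)"
  by (induction "is") (auto intro: nice_partial)

lemma nice_measurable [measurable_dest]: "nice f \<Longrightarrow> f \<in> borel_measurable borel"
  by (simp add: borel_measurable_continuous_onI nice_continuous)

lemma test_functions_nice:
  assumes "v \<in> test_functions" shows "nice v"
proof -
  have "(\<exists>C. \<forall>x. \<bar>w x\<bar> \<le> C) \<and> integrable lborel w" if tw: "w \<in> test_functions" for w :: "real ^ 'a \<Rightarrow> real"
  proof -
    obtain R where R: "\<And>x. norm x > R \<Longrightarrow> w x = 0" and w: "smooth w"
      using tw by (auto simp: test_functions_iff)
    have c: "continuous_on (cball 0 R) w" using smooth_continuous[OF w] continuous_on_subset by blast
    then have "bounded (w ` cball 0 R)" by (intro compact_imp_bounded compact_continuous_image) auto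
    then obtain C where C: "\<And>x. x \<in> cball 0 R \<Longrightarrow> \<bar>w x\<bar> \<le> C"
      by (metis bounded_iff image_eqI real_norm_def)
    have "\<bar>w x\<bar> \<le> max C 0" for x
      using C[of x] R[of x] by (cases "norm x \<le> R") (auto simp: max_def)
    moreover have "integrable lborel (\<lambda>x. indicator (cball 0 R) x *\<^sub>R w x)"
      by (rule borel_integrable_compact) (auto simp: c)
    moreover have "(\<lambda>x. indicator (cball 0 R) x *\<^sub>R w x) = w"
      using R by (force simp: indicator_def)
    ultimately show ?thesis by auto
  qed
  moreover have "smooth v" using assms by (simp add: test_functions_iff)
  ultimately show ?thesis
    using test_functions_partials[OF assms] unfolding nice_def by blast
qed

section \<open>Change of variables and integration by parts\<close>

lemma borel_measurable_coordinate [measurable]: "(\<lambda>x::real^'n::finite. x $ i) \<in> borel_measurable borel"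
  by (intro borel_measurable_continuous_onI continuous_intros)

lemma nn_integral_affine:
  fixes f :: "'a::euclidean_space \<Rightarrow> ennreal"
  assumes [measurable]: "f \<in> borel_measurable borel" and c: "c \<noteq> 0"
  shows "(\<integral>\<^sup>+x. f x \<partial>lborel) = ennreal (\<bar>c\<bar> ^ DIM('a)) * (\<integral>\<^sup>+x. f (t + c *\<^sub>R x) \<partial>lborel)"
  by (subst lborel_affine[OF c, of t])
     (simp add: nn_integral_density nn_integral_distr nn_integral_cmult)

lemma integrable_affine:
  fixes f :: "'a::euclidean_space \<Rightarrow> real"
  assumes [measurable]: "f \<in> borel_measurable borel" and c: "c \<noteq> 0"
  shows "integrable lborel (\<lambda>x. f (t + c *\<^sub>R x)) \<longleftrightarrow> integrable lborel f"
proof -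
  have "integrable lborel f \<longleftrightarrow> integrable (density (distr lborel borel (\<lambda>x. t + c *\<^sub>R x)) (\<lambda>_. \<bar>c\<bar> ^ DIM('a))) f"
    by (subst lborel_affine[OF c, of t]) simp
  also have "\<dots> \<longleftrightarrow> integrable lborel (\<lambda>x. f (t + c *\<^sub>R x))"
    using c by (subst integrable_density) (auto simp: integrable_distr_eq)
  finally show ?thesis by simp
qed

lemma integral_affine:
  fixes f :: "'a::euclidean_space \<Rightarrow> real"
  assumes [measurable]: "f \<in> borel_measurable borel" and c: "c \<noteq> 0"
  shows "(LINT x|lborel. f x) = \<bar>c\<bar> ^ DIM('a) * (LINT x|lborel. f (t + c *\<^sub>R x))"
proof -
  have "(LINT x|lborel. f x) = (LINT x|density (distr lborel borel (\<lambda>x. t + c *\<^sub>R x)) (\<lambda>_. \<bar>c\<bar> ^ DIM('a)). f x)"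
    by (subst lborel_affine[OF c, of t]) simp
  also have "\<dots> = \<bar>c\<bar> ^ DIM('a) * (LINT x|lborel. f (t + c *\<^sub>R x))"
    by (subst integral_density) (auto simp: integral_distr)
  finally show ?thesis .
qed

lemma integrable_reflect:
  fixes f :: "'a::euclidean_space \<Rightarrow> real"
  assumes [measurable]: "f \<in> borel_measurable borel"
  shows "integrable lborel (\<lambda>y. f (x - y)) \<longleftrightarrow> integrable lborel f"
  using integrable_affine[of f "-1" x] by simp

lemma integral_reflect:
  fixes f :: "'a::euclidean_space \<Rightarrow> real"
  assumes [measurable]: "f \<in> borel_measurable borel"
  shows "(LINT y|lborel. f (x - y)) = (LINT y|lborel. f y)"
  using integral_affine[of f "-1" x] by simp

lemma integrable_pairI:
  fixes h :: "'a::euclidean_space \<Rightarrow> 'b::euclidean_space \<Rightarrow> real"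
  assumes [measurable]: "case_prod h \<in> borel_measurable (borel \<Otimes>\<^sub>M borel)"
    and le: "\<And>s. (\<integral>\<^sup>+x. ennreal \<bar>h s x\<bar> \<partial>lborel) \<le> W s"
    and fin: "(\<integral>\<^sup>+s. W s \<partial>lborel) < \<infinity>"
  shows "integrable (lborel \<Otimes>\<^sub>M lborel) (case_prod h)"
proof (rule integrableI_bounded)
  show "case_prod h \<in> borel_measurable (lborel \<Otimes>\<^sub>M lborel)" by measurable
  have "(\<integral>\<^sup>+x. ennreal (norm (case_prod h x)) \<partial>(lborel \<Otimes>\<^sub>M lborel)) = (\<integral>\<^sup>+s. \<integral>\<^sup>+x. ennreal \<bar>h s x\<bar> \<partial>lborel \<partial>lborel)"
    by (subst lborel.nn_integral_fst[symmetric]) (auto simp: split_beta)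
  also have "\<dots> \<le> (\<integral>\<^sup>+s. W s \<partial>lborel)" by (intro nn_integral_mono le)
  finally show "(\<integral>\<^sup>+x. ennreal (norm (case_prod h x)) \<partial>(lborel \<Otimes>\<^sub>M lborel)) < \<infinity>" using fin by simp
qed

lemma nn_integral_abs_finite:
  fixes f :: "'a \<Rightarrow> real"
  shows "integrable M f \<Longrightarrow> (\<integral>\<^sup>+x. ennreal \<bar>f x\<bar> \<partial>M) < \<infinity>"
  by (simp add: integrable_iff_bounded)

lemma integrable_tensor:
  fixes f :: "'a::euclidean_space \<Rightarrow> real" and g :: "'b::euclidean_space \<Rightarrow> real"
  assumes f: "integrable lborel f" and g: "integrable lborel g"
  shows "integrable (lborel \<Otimes>\<^sub>M lborel) (\<lambda>(x, y). f x * g y)"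
proof -
  have [measurable]: "f \<in> borel_measurable borel" "g \<in> borel_measurable borel"
    using f g borel_measurable_integrable by auto
  show ?thesis
  proof (rule integrable_pairI)
    show "(\<integral>\<^sup>+y. ennreal \<bar>f x * g y\<bar> \<partial>lborel) \<le> ennreal \<bar>f x\<bar> * (\<integral>\<^sup>+y. ennreal \<bar>g y\<bar> \<partial>lborel)" for x
      by (simp add: abs_mult ennreal_mult nn_integral_cmult)
    show "(\<integral>\<^sup>+x. ennreal \<bar>f x\<bar> * (\<integral>\<^sup>+y. ennreal \<bar>g y\<bar> \<partial>lborel) \<partial>lborel) < \<infinity>"
      using nn_integral_abs_finite[OF f] nn_integral_abs_finite[OF g]
      by (simp add: nn_integral_multc ennreal_mult_less_top)
  qed measurable
qed

lemma integrable_times_bounded: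
  fixes f g :: "'a \<Rightarrow> real"
  assumes "integrable M f" "g \<in> borel_measurable M" "\<And>x. \<bar>g x\<bar> \<le> C"
  shows "integrable M (\<lambda>x. f x * g x)"
proof (rule Bochner_Integration.integrable_bound[of _ "\<lambda>x. C * f x"])
  show "integrable M (\<lambda>x. C * f x)" using assms by simp
  have "0 \<le> C" using assms(3) abs_ge_zero order_trans by blast
  then show "AE x in M. norm (f x * g x) \<le> norm (C * f x)"
    using assms(3) by (auto simp: abs_mult mult.commute[of C] intro!: mult_left_mono AE_I2)
qed (use assms in measurable)

text \<open>
  By translation invariance \<open>F(x + e\<^sub>i) - F(x)\<close> has integral zero. The difference is the integral of
  \<open>\<partial>\<^sub>i F\<close> along a unit segment, so by Fubini its integral is also that of \<open>\<partial>\<^sub>i F\<close>.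
\<close>

lemma integral_partial_eq_0:
  fixes F :: "real ^ 'n::finite \<Rightarrow> real"
  assumes F: "integrable lborel F" "\<And>x. F differentiable (at x)"
    and G: "integrable lborel (partial i F)" "continuous_on UNIV (partial i F)"
  shows "(LINT x|lborel. partial i F x) = 0"
proof -
  define e :: "real ^ 'n" where "e = axis i 1"
  have [measurable]: "F \<in> borel_measurable borel" "partial i F \<in> borel_measurable borel"
    using F(1) G(1) borel_measurable_integrable by auto
  \<comment> \<open>The derivative of \<open>F\<close> along the segment from \<open>x\<close> to \<open>x + e\<close>.\<close>
  define h where "h s x = indicator {0..1} s * partial i F (x + s *\<^sub>R e)" for s x
  have hm: "case_prod h \<in> borel_measurable (borel \<Otimes>\<^sub>M borel)" unfolding h_def by measurable
  have int: "integrable (lborel \<Otimes>\<^sub>M lborel) (case_prod h)"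
  proof (rule integrable_pairI[OF hm])
    fix s
    have "(\<integral>\<^sup>+x. ennreal \<bar>h s x\<bar> \<partial>lborel) \<le> indicator {0..1} s * (\<integral>\<^sup>+x. ennreal \<bar>partial i F (x + s *\<^sub>R e)\<bar> \<partial>lborel)"
      by (auto simp: h_def indicator_def)
    also have "(\<integral>\<^sup>+x. ennreal \<bar>partial i F (x + s *\<^sub>R e)\<bar> \<partial>lborel) = (\<integral>\<^sup>+x. ennreal \<bar>partial i F x\<bar> \<partial>lborel)"
      by (subst nn_integral_affine[of "\<lambda>x. ennreal \<bar>partial i F x\<bar>" 1 "s *\<^sub>R e"]) (auto simp: add.commute)
    finally show "(\<integral>\<^sup>+x. ennreal \<bar>h s x\<bar> \<partial>lborel) \<le> indicator {0..1} s * (\<integral>\<^sup>+x. ennreal \<bar>partial i F x\<bar> \<partial>lborel)" .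
  next
    show "(\<integral>\<^sup>+s. indicator {0..1::real} s * (\<integral>\<^sup>+x. ennreal \<bar>partial i F x\<bar> \<partial>lborel) \<partial>lborel) < \<infinity>"
      using nn_integral_abs_finite[OF G(1)] by (simp add: nn_integral_multc)
  qed
  have inner: "(LINT s|lborel. h s x) = F (x + e) - F x" for x
  proof -
    have D: "((\<lambda>s. F (x + s *\<^sub>R e)) has_real_derivative partial i F (x + s *\<^sub>R e)) (at s)" for s
    proof -
      obtain D where D: "(F has_derivative D) (at (x + s *\<^sub>R e))" using F(2) by (auto simp: differentiable_def)
      interpret bounded_linear D by (rule has_derivative_bounded_linear[OF D])
      have "((\<lambda>s. F (x + s *\<^sub>R e)) has_derivative (\<lambda>t. D (t *\<^sub>R e))) (at s)"
        by (rule has_derivative_compose[where f="\<lambda>s. x + s *\<^sub>R e", OF _ D]) (auto intro!: derivative_eq_intros)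
      moreover have "partial i F (x + s *\<^sub>R e) = D e" using partial_eq[OF D, of i] by (simp add: e_def)
      ultimately show ?thesis by (simp add: scaleR has_field_derivative_def mult_commute_abs)
    qed
    have "(LBINT s. partial i F (x + s *\<^sub>R e) * indicator {0..1} s) = F (x + 1 *\<^sub>R e) - F (x + 0 *\<^sub>R e)"
      using D
      by (intro integral_FTC_Icc_real)
        (auto intro!: continuous_intros continuous_on_interior[OF continuous_on_compose2[OF G(2)], of UNIV])
    then show ?thesis by (simp add: h_def mult.commute)
  qed
  have outer: "(LINT x|lborel. h s x) = indicator {0..1} s * (LINT x|lborel. partial i F x)" for s
    using integral_affine[of "partial i F" 1 "s *\<^sub>R e"] by (simp add: h_def add.commute)
  have "(LINT s|lborel. (LINT x|lborel. h s x)) = (LINT x|lborel. partial i F x)"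
    unfolding outer by simp
  moreover have "(LINT s|lborel. (LINT x|lborel. h s x)) = (LINT x|lborel. (LINT s|lborel. h s x))"
    using lborel_pair.Fubini_integral[OF int] by simp
  moreover have "(LINT x|lborel. (LINT s|lborel. h s x)) = (LINT x|lborel. F (x + e)) - (LINT x|lborel. F x)"
    unfolding inner
    by (subst Bochner_Integration.integral_diff)
      (use F(1) integrable_affine[of F 1 e] in \<open>auto simp: add.commute\<close>)
  moreover have "(LINT x|lborel. F (x + e)) = (LINT x|lborel. F x)"
    using integral_affine[of F 1 e] by (simp add: add.commute)
  ultimately show ?thesis by simp
qed

lemma integration_by_parts:
  fixes f g :: "real ^ 'n::finite \<Rightarrow> real"
  assumes f: "\<And>x. f differentiable (at x)" "continuous_on UNIV (partial i f)"
    and g: "\<And>x. g differentiable (at x)" "continuous_on UNIV (partial i g)"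
    and int: "integrable lborel (\<lambda>x. f x * g x)" "integrable lborel (\<lambda>x. partial i f x * g x)"
      "integrable lborel (\<lambda>x. f x * partial i g x)"
  shows "(LINT x|lborel. partial i f x * g x) = - (LINT x|lborel. f x * partial i g x)"
proof -
  have eq: "partial i (\<lambda>x. f x * g x) = (\<lambda>x. partial i f x * g x + f x * partial i g x)"
    by (auto intro!: ext partial_mult f g)
  have "continuous_on UNIV f" "continuous_on UNIV g"
    using f g by (auto intro!: continuous_at_imp_continuous_on differentiable_imp_continuous_within)
  then have "(LINT x|lborel. partial i (\<lambda>x. f x * g x) x) = 0"
    using assms by (intro integral_partial_eq_0) (auto simp: eq intro!: continuous_intros)
  then show ?thesis using int unfolding eq by simp
qed

lemma nice_times_integrable:
  assumes "nice f" "nice g" shows "integrable lborel (\<lambda>x. f x * g x)"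
proof -
  obtain C where "\<And>x. \<bar>g x\<bar> \<le> C" using nice_bounded[OF assms(2)] by auto
  then show ?thesis using assms
    by (intro integrable_times_bounded[of _ _ _ C]) (auto intro: nice_integrable dest: nice_measurable)
qed

lemma nice_integration_by_parts:
  assumes "nice f" "nice g"
  shows "(LINT x|lborel. partial i f x * g x) = - (LINT x|lborel. f x * partial i g x)"
  using assms
  by (intro integration_by_parts nice_times_integrable nice_continuous nice_differentiable nice_partial)

section \<open>Convolution\<close>

definition conv :: "(real ^ 'n::finite \<Rightarrow> real) \<Rightarrow> (real ^ 'n \<Rightarrow> real) \<Rightarrow> real ^ 'n \<Rightarrow> real" where
  "conv K f x = (LINT y|lborel. K y * f (x - y))"

lemma conv_measurable [measurable (raw)]:
  fixes K f :: "real ^ 'n::finite \<Rightarrow> real"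
  assumes [measurable]: "K \<in> borel_measurable borel" "f \<in> borel_measurable borel"
  shows "conv K f \<in> borel_measurable borel"
  unfolding conv_def[abs_def] by measurable

lemma conv_commute:
  fixes K f :: "real ^ 'n::finite \<Rightarrow> real"
  assumes [measurable]: "K \<in> borel_measurable borel" "f \<in> borel_measurable borel"
  shows "conv K f x = conv f K x"
  using integral_reflect[of "\<lambda>y. K y * f (x - y)" x] by (simp add: conv_def mult.commute)

lemma integrable_conv_pair:
  fixes K f :: "real ^ 'n::finite \<Rightarrow> real"
  assumes K: "integrable lborel K" and f: "integrable lborel f"
  shows "integrable (lborel \<Otimes>\<^sub>M lborel) (\<lambda>(y, x). K y * f (x - y))"
proof -
  have [measurable]: "K \<in> borel_measurable borel" "f \<in> borel_measurable borel"
    using K f borel_measurable_integrable by auto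
  show ?thesis
  proof (rule integrable_pairI)
    fix y :: "real ^ 'n"
    have "(\<integral>\<^sup>+x. ennreal \<bar>f (x - y)\<bar> \<partial>lborel) = (\<integral>\<^sup>+x. ennreal \<bar>f x\<bar> \<partial>lborel)"
      by (subst nn_integral_affine[of "\<lambda>x. ennreal \<bar>f x\<bar>" 1 "- y"]) auto
    then show "(\<integral>\<^sup>+x. ennreal \<bar>K y * f (x - y)\<bar> \<partial>lborel) \<le> ennreal \<bar>K y\<bar> * (\<integral>\<^sup>+x. ennreal \<bar>f x\<bar> \<partial>lborel)"
      by (simp add: abs_mult ennreal_mult nn_integral_cmult)
  next
    show "(\<integral>\<^sup>+y. ennreal \<bar>K y\<bar> * (\<integral>\<^sup>+x. ennreal \<bar>f x\<bar> \<partial>lborel) \<partial>lborel) < \<infinity>"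
      using nn_integral_abs_finite[OF K] nn_integral_abs_finite[OF f]
      by (simp add: nn_integral_multc ennreal_mult_less_top)
  qed measurable
qed

lemma integrable_conv:
  fixes K f :: "real ^ 'n::finite \<Rightarrow> real"
  assumes "integrable lborel K" "integrable lborel f"
  shows "integrable lborel (conv K f)"
  using lborel_pair.integrable_snd[OF integrable_conv_pair[OF assms]] by (simp add: conv_def[abs_def])

lemma AE_integrable_conv:
  fixes K f :: "real ^ 'n::finite \<Rightarrow> real"
  assumes "integrable lborel K" "integrable lborel f"
  shows "AE x in lborel. integrable lborel (\<lambda>y. K y * f (x - y))"
  using lborel_pair.AE_integrable_snd[OF integrable_conv_pair[OF assms]] by simp

lemma integrable_conv_bounded:
  fixes K f :: "real ^ 'n::finite \<Rightarrow> real"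
  assumes "integrable lborel K" "f \<in> borel_measurable borel" "\<And>x. \<bar>f x\<bar> \<le> C"
  shows "integrable lborel (\<lambda>y. K y * f (x - y))"
  by (rule integrable_times_bounded) (use assms in auto)

lemma conv_bound:
  fixes K f :: "real ^ 'n::finite \<Rightarrow> real"
  assumes K: "integrable lborel K" and "f \<in> borel_measurable borel" "\<And>x. \<bar>f x\<bar> \<le> C"
  shows "\<bar>conv K f x\<bar> \<le> (LINT y|lborel. \<bar>K y\<bar>) * C"
proof -
  have "\<bar>conv K f x\<bar> \<le> (LINT y|lborel. \<bar>K y * f (x - y)\<bar>)"
    unfolding conv_def by (rule integral_abs_bound)
  also have "\<dots> \<le> (LINT y|lborel. \<bar>K y\<bar> * C)"
    using integrable_abs[OF integrable_conv_bounded[OF assms], of x] K assms(3)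
    by (intro integral_mono) (auto simp: abs_mult intro!: mult_left_mono)
  finally show ?thesis by simp
qed

lemma bounded_partials_lipschitz:
  fixes f :: "real ^ 'n::finite \<Rightarrow> real" and C :: real
  assumes S: "convex S" "x \<in> S" "y \<in> S" and diff: "\<And>x. x \<in> S \<Longrightarrow> f differentiable (at x)"
    and bd: "\<And>i x. x \<in> S \<Longrightarrow> \<bar>partial i f x\<bar> \<le> C"
  shows "\<bar>f x - f y\<bar> \<le> CARD('n) * C * norm (x - y)"
proof -
  have "norm (f x - f y) \<le> (CARD('n) * C) * norm (x - y)"
  proof (rule differentiable_bound[OF S(1) _ _ S(2,3)])
    fix z assume z: "z \<in> S"
    show "(f has_derivative (\<lambda>h. \<Sum>i\<in>UNIV. h $ i * partial i f z)) (at z within S)"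
      using has_derivative_partials[OF diff[OF z]] by (rule has_derivative_at_withinI)
    show "onorm (\<lambda>h. \<Sum>i\<in>UNIV. h $ i * partial i f z) \<le> CARD('n) * C"
    proof (rule onorm_le)
      fix h :: "real ^ 'n"
      have "norm (\<Sum>i\<in>UNIV. h $ i * partial i f z) \<le> (\<Sum>i\<in>UNIV. norm (h $ i * partial i f z))" by (rule norm_sum)
      also have "\<dots> \<le> (\<Sum>i\<in>(UNIV::'n set). norm h * C)"
        using bd[OF z] by (intro sum_mono) (auto simp: abs_mult intro!: mult_mono component_le_norm_cart)
      finally show "norm (\<Sum>i\<in>UNIV. h $ i * partial i f z) \<le> CARD('n) * C * norm h" by (simp add: mult_ac)
    qed
  qed
  then show ?thesis by simp
qed

lemma nice_partials_bound:
  fixes f :: "real ^ 'n::finite \<Rightarrow> real"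
  assumes "nice f"
  obtains C where "0 \<le> C" "\<And>i x. \<bar>partial i f x\<bar> \<le> C" "\<And>i j x. \<bar>partial i (partial j f) x\<bar> \<le> C"
proof -
  have "\<forall>i. \<exists>C. \<forall>x. \<bar>partial i f x\<bar> \<le> C" "\<forall>p. \<exists>C. \<forall>x. \<bar>partial (fst p) (partial (snd p) f) x\<bar> \<le> C"
    using nice_bounded nice_partial assms by blast+
  then obtain C D where C: "\<And>i x. \<bar>partial i f x\<bar> \<le> C i"
    and D: "\<And>i j x. \<bar>partial i (partial j f) x\<bar> \<le> D (i, j)"
    by (metis fst_conv snd_conv)
  show ?thesis
  proof (rule that[of "(\<Sum>i\<in>UNIV. \<bar>C i\<bar>) + (\<Sum>p\<in>UNIV. \<bar>D p\<bar>)"])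
    show "0 \<le> (\<Sum>i\<in>UNIV. \<bar>C i\<bar>) + (\<Sum>p\<in>UNIV. \<bar>D p\<bar>)" by (intro add_nonneg_nonneg sum_nonneg) auto
    have c: "\<bar>C i\<bar> \<le> (\<Sum>i\<in>UNIV. \<bar>C i\<bar>)" for i by (rule member_le_sum) auto
    have d: "\<bar>D p\<bar> \<le> (\<Sum>p\<in>UNIV. \<bar>D p\<bar>)" for p by (rule member_le_sum) auto
    fix i j x
    show "\<bar>partial i f x\<bar> \<le> (\<Sum>i\<in>UNIV. \<bar>C i\<bar>) + (\<Sum>p\<in>UNIV. \<bar>D p\<bar>)" using C[of i x] c[of i] d[of "(i,i)"] by linarith
    show "\<bar>partial i (partial j f) x\<bar> \<le> (\<Sum>i\<in>UNIV. \<bar>C i\<bar>) + (\<Sum>p\<in>UNIV. \<bar>D p\<bar>)"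
      using D[of i j x] d[of "(i,j)"] c[of i] by linarith
  qed
qed

text \<open>
  The remainder is quadratic with a constant independent of \<open>x\<close>; this uniformity is what allows
  differentiation under a convolution with a merely integrable kernel.
\<close>

lemma taylor_bound:
  fixes f :: "real ^ 'n::finite \<Rightarrow> real"
  assumes f: "nice f"
  obtains C where "\<And>x h. \<bar>f (x + h) - f x - (\<Sum>i\<in>UNIV. h $ i * partial i f x)\<bar> \<le> C * (norm h)\<^sup>2"
proof -
  obtain C where C: "0 \<le> C" "\<And>i j x. \<bar>partial i (partial j f) x\<bar> \<le> C"
    using nice_partials_bound[OF f] by metis
  define N where "N = real CARD('n)"
  have "\<bar>f (x + h) - f x - (\<Sum>i\<in>UNIV. h $ i * partial i f x)\<bar> \<le> (N * N * C) * (norm h)\<^sup>2" for x h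
  proof -
    \<comment> \<open>Subtracting the linear part at \<open>x\<close> leaves a function whose gradient on the ball of radius
      \<open>|h|\<close> is of size \<open>|h|\<close>.\<close>
    define g where "g y = f y + (\<Sum>i\<in>UNIV. y $ i * (- partial i f x))" for y
    have L: "((\<lambda>y. \<Sum>i\<in>UNIV. y $ i * (- partial i f x)) has_derivative (\<lambda>v. \<Sum>i\<in>UNIV. v $ i * (- partial i f x))) (at y)" for y
      by (intro bounded_linear_imp_has_derivative bounded_linear_sum bounded_linear_mult_left[THEN bounded_linear_compose] bounded_linear_vec_nth)
    have gd: "(g has_derivative (\<lambda>v. (\<Sum>i\<in>UNIV. v $ i * partial i f y) + (\<Sum>i\<in>UNIV. v $ i * (- partial i f x)))) (at y)" for y
      unfolding g_def by (intro has_derivative_add has_derivative_partials nice_differentiable f L)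
    have gp: "partial i g y = partial i f y - partial i f x" for i y
      by (subst partial_eq[OF gd]) (simp add: axis_def if_distrib[of "\<lambda>c. c * _"] sum_negf cong: if_cong)
    have "\<bar>g (x + h) - g x\<bar> \<le> CARD('n) * (N * C * norm h) * norm ((x + h) - x)"
    proof (rule bounded_partials_lipschitz[where S="cball x (norm h)" and f=g and x="x + h" and y=x and C="N * C * norm h"])
      fix i y assume y: "y \<in> cball x (norm h)"
      have "\<bar>partial i f y - partial i f x\<bar> \<le> CARD('n) * C * norm (y - x)"
        by (rule bounded_partials_lipschitz[where S=UNIV]) (auto intro: nice_differentiable nice_partial f C)
      also have "\<dots> \<le> CARD('n) * C * norm h"
        using y C(1) by (intro mult_left_mono) (auto simp: dist_norm norm_minus_commute)
      finally show "\<bar>partial i g y\<bar> \<le> N * C * norm h" by (simp add: gp N_def)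
    qed (use gd in \<open>auto simp: differentiable_def dist_norm\<close>)
    moreover have "g (x + h) - g x = f (x + h) - f x - (\<Sum>i\<in>UNIV. h $ i * partial i f x)"
      by (simp add: g_def sum_negf algebra_simps sum.distrib sum_subtractf)
    ultimately show ?thesis by (simp add: N_def power2_eq_square mult_ac)
  qed
  then show ?thesis using that by blast
qed

text \<open>
  The uniform quadratic remainder of \<open>f\<close>, integrated against \<open>K\<close>, is still quadratic.
\<close>

lemma conv_has_derivative:
  fixes f :: "real ^ 'n::finite \<Rightarrow> real"
  assumes K: "integrable lborel K" and f: "nice f"
  shows "(conv K f has_derivative (\<lambda>h. \<Sum>i\<in>UNIV. h $ i * conv K (partial i f) x)) (at x)"
  unfolding has_derivative_at
proof
  show "bounded_linear (\<lambda>h. \<Sum>i\<in>UNIV. h $ i * conv K (partial i f) x)"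
    by (intro bounded_linear_sum bounded_linear_mult_left[THEN bounded_linear_compose] bounded_linear_vec_nth)
  obtain C where C: "\<And>x h. \<bar>f (x + h) - f x - (\<Sum>i\<in>UNIV. h $ i * partial i f x)\<bar> \<le> C * (norm h)\<^sup>2"
    using taylor_bound[OF f] by blast
  have int: "integrable lborel (\<lambda>y. K y * g (x - y))" if g: "nice g" for g x
  proof -
    obtain D where "\<And>x. \<bar>g x\<bar> \<le> D" using nice_bounded[OF g] by blast
    then show ?thesis using integrable_conv_bounded[OF K] g by (metis nice_measurable)
  qed
  define A where "A = (LINT y|lborel. \<bar>K y\<bar>)"
  have bd: "norm (conv K f (x + h) - conv K f x - (\<Sum>i\<in>UNIV. h $ i * conv K (partial i f) x)) \<le> A * C * (norm h)\<^sup>2" for h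
  proof -
    have "conv K f (x + h) - conv K f x - (\<Sum>i\<in>UNIV. h $ i * conv K (partial i f) x)
      = (LINT y|lborel. K y * f (x + h - y) - K y * f (x - y) - (\<Sum>i\<in>UNIV. h $ i * (K y * partial i f (x - y))))"
      unfolding conv_def by (simp add: int f nice_partial)
    also have "\<dots> = (LINT y|lborel. K y * (f (x - y + h) - f (x - y) - (\<Sum>i\<in>UNIV. h $ i * partial i f (x - y))))"
      by (intro Bochner_Integration.integral_cong) (auto simp: algebra_simps sum_distrib_left intro!: sum.cong)
    also have "norm \<dots> \<le> (LINT y|lborel. \<bar>K y\<bar> * (C * (norm h)\<^sup>2))"
    proof (rule Bochner_Integration.integral_norm_bound_integral)
      have "integrable lborel (\<lambda>y. K y * f (x + h - y) - K y * f (x - y) - (\<Sum>i\<in>UNIV. h $ i * (K y * partial i f (x - y))))"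
        by (intro Bochner_Integration.integrable_diff Bochner_Integration.integrable_sum integrable_mult_right int f nice_partial)
      then show "integrable lborel (\<lambda>y. K y * (f (x - y + h) - f (x - y) - (\<Sum>i\<in>UNIV. h $ i * partial i f (x - y))))"
        by (rule Bochner_Integration.integrable_cong[THEN iffD1, rotated -1])
          (auto simp: algebra_simps sum_distrib_left intro!: sum.cong)
    qed (use K C in \<open>auto simp: abs_mult intro!: mult_left_mono\<close>)
    finally show ?thesis by (simp add: A_def mult_ac)
  qed
  have lim: "((\<lambda>h. A * C * norm h) \<longlongrightarrow> 0) (at (0::real^'n))"
    by (intro tendsto_mult_right_zero tendsto_norm_zero tendsto_ident_at)
  show "(\<lambda>h. norm (conv K f (x + h) - conv K f x - (\<Sum>i\<in>UNIV. h $ i * conv K (partial i f) x)) / norm h) \<midarrow>0\<rightarrow> 0"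
  proof (rule Lim_null_comparison[OF _ lim], intro eventuallyI)
    fix h
    show "norm (norm (conv K f (x + h) - conv K f x - (\<Sum>i\<in>UNIV. h $ i * conv K (partial i f) x)) / norm h) \<le> A * C * norm h"
      using bd[of h] by (cases "h = 0") (auto simp: divide_le_eq power2_eq_square mult_ac)
  qed
qed

lemma partial_conv:
  fixes K f :: "real ^ 'n::finite \<Rightarrow> real"
  assumes "integrable lborel K" "nice f"
  shows "partial i (conv K f) = conv K (partial i f)"
  by (rule ext, subst partial_eq[OF conv_has_derivative[OF assms]])
     (simp add: axis_def if_distrib[of "\<lambda>c. c * _"] cong: if_cong)

lemma partials_conv:
  fixes K f :: "real ^ 'n::finite \<Rightarrow> real"
  assumes "integrable lborel K" "nice f"
  shows "partials is (conv K f) = conv K (partials is f)"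
  using assms by (induction "is") (simp_all add: partial_conv nice_partials)

text \<open>
  All derivatives fall on \<open>f\<close>, so the convolutions of \<open>K\<close> with nice functions form a family closed
  under differentiation.
\<close>

lemma nice_conv:
  fixes K f :: "real ^ 'n::finite \<Rightarrow> real"
  assumes K: "integrable lborel K" and f: "nice f"
  shows "nice (conv K f)"
  unfolding nice_def partials_conv[OF assms]
proof (intro conjI allI)
  show "smooth (conv K f)"
  proof (rule smooth_coinduct[of "\<lambda>g. \<exists>f. nice f \<and> g = conv K f"])
    show "g differentiable (at x)" if ex: "\<exists>f. nice f \<and> g = conv K f" for g x
    proof -
      obtain f where "nice f" "g = conv K f" using ex by blast
      then show ?thesis using conv_has_derivative[OF K, of f x] differentiableI by blast
    qed
  qed (use f partial_conv[OF K] nice_partial in blast)+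
  fix "is"
  have n: "nice (partials is f)" by (rule nice_partials[OF f])
  then obtain C where "\<And>x. \<bar>partials is f x\<bar> \<le> C" using nice_bounded by blast
  then show "\<exists>C. \<forall>x. \<bar>conv K (partials is f) x\<bar> \<le> C"
    using conv_bound[OF K] n by (metis nice_measurable)
  show "integrable lborel (conv K (partials is f))"
    by (intro integrable_conv K nice_integrable n)
qed

section \<open>Scale mixtures of a profile\<close>

text \<open>
  The density of the product of a random scale with density \<open>w\<close> and a random vector with density \<open>r\<close>:
  a superposition of the dilates \<open>s\<^bsup>-N\<^esup> r(y / s)\<close>.
\<close>

definition mix :: "(real \<Rightarrow> real) \<Rightarrow> (real ^ 'n::finite \<Rightarrow> real) \<Rightarrow> real ^ 'n \<Rightarrow> real" where
  "mix w r y = (LINT s|lborel. w s / s ^ CARD('n) * r ((1 / s) *\<^sub>R y))"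

lemma mix_measurable [measurable (raw)]:
  fixes r :: "real ^ 'n::finite \<Rightarrow> real"
  assumes [measurable]: "w \<in> borel_measurable borel" "r \<in> borel_measurable borel"
  shows "mix w r \<in> borel_measurable borel"
  unfolding mix_def[abs_def] by measurable

context
  fixes w :: "real \<Rightarrow> real" and r :: "real ^ 'n::finite \<Rightarrow> real"
  assumes w: "integrable lborel w" and w0: "\<And>s. s \<le> 0 \<Longrightarrow> w s = 0" and r: "integrable lborel r"
begin

lemma mix_meas: "w \<in> borel_measurable borel" "r \<in> borel_measurable borel"
  using w r borel_measurable_integrable by auto

lemma integrable_mix_pair:
  "integrable (lborel \<Otimes>\<^sub>M lborel) (\<lambda>(s, y). w s / s ^ CARD('n) * r ((1 / s) *\<^sub>R y))"
proof -
  note [measurable] = mix_meas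
  show ?thesis
  proof (rule integrable_pairI)
    fix s :: real
    show "(\<integral>\<^sup>+y. ennreal \<bar>w s / s ^ CARD('n) * r ((1 / s) *\<^sub>R y)\<bar> \<partial>lborel) \<le> ennreal \<bar>w s\<bar> * (\<integral>\<^sup>+y. ennreal \<bar>r y\<bar> \<partial>lborel)"
    proof (cases "s > 0")
      case True
      have "(\<integral>\<^sup>+y. ennreal \<bar>w s / s ^ CARD('n) * r ((1 / s) *\<^sub>R y)\<bar> \<partial>lborel)
        = ennreal (\<bar>s\<bar> ^ CARD('n)) * (\<integral>\<^sup>+y. ennreal \<bar>w s / s ^ CARD('n) * r y\<bar> \<partial>lborel)"
        using True by (subst nn_integral_affine[of _ s 0]) auto
      also have "\<dots> = ennreal (\<bar>s\<bar> ^ CARD('n)) * ennreal (\<bar>w s\<bar> / \<bar>s\<bar> ^ CARD('n)) * (\<integral>\<^sup>+y. ennreal \<bar>r y\<bar> \<partial>lborel)"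
      proof -
        have "ennreal \<bar>w s / s ^ CARD('n) * r y\<bar> = ennreal (\<bar>w s\<bar> / \<bar>s\<bar> ^ CARD('n)) * ennreal \<bar>r y\<bar>" for y
          by (simp add: abs_mult power_abs flip: ennreal_mult)
        then show ?thesis by (simp add: nn_integral_cmult mult.assoc)
      qed
      also have "\<dots> = ennreal \<bar>w s\<bar> * (\<integral>\<^sup>+y. ennreal \<bar>r y\<bar> \<partial>lborel)"
        using True by (simp flip: ennreal_mult')
      finally show ?thesis by simp
    qed (simp add: w0)
  next
    show "(\<integral>\<^sup>+s. ennreal \<bar>w s\<bar> * (\<integral>\<^sup>+y. ennreal \<bar>r y\<bar> \<partial>lborel) \<partial>lborel) < \<infinity>"
      using nn_integral_abs_finite[OF w] nn_integral_abs_finite[OF r] mix_meas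
      by (simp add: nn_integral_multc ennreal_mult_less_top)
  qed measurable
qed

lemma integrable_mix: "integrable lborel (mix w r)"
  using lborel_pair.integrable_snd[OF integrable_mix_pair] by (simp add: mix_def[abs_def])

lemma AE_integrable_mix: "AE y in lborel. integrable lborel (\<lambda>s. w s / s ^ CARD('n) * r ((1 / s) *\<^sub>R y))"
  using lborel_pair.AE_integrable_snd[OF integrable_mix_pair] by simp

text \<open>
  Fubini and the substitution \<open>y = s z\<close>, which absorbs the factor \<open>s\<^bsup>-N\<^esup>\<close>.
\<close>

lemma conv_mix:
  assumes [measurable]: "f \<in> borel_measurable borel" and f: "\<And>x. \<bar>f x\<bar> \<le> C"
  shows "conv (mix w r) f x = (LINT s|lborel. w s * (LINT z|lborel. r z * f (x - s *\<^sub>R z)))"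
proof -
  note [measurable] = mix_meas
  define h where "h s y = w s / s ^ CARD('n) * r ((1 / s) *\<^sub>R y) * f (x - y)" for s y
  have int: "integrable (lborel \<Otimes>\<^sub>M lborel) (case_prod h)"
  proof -
    have "case_prod h = (\<lambda>p. (case p of (s, y) \<Rightarrow> w s / s ^ CARD('n) * r ((1 / s) *\<^sub>R y)) * f (x - snd p))"
      by (auto simp: h_def fun_eq_iff)
    then show ?thesis
      using integrable_times_bounded[OF integrable_mix_pair, of "\<lambda>p. f (x - snd p)" C] f by simp
  qed
  have "conv (mix w r) f x = (LINT y|lborel. LINT s|lborel. h s y)"
    by (simp only: conv_def mix_def h_def integral_mult_left_zero)
  also have eq: "\<dots> = (LINT s|lborel. LINT y|lborel. h s y)"
    using lborel_pair.Fubini_integral[OF int] by simp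
  have inner: "(LINT y|lborel. h s y) = w s * (LINT z|lborel. r z * f (x - s *\<^sub>R z))" for s
  proof (cases "s > 0")
    case True
    have "(LINT y|lborel. h s y) = \<bar>s\<bar> ^ CARD('n) * (LINT z|lborel. h s (0 + s *\<^sub>R z))"
    proof -
      have [measurable]: "h s \<in> borel_measurable borel" unfolding h_def[abs_def] by measurable
      show ?thesis using True integral_affine[of "h s" s 0] by (simp only: DIM_cart DIM_real mult_1_right) simp
    qed
    then show ?thesis using True by (simp add: h_def mult.assoc)
  qed (simp add: h_def w0)
  note eq
  finally show ?thesis unfolding inner .
qed

text \<open>
  In this order of integration the inner integral runs along the ray from \<open>x\<close> in direction \<open>- z\<close>, where
  the fundamental theorem of calculus is available.
\<close>

lemma conv_mix_swap:
  assumes [measurable]: "f \<in> borel_measurable borel" and f: "\<And>x. \<bar>f x\<bar> \<le> C"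
  shows "conv (mix w r) f x = (LINT z|lborel. r z * (LINT s|lborel. w s * f (x - s *\<^sub>R z)))" (is ?eq)
    and "integrable lborel (\<lambda>z. r z * (LINT s|lborel. w s * f (x - s *\<^sub>R z)))" (is ?int)
proof -
  note [measurable] = mix_meas
  define h where "h s z = w s * r z * f (x - s *\<^sub>R z)" for s z
  have "integrable (lborel \<Otimes>\<^sub>M lborel) (\<lambda>(s, z). w s * r z)"
    by (rule integrable_tensor[OF w r])
  then have "integrable (lborel \<Otimes>\<^sub>M lborel) (\<lambda>p. (case p of (s, z) \<Rightarrow> w s * r z) * f (x - fst p *\<^sub>R snd p))"
    by (rule integrable_times_bounded) (use f in auto)
  moreover have "(\<lambda>p. (case p of (s, z) \<Rightarrow> w s * r z) * f (x - fst p *\<^sub>R snd p)) = case_prod h"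
    by (auto simp: h_def fun_eq_iff)
  ultimately have int: "integrable (lborel \<Otimes>\<^sub>M lborel) (case_prod h)" by simp
  have 1: "(LINT z|lborel. h s z) = w s * (LINT z|lborel. r z * f (x - s *\<^sub>R z))" for s
    by (simp add: h_def mult.assoc)
  have 2: "(LINT s|lborel. h s z) = r z * (LINT s|lborel. w s * f (x - s *\<^sub>R z))" for z
    by (simp add: h_def mult.assoc mult.left_commute[of _ "r z"])
  show ?eq
    using lborel_pair.Fubini_integral[OF int] conv_mix[OF assms] unfolding 1 2 by simp
  show ?int
    using lborel_pair.integrable_snd[OF int] unfolding 2 .
qed

lemma mix_uminus:
  assumes "\<And>z. r (- z) = c * r z"
  shows "mix w r (- y) = c * mix w r y"
proof -
  have "w s / s ^ CARD('n) * r ((1 / s) *\<^sub>R - y) = c * (w s / s ^ CARD('n) * r ((1 / s) *\<^sub>R y))" for s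
    using assms[of "(1 / s) *\<^sub>R y"] by simp
  then show ?thesis by (simp only: mix_def integral_mult_right_zero)
qed

end

section \<open>The Gaussian profile\<close>

text \<open>
  On the shell \<open>n \<le> |x| < n + 1\<close>, whose volume is at most a multiple of \<open>(n + 1)\<^sup>N\<close>, the function is at
  most \<open>C / (n + 1)\<^bsup>N+2\<^esup>\<close>; the products are summable.
\<close>

lemma integrable_decay:
  fixes f :: "real ^ 'n::finite \<Rightarrow> real"
  assumes [measurable]: "f \<in> borel_measurable borel"
    and f: "\<And>x. \<bar>f x\<bar> * (1 + norm x) ^ (CARD('n) + 2) \<le> C"
  shows "integrable lborel f"
proof (rule integrableI_bounded)
  define p where "p = CARD('n) + 2"
  have C0: "0 \<le> C" using f[of 0] by simp
  define V where "V = unit_ball_vol (CARD('n))"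
  have V: "0 \<le> V" by (simp add: V_def)
  have bd: "ennreal (norm (f x)) \<le> (\<Sum>n. indicator (cball 0 (Suc n)) x * ennreal (C / real (Suc n) ^ p))" for x
  proof -
    define n where "n = nat \<lfloor>norm x\<rfloor>"
    have n1: "n \<le> norm x" unfolding n_def by (simp add: of_nat_floor)
    have n: "n \<le> norm x" "norm x \<le> Suc n" using n1 unfolding n_def by (simp, linarith)
    have "\<bar>f x\<bar> * real (Suc n) ^ p \<le> \<bar>f x\<bar> * (1 + norm x) ^ p"
      using n by (intro mult_left_mono power_mono) auto
    also have "\<dots> \<le> C" using f by (simp add: p_def)
    finally have "\<bar>f x\<bar> \<le> C / real (Suc n) ^ p" by (simp add: pos_le_divide_eq)
    then have "ennreal (norm (f x)) \<le> indicator (cball 0 (Suc n)) x * ennreal (C / real (Suc n) ^ p)"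
      using n by (simp add: ennreal_leI)
    also have "\<dots> \<le> (\<Sum>n. indicator (cball 0 (Suc n)) x * ennreal (C / real (Suc n) ^ p))"
    proof -
      have "F n \<le> (\<Sum>n. F n)" for F :: "nat \<Rightarrow> ennreal" and n
        using sum_le_suminf[of F "{n}"] by (simp add: summableI)
      from this[of "\<lambda>n. indicator (cball 0 (Suc n)) x * ennreal (C / real (Suc n) ^ p)"] show ?thesis .
    qed
    finally show ?thesis .
  qed
  have "(\<integral>\<^sup>+x. ennreal (norm (f x)) \<partial>lborel) \<le> (\<integral>\<^sup>+(x::real^'n). (\<Sum>n. indicator (cball 0 (Suc n)) x * ennreal (C / real (Suc n) ^ p)) \<partial>lborel)"
    by (intro nn_integral_mono bd)
  also have "\<dots> = (\<Sum>n. \<integral>\<^sup>+(x::real^'n). indicator (cball 0 (Suc n)) x * ennreal (C / real (Suc n) ^ p) \<partial>lborel)"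
    by (intro nn_integral_suminf borel_measurable_times_ennreal borel_measurable_indicator borel_measurable_const) auto
  also have "\<dots> = (\<Sum>n. ennreal (V * C * (1 / real (Suc n) ^ 2)))"
  proof (intro suminf_cong)
    fix n
    have "(\<integral>\<^sup>+x. indicator (cball 0 (Suc n)) (x::real^'n) * ennreal (C / real (Suc n) ^ p) \<partial>lborel)
      = ennreal (V * real (Suc n) ^ CARD('n)) * ennreal (C / real (Suc n) ^ p)"
      by (subst nn_integral_multc) (auto simp: emeasure_cball V_def intro!: borel_measurable_indicator)
    also have "\<dots> = ennreal ((V * real (Suc n) ^ CARD('n)) * (C / real (Suc n) ^ p))"
      using C0 V by (intro ennreal_mult[symmetric]) auto
    also have "(V * real (Suc n) ^ CARD('n)) * (C / real (Suc n) ^ p) = V * C * (1 / real (Suc n) ^ 2)"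
      by (simp add: p_def power_add power2_eq_square)
    finally show "(\<integral>\<^sup>+x. indicator (cball 0 (Suc n)) (x::real^'n) * ennreal (C / real (Suc n) ^ p) \<partial>lborel)
      = ennreal (V * C * (1 / real (Suc n) ^ 2))" .
  qed
  also have "\<dots> < \<infinity>"
  proof -
    have "summable (\<lambda>n. 1 / real n ^ 2)" by (rule inverse_power_summable[of 2, unfolded inverse_eq_divide]) simp
    then have "summable (\<lambda>n. 1 / real (Suc n) ^ 2)" by (subst summable_Suc_iff)
    then have "summable (\<lambda>n. V * C * (1 / real (Suc n) ^ 2))" by (rule summable_mult)
    then show ?thesis
      using C0 V by (subst suminf_ennreal2) auto
  qed
  finally show "(\<integral>\<^sup>+x. ennreal (norm (f x)) \<partial>lborel) < \<infinity>" .
qed simp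

text \<open>
  Since \<open>(1 + r)\<^sup>p \<le> e\<^bsup>p r\<^esup>\<close>, it suffices to complete the square in \<open>p r - b r\<^sup>2\<close>.
\<close>

lemma exp_quadratic_decay:
  fixes b :: real
  assumes b: "b > 0" and r: "r \<ge> 0"
  shows "exp (- b * r\<^sup>2) * (1 + r) ^ p \<le> exp (real p ^ 2 / (4 * b))"
proof -
  have "(1 + r) ^ p \<le> exp r ^ p" using r by (intro power_mono exp_ge_add_one_self) auto
  also have "\<dots> = exp (p * r)" by (simp add: exp_of_nat_mult)
  also have "\<dots> \<le> exp (b * r\<^sup>2 + real p ^ 2 / (4 * b))"
  proof -
    have "0 \<le> (2 * b * r - p)\<^sup>2 / (4 * b)" using b by simp
    also have "\<dots> = b * r\<^sup>2 + real p ^ 2 / (4 * b) - p * r"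
      using b by (simp add: field_simps power2_eq_square)
    finally show ?thesis by simp
  qed
  finally have "exp (- b * r\<^sup>2) * (1 + r) ^ p \<le> exp (- b * r\<^sup>2) * exp (b * r\<^sup>2 + real p ^ 2 / (4 * b))"
    by (intro mult_left_mono) auto
  then show ?thesis by (simp flip: exp_add)
qed

lemma integrable_gaussian:
  fixes b :: real
  assumes b: "b > 0"
  shows "integrable lborel (\<lambda>z::real^'n::finite. exp (- b * (norm z)\<^sup>2))"
    and "integrable lborel (\<lambda>z::real^'n::finite. z $ i * exp (- b * (norm z)\<^sup>2))"
proof -
  let ?C = "exp (real (CARD('n) + 3) ^ 2 / (4 * b))"
  have bd: "exp (- b * (norm z)\<^sup>2) * (1 + norm z) ^ (CARD('n) + 3) \<le> ?C" for z :: "real ^ 'n"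
    by (intro exp_quadratic_decay b) auto
  have mono: "(1 + norm z) ^ (CARD('n) + 2) \<le> (1 + norm z) ^ (CARD('n) + 3)" for z :: "real ^ 'n"
    by (intro power_increasing) auto
  show "integrable lborel (\<lambda>z::real^'n. exp (- b * (norm z)\<^sup>2))"
  proof (rule integrable_decay)
    show "\<bar>exp (- b * (norm z)\<^sup>2)\<bar> * (1 + norm z) ^ (CARD('n) + 2) \<le> ?C" for z :: "real ^ 'n"
      using order_trans[OF mult_left_mono[OF mono[of z], of "exp (- b * (norm z)\<^sup>2)"] bd[of z]] by simp
  qed measurable
  show "integrable lborel (\<lambda>z::real^'n. z $ i * exp (- b * (norm z)\<^sup>2))"
  proof (rule integrable_decay)
    fix z :: "real ^ 'n"
    have "\<bar>z $ i\<bar> \<le> 1 + norm z" using component_le_norm_cart[of z i] by simp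
    then have "\<bar>z $ i\<bar> * (exp (- b * (norm z)\<^sup>2) * (1 + norm z) ^ (CARD('n) + 2))
        \<le> (1 + norm z) * (exp (- b * (norm z)\<^sup>2) * (1 + norm z) ^ (CARD('n) + 2))"
      by (intro mult_right_mono) auto
    also have "\<dots> = exp (- b * (norm z)\<^sup>2) * (1 + norm z) ^ (CARD('n) + 3)"
      by (simp add: power_add numeral_eq_Suc)
    also have "\<dots> \<le> ?C" by (rule bd)
    finally show "\<bar>z $ i * exp (- b * (norm z)\<^sup>2)\<bar> * (1 + norm z) ^ (CARD('n) + 2) \<le> ?C"
      by (simp add: abs_mult mult.assoc)
  qed measurable
qed

text \<open>
  The heat kernel at time \<open>1\<close>. Its width is fixed by \<open>\<nabla> gauss(z) = - (z / 2) gauss(z)\<close>, the relation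
  through which the Laplacian enters.
\<close>

definition gauss :: "real ^ 'n::finite \<Rightarrow> real" where
  "gauss z = exp (- (1/4) * (norm z)\<^sup>2) / (LINT z|lborel. exp (- (1/4) * (norm (z::real^'n))\<^sup>2))"

definition dgauss :: "'n \<Rightarrow> real ^ 'n::finite \<Rightarrow> real" where
  "dgauss i z = - (z $ i / 2) * gauss z"

lemma gauss_measurable [measurable]: "gauss \<in> borel_measurable borel" "dgauss i \<in> borel_measurable borel"
  unfolding gauss_def[abs_def] dgauss_def[abs_def] by measurable

lemma integrable_gauss: "integrable lborel gauss"
  unfolding gauss_def[abs_def] by (intro integrable_divide integrable_gaussian) auto

lemma integrable_dgauss: "integrable lborel (dgauss (i :: 'n::finite))"
proof -
  let ?c = "LINT z|lborel. exp (- (1/4) * (norm (z::real^'n))\<^sup>2)"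
  have "dgauss i = (\<lambda>z. (- 1 / 2) * (z $ i * exp (- (1/4) * (norm z)\<^sup>2) / ?c))"
    by (rule ext) (simp add: dgauss_def gauss_def)
  moreover have "integrable lborel (\<lambda>z::real^'n. (- 1 / 2) * (z $ i * exp (- (1/4) * (norm z)\<^sup>2) / ?c))"
    by (intro integrable_mult_right integrable_divide integrable_gaussian) auto
  ultimately show ?thesis by simp
qed

lemma gauss_norm_pos: "0 < (LINT z|lborel. exp (- (1/4) * (norm (z::real^'n::finite))\<^sup>2))"
proof -
  have "(LINT z|lborel. exp (- (1/4) * (norm (z::real^'n))\<^sup>2)) \<noteq> 0"
  proof
    assume "(LINT z|lborel. exp (- (1/4) * (norm (z::real^'n))\<^sup>2)) = 0"
    then have "AE z::real^'n in lborel. exp (- (1/4) * (norm z)\<^sup>2) = 0"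
      using integral_nonneg_eq_0_iff_AE[OF integrable_gaussian(1)[of "1/4", where 'n='n]] by simp
    then have "AE z::real^'n in lborel. z \<notin> UNIV" by simp
    then have "UNIV \<in> null_sets (lborel :: (real^'n) measure)"
      using AE_iff_null_sets[of UNIV "lborel :: (real^'n) measure"] by simp
    then show False by (simp add: null_sets_def)
  qed
  moreover have "0 \<le> (LINT z|lborel. exp (- (1/4) * (norm (z::real^'n))\<^sup>2))" by simp
  ultimately show ?thesis by linarith
qed

lemma gauss_nonneg: "0 \<le> gauss z"
  unfolding gauss_def using gauss_norm_pos by (intro divide_nonneg_nonneg) auto

lemma integral_gauss: "(LINT z|lborel. gauss (z::real^'n::finite)) = 1"
  using gauss_norm_pos[where 'n='n] by (simp add: gauss_def)

lemma gauss_has_derivative: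
  "(gauss has_derivative (\<lambda>h. \<Sum>i\<in>UNIV. h $ i * dgauss i z)) (at (z::real^'n::finite))"
proof -
  let ?c = "LINT z|lborel. exp (- (1/4) * (norm (z::real^'n))\<^sup>2)"
  have g: "gauss = (\<lambda>z::real^'n. exp (- (1/4) * (z \<bullet> z)) / ?c)"
    by (auto simp: gauss_def power2_norm_eq_inner)
  have "((\<lambda>z::real^'n. exp (- (1/4) * (z \<bullet> z)) / ?c) has_derivative
    (\<lambda>h. exp (- (1/4) * (z \<bullet> z)) * (- (1/4) * (z \<bullet> h + h \<bullet> z)) / ?c)) (at z)"
    using gauss_norm_pos[where 'n='n]
    by (auto intro!: derivative_eq_intros simp: field_simps)
  moreover have "exp (- (1/4) * (z \<bullet> z)) * (- (1/4) * (z \<bullet> h + h \<bullet> z)) / ?c = (\<Sum>i\<in>UNIV. h $ i * dgauss i z)" for h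
  proof -
    have "(\<Sum>i\<in>UNIV. h $ i * dgauss i z) = (\<Sum>i\<in>UNIV. (z $ i * h $ i) * (- (1/2) * gauss z))"
      by (intro sum.cong) (auto simp: dgauss_def)
    also have "\<dots> = (z \<bullet> h) * (- (1/2) * gauss z)"
      unfolding inner_vec_def inner_real_def by (rule sum_distrib_right[symmetric])
    finally show ?thesis by (simp add: g inner_commute)
  qed
  ultimately show ?thesis unfolding g by simp
qed

lemma partial_gauss: "partial i gauss = dgauss i"
  by (rule ext, subst partial_eq[OF gauss_has_derivative])
     (simp add: axis_def if_distrib[of "\<lambda>c. c * _"] cong: if_cong)

lemma gauss_continuous: "continuous_on UNIV gauss" "continuous_on UNIV (dgauss i)"
proof -
  show "continuous_on UNIV gauss"
    by (intro continuous_at_imp_continuous_on ballI has_derivative_continuous[OF gauss_has_derivative])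
  then show "continuous_on UNIV (dgauss i)"
    unfolding dgauss_def[abs_def] by (intro continuous_intros) auto
qed

section \<open>The Bessel kernel\<close>

text \<open>
  The bound \<open>e\<^bsup>-s\<^sup>2\<^esup> \<le> e e\<^bsup>-s\<^esup>\<close> reduces this to the Gamma integral at \<open>e + 1 > 0\<close>.
\<close>

lemma integrable_powr_exp:
  assumes e: "e > -1"
  shows "integrable lborel (\<lambda>s::real. if s > 0 then s powr e * exp (- s\<^sup>2) else 0)"
proof (rule Bochner_Integration.integrable_bound)
  define f :: "real \<Rightarrow> real" where "f t = (if t \<in> {0..} then t powr e / exp t else 0)" for t
  have "((\<lambda>t. t powr ((e + 1) - 1) / exp t) has_integral Gamma (e + 1)) {0..}"
    using e by (intro Gamma_integral_real) auto
  then have "(f has_integral Gamma (e + 1)) UNIV"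
    unfolding f_def by (subst has_integral_restrict_UNIV) simp
  then have "(\<integral>\<^sup>+t. ennreal (f t) \<partial>lborel) = ennreal (Gamma (e + 1))"
    by (rule nn_integral_has_integral_lborel[rotated 2]) (auto simp: f_def[abs_def])
  moreover have "f \<in> borel_measurable borel" unfolding f_def[abs_def] by measurable
  ultimately have "integrable lborel f"
    by (intro integrableI_nonneg) (auto simp: f_def)
  also have "f = (\<lambda>t. indicator {0<..} t * (t powr e / exp t))"
    by (auto simp: f_def indicator_def fun_eq_iff)
  finally show "integrable lborel (\<lambda>t. exp 1 * (indicator {0<..} t * (t powr e / exp t)))"
    by (intro integrable_mult_right)
  show "AE s in lborel. norm (if s > 0 then s powr e * exp (- s\<^sup>2) else 0) \<le> norm (exp 1 * (indicator {0<..} s * (s powr e / exp s)))"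
  proof (intro AE_I2)
    fix s :: real
    have "s powr e * exp (- s\<^sup>2) \<le> exp 1 * (s powr e / exp s)" if "s > 0"
    proof -
      have "0 \<le> (s - 1/2)\<^sup>2" by simp
      then have "- s\<^sup>2 \<le> 1 - s" by (simp add: power2_eq_square algebra_simps)
      then have "exp (- s\<^sup>2) \<le> exp 1 / exp s" by (simp flip: exp_diff)
      then show ?thesis using mult_left_mono[of "exp (- s\<^sup>2)" "exp 1 / exp s" "s powr e"] by (simp add: mult_ac)
    qed
    then show "norm (if s > 0 then s powr e * exp (- s\<^sup>2) else 0) \<le> norm (exp 1 * (indicator {0<..} s * (s powr e / exp s)))"
      by (auto simp: indicator_def)
  qed
qed measurable

text \<open>
  With \<open>t = s\<^sup>2\<close> this is the weight \<open>e\<^bsup>-t\<^esup> dt\<close> in the formula that expresses the inverse of \<open>1 - \<Delta>\<close> through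
  the heat semigroup. Working with \<open>s\<close> instead of \<open>t\<close> makes \<open>f(x - s z)\<close> differentiable up to \<open>s = 0\<close>.
\<close>

definition bessel_weight :: "real \<Rightarrow> real" where
  "bessel_weight s = (if s > 0 then 2 * s * exp (- s\<^sup>2) else 0)"

definition dbessel_weight :: "real \<Rightarrow> real" where
  "dbessel_weight s = (if s > 0 then 2 * exp (- s\<^sup>2) else 0)"

lemma integrable_bessel_weight: "integrable lborel bessel_weight"
proof -
  have "bessel_weight = (\<lambda>s. 2 * (if s > 0 then s powr 1 * exp (- s\<^sup>2) else 0))"
    by (auto simp: bessel_weight_def)
  moreover have "integrable lborel \<dots>" by (intro integrable_mult_right integrable_powr_exp) simp
  ultimately show ?thesis by simp
qed

lemma integrable_dbessel_weight: "integrable lborel dbessel_weight"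
proof -
  have "dbessel_weight = (\<lambda>s. 2 * (if s > 0 then s powr 0 * exp (- s\<^sup>2) else 0))"
    by (auto simp: dbessel_weight_def)
  moreover have "integrable lborel \<dots>" by (intro integrable_mult_right integrable_powr_exp) simp
  ultimately show ?thesis by simp
qed

definition bessel :: "real ^ 'n::finite \<Rightarrow> real" where
  "bessel = mix bessel_weight gauss"

text \<open>
  The partial derivative of \<open>bessel\<close> away from the origin: differentiating a dilate costs a factor
  \<open>1 / s\<close>, which lowers the weight from \<open>2 s e\<^bsup>-s\<^sup>2\<^esup>\<close> to the still integrable \<open>2 e\<^bsup>-s\<^sup>2\<^esup>\<close>.
\<close>

definition dbessel :: "'n \<Rightarrow> real ^ 'n::finite \<Rightarrow> real" where
  "dbessel i = mix dbessel_weight (dgauss i)"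

lemma integrable_bessel: "integrable lborel bessel"
  and bessel_even: "bessel (- y) = bessel y"
  and integrable_dbessel: "integrable lborel (dbessel i)"
proof -
  show "integrable lborel bessel" "integrable lborel (dbessel i)"
    unfolding bessel_def dbessel_def
    by (intro integrable_mix integrable_bessel_weight integrable_dbessel_weight integrable_gauss integrable_dgauss;
        simp add: bessel_weight_def dbessel_weight_def)+
  have "bessel (- y) = 1 * bessel y" unfolding bessel_def
    by (rule mix_uminus[OF integrable_bessel_weight _ integrable_gauss]) (auto simp: bessel_weight_def gauss_def)
  then show "bessel (- y) = bessel y" by simp
qed

lemma bessel_nonneg: "0 \<le> bessel y"
  unfolding bessel_def mix_def
  by (intro integral_nonneg_AE AE_I2) (auto simp: bessel_weight_def gauss_nonneg)

lemma bessel_measurable [measurable]: "bessel \<in> borel_measurable borel" "dbessel i \<in> borel_measurable borel"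
  using borel_measurable_integrable[OF integrable_bessel] borel_measurable_integrable[OF integrable_dbessel] by auto

lemma conv_bessel:
  assumes "f \<in> borel_measurable borel" "\<And>x. \<bar>f x\<bar> \<le> C"
  shows "conv bessel f x = (LINT s|lborel. bessel_weight s * (LINT z|lborel. gauss z * f (x - s *\<^sub>R z)))"
  unfolding bessel_def
  by (rule conv_mix[OF integrable_bessel_weight _ integrable_gauss assms]) (simp add: bessel_weight_def)

lemma conv_dbessel:
  assumes "f \<in> borel_measurable borel" "\<And>x. \<bar>f x\<bar> \<le> C"
  shows "conv (dbessel i) f x = (LINT s|lborel. dbessel_weight s * (LINT z|lborel. dgauss i z * f (x - s *\<^sub>R z)))"
  unfolding dbessel_def
  by (rule conv_mix[OF integrable_dbessel_weight _ integrable_dgauss assms]) (simp add: dbessel_weight_def)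

section \<open>The Bessel kernel inverts one minus the Laplacian\<close>

lemma affine_argument_derivative:
  fixes f :: "real ^ 'n::finite \<Rightarrow> real"
  assumes "nice f"
  shows "(\<lambda>z. f (x - s *\<^sub>R z)) differentiable (at z)"
    and "partial i (\<lambda>z. f (x - s *\<^sub>R z)) z = - s * partial i f (x - s *\<^sub>R z)"
    and "((\<lambda>s. f (x - s *\<^sub>R z)) has_real_derivative - (\<Sum>i\<in>UNIV. z $ i * partial i f (x - s *\<^sub>R z))) (at s)"
proof -
  note D = has_derivative_partials[OF nice_differentiable[OF assms]]
  have 1: "((\<lambda>z. f (x - s *\<^sub>R z)) has_derivative (\<lambda>h. \<Sum>i\<in>UNIV. (- (s *\<^sub>R h)) $ i * partial i f (x - s *\<^sub>R z))) (at z)"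
    by (rule has_derivative_compose[where f="\<lambda>z. x - s *\<^sub>R z", OF _ D]) (auto intro!: derivative_eq_intros)
  then show "(\<lambda>z. f (x - s *\<^sub>R z)) differentiable (at z)" by (auto simp: differentiable_def)
  show "partial i (\<lambda>z. f (x - s *\<^sub>R z)) z = - s * partial i f (x - s *\<^sub>R z)"
    by (subst partial_eq[OF 1]) (simp add: axis_def if_distrib[of "\<lambda>c. _ * c"] if_distrib[of "\<lambda>c. c * _"] sum_negf cong: if_cong)
  have "((\<lambda>s. f (x - s *\<^sub>R z)) has_derivative (\<lambda>h. \<Sum>i\<in>UNIV. (- (h *\<^sub>R z)) $ i * partial i f (x - s *\<^sub>R z))) (at s)"
    by (rule has_derivative_compose[where f="\<lambda>s. x - s *\<^sub>R z", OF _ D]) (auto intro!: derivative_eq_intros)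
  moreover have "(\<lambda>h. \<Sum>i\<in>UNIV. (- (h *\<^sub>R z)) $ i * partial i f (x - s *\<^sub>R z))
      = (*) (- (\<Sum>i\<in>UNIV. z $ i * partial i f (x - s *\<^sub>R z)))"
    by (rule ext) (simp add: sum_negf sum_distrib_left sum_distrib_right mult_ac)
  ultimately show "((\<lambda>s. f (x - s *\<^sub>R z)) has_real_derivative - (\<Sum>i\<in>UNIV. z $ i * partial i f (x - s *\<^sub>R z))) (at s)"
    by (simp add: has_field_derivative_def)
qed

text \<open>
  Integration by parts in the variable \<open>z\<close> of the Gaussian moves the derivative from \<open>f(x - s z)\<close> to
  \<open>gauss\<close> and produces the factor \<open>1 / s\<close> that turns one weight into the other.
\<close>

lemma conv_bessel_partial:
  fixes f :: "real ^ 'n::finite \<Rightarrow> real"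
  assumes f: "nice f"
  shows "conv bessel (partial i f) = conv (dbessel i) f"
proof
  fix x
  obtain C where C: "\<And>x. \<bar>f x\<bar> \<le> C" using nice_bounded[OF f] by blast
  obtain D where D: "\<And>x. \<bar>partial i f x\<bar> \<le> D" using nice_bounded[OF nice_partial[OF f]] by blast
  have [measurable]: "f \<in> borel_measurable borel" "partial i f \<in> borel_measurable borel"
    using f nice_measurable nice_partial by blast+
  have "bessel_weight s * (LINT z|lborel. gauss z * partial i f (x - s *\<^sub>R z))
      = dbessel_weight s * (LINT z|lborel. dgauss i z * f (x - s *\<^sub>R z))" for s
  proof (cases "s > 0")
    case True
    let ?F = "\<lambda>z. f (x - s *\<^sub>R z)"
    have p: "partial i ?F = (\<lambda>z. - s * partial i f (x - s *\<^sub>R z))"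
      by (rule ext) (rule affine_argument_derivative[OF f])
    have c: "continuous_on UNIV (\<lambda>z. partial i f (x - s *\<^sub>R z))"
      by (intro continuous_on_compose2[OF nice_continuous[OF nice_partial[OF f]]] continuous_intros) auto
    have i: "integrable lborel (\<lambda>z. gauss z * partial i f (x - s *\<^sub>R z))"
      by (rule integrable_times_bounded[OF integrable_gauss]) (use D in auto)
    have "(LINT z|lborel. partial i gauss z * ?F z) = - (LINT z|lborel. gauss z * partial i ?F z)"
    proof (rule integration_by_parts)
      show "gauss differentiable at z" for z :: "real ^ 'n" using gauss_has_derivative by (auto simp: differentiable_def)
      show "continuous_on UNIV (partial i gauss)" by (simp add: partial_gauss gauss_continuous)
      show "?F differentiable at z" for z by (rule affine_argument_derivative[OF f])
      show "continuous_on UNIV (partial i ?F)" unfolding p by (intro continuous_intros c)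
      show "integrable lborel (\<lambda>z. gauss z * ?F z)"
        by (rule integrable_times_bounded[OF integrable_gauss]) (use C in auto)
      show "integrable lborel (\<lambda>z. partial i gauss z * ?F z)"
        unfolding partial_gauss by (rule integrable_times_bounded[OF integrable_dgauss]) (use C in auto)
      have "integrable lborel (\<lambda>z. (- s) * (gauss z * partial i f (x - s *\<^sub>R z)))"
        by (intro integrable_mult_right i)
      then show "integrable lborel (\<lambda>z. gauss z * partial i ?F z)"
        unfolding p by (simp add: mult.left_commute)
    qed
    also have "\<dots> = s * (LINT z|lborel. gauss z * partial i f (x - s *\<^sub>R z))"
      unfolding p by (simp add: mult.left_commute[of _ s])
    finally show ?thesis using True by (simp add: bessel_weight_def dbessel_weight_def partial_gauss)
  qed (simp add: bessel_weight_def dbessel_weight_def)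
  moreover have "conv bessel (partial i f) x
      = (LINT s|lborel. bessel_weight s * (LINT z|lborel. gauss z * partial i f (x - s *\<^sub>R z)))"
    by (rule conv_bessel[OF _ D]) measurable
  moreover have "conv (dbessel i) f x
      = (LINT s|lborel. dbessel_weight s * (LINT z|lborel. dgauss i z * f (x - s *\<^sub>R z)))"
    by (rule conv_dbessel[OF _ C]) measurable
  ultimately show "conv bessel (partial i f) x = conv (dbessel i) f x" by simp
qed

text \<open>
  The left-hand side is the integral of \<open>- d/ds (e\<^bsup>-s\<^sup>2\<^esup> f(x - s z))\<close> over \<open>s > 0\<close>.
\<close>

lemma radial_ftc:
  fixes f :: "real ^ 'n::finite \<Rightarrow> real"
  assumes f: "nice f"
  shows "(LINT s|lborel. bessel_weight s * f (x - s *\<^sub>R z))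
    + (\<Sum>i\<in>UNIV. z $ i / 2 * (LINT s|lborel. dbessel_weight s * partial i f (x - s *\<^sub>R z))) = f x"
proof -
  obtain C where C: "\<And>x. \<bar>f x\<bar> \<le> C" using nice_bounded[OF f] by blast
  obtain D where D: "\<And>i x. \<bar>partial i f x\<bar> \<le> D" using nice_partials_bound[OF f] by metis
  have [measurable]: "f \<in> borel_measurable borel" "partial i f \<in> borel_measurable borel" for i
    using f nice_measurable nice_partial by blast+
  have i1: "integrable lborel (\<lambda>s. bessel_weight s * f (x - s *\<^sub>R z))"
    by (rule integrable_times_bounded[OF integrable_bessel_weight]) (use C in auto)
  have i2: "integrable lborel (\<lambda>s. dbessel_weight s * partial i f (x - s *\<^sub>R z))" for i
    by (rule integrable_times_bounded[OF integrable_dbessel_weight]) (use D in auto)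
  \<comment> \<open>An antiderivative that vanishes at infinity and equals \<open>- f x\<close> at \<open>s = 0\<close>.\<close>
  define G where "G s = - (exp (- s\<^sup>2) * f (x - s *\<^sub>R z))" for s
  define g where "g s = exp (- s\<^sup>2) * (2 * s * f (x - s *\<^sub>R z) + (\<Sum>i\<in>UNIV. z $ i * partial i f (x - s *\<^sub>R z)))" for s
  have G: "(G has_real_derivative g s) (at s)" for s
    unfolding G_def g_def
    by (auto intro!: derivative_eq_intros affine_argument_derivative(3)[OF f] simp: algebra_simps)
  have eq: "indicator {0<..} s * g s = bessel_weight s * f (x - s *\<^sub>R z)
      + (\<Sum>i\<in>UNIV. z $ i / 2 * (dbessel_weight s * partial i f (x - s *\<^sub>R z)))" for s
    by (auto simp: g_def bessel_weight_def dbessel_weight_def indicator_def algebra_simps sum_distrib_left sum_distrib_right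
        intro!: sum.cong)
  have int: "integrable lborel (\<lambda>s. indicator {0<..} s * g s)"
    unfolding eq by (intro Bochner_Integration.integrable_add Bochner_Integration.integrable_sum integrable_mult_right i1 i2)
  have "(LBINT s=ereal 0..\<infinity>. g s) = 0 - (- f x)"
  proof (rule interval_integral_FTC_integrable)
    show "(G has_vector_derivative g s) (at s)" for s
      using G by (simp add: has_real_derivative_iff_has_vector_derivative)
    show "isCont g s" for s
    proof -
      have "continuous_on UNIV g"
        unfolding g_def
        by (intro continuous_intros continuous_on_compose2[OF nice_continuous[OF f]]
            continuous_on_compose2[OF nice_continuous[OF nice_partial[OF f]]]) auto
      then show ?thesis by (simp add: continuous_on_eq_continuous_at)
    qed
    show "set_integrable lborel (einterval (ereal 0) \<infinity>) g"
      using int by (simp add: set_integrable_def einterval_def greaterThan_def)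
    have "isCont G 0" using G DERIV_isCont by blast
    then have "(G \<longlongrightarrow> G 0) (at_right 0)" by (simp add: isCont_def filterlim_at_split)
    then show "((G \<circ> real_of_ereal) \<longlongrightarrow> - f x) (at_right (ereal 0))"
      by (simp add: ereal_tendsto_simps G_def)
    have "((\<lambda>s. C * exp (- s)) \<longlongrightarrow> C * 0) at_top"
      by (intro tendsto_mult tendsto_const filterlim_compose[OF exp_at_bot] filterlim_uminus_at_bot_at_top)
    then have lim: "((\<lambda>s. C * exp (- s)) \<longlongrightarrow> 0) at_top" by simp
    have "(G \<longlongrightarrow> 0) at_top"
    proof (rule Lim_null_comparison[OF _ lim])
      show "\<forall>\<^sub>F s in at_top. norm (G s) \<le> C * exp (- s)"
        using eventually_ge_at_top[of 1]
      proof eventually_elim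
        case (elim s)
        then have "s * 1 \<le> s * s" by (intro mult_left_mono) auto
        then have "exp (- s\<^sup>2) \<le> exp (- s)" by (simp add: power2_eq_square)
        then have "exp (- s\<^sup>2) * \<bar>f (x - s *\<^sub>R z)\<bar> \<le> exp (- s) * C" by (intro mult_mono C) auto
        then show ?case by (simp add: G_def abs_mult mult.commute)
      qed
    qed
    then show "((G \<circ> real_of_ereal) \<longlongrightarrow> 0) (at_left \<infinity>)" by (simp add: ereal_tendsto_simps)
  qed auto
  moreover have "(LBINT s=ereal 0..\<infinity>. g s) = (LINT s|lborel. indicator {0<..} s * g s)"
    by (simp add: interval_integral_to_infinity_eq set_lebesgue_integral_def)
  moreover have "(LINT s|lborel. indicator {0<..} s * g s) = (LINT s|lborel. bessel_weight s * f (x - s *\<^sub>R z))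
    + (\<Sum>i\<in>UNIV. z $ i / 2 * (LINT s|lborel. dbessel_weight s * partial i f (x - s *\<^sub>R z)))"
    unfolding eq by (simp add: i1 i2)
  ultimately show ?thesis by simp
qed

text \<open>
  This is \<open>radial_ftc\<close> averaged over \<open>z\<close> with weight \<open>gauss\<close>, because \<open>gauss(z) z\<^sub>i / 2 = - dgauss\<^sub>i(z)\<close>.
\<close>

lemma bessel_representation:
  fixes f :: "real ^ 'n::finite \<Rightarrow> real"
  assumes f: "nice f"
  shows "conv bessel f x - (\<Sum>i\<in>UNIV. conv (dbessel i) (partial i f) x) = f x"
proof -
  obtain C where C: "\<And>x. \<bar>f x\<bar> \<le> C" using nice_bounded[OF f] by blast
  obtain D where D: "\<And>i x. \<bar>partial i f x\<bar> \<le> D" using nice_partials_bound[OF f] by metis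
  have m: "f \<in> borel_measurable borel" "partial i f \<in> borel_measurable borel" for i
    using f nice_measurable nice_partial by blast+
  have w: "s \<le> 0 \<Longrightarrow> bessel_weight s = 0" "s \<le> 0 \<Longrightarrow> dbessel_weight s = 0" for s
    by (auto simp: bessel_weight_def dbessel_weight_def)
  note s1 = conv_mix_swap[OF integrable_bessel_weight w(1) integrable_gauss m(1) C, folded bessel_def, of x]
  note s2 = conv_mix_swap[OF integrable_dbessel_weight w(2) integrable_dgauss m(2) D, folded dbessel_def, of _ _ x]
  have "conv bessel f x - (\<Sum>i\<in>UNIV. conv (dbessel i) (partial i f) x)
    = (LINT z|lborel. gauss z * (LINT s|lborel. bessel_weight s * f (x - s *\<^sub>R z)))
     - (\<Sum>i\<in>UNIV. LINT z|lborel. dgauss i z * (LINT s|lborel. dbessel_weight s * partial i f (x - s *\<^sub>R z)))"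
    by (simp only: s1(1) s2(1))
  also have "\<dots> = (LINT z|lborel. gauss z * (LINT s|lborel. bessel_weight s * f (x - s *\<^sub>R z))
     - (\<Sum>i\<in>UNIV. dgauss i z * (LINT s|lborel. dbessel_weight s * partial i f (x - s *\<^sub>R z))))"
    using s1(2) s2(2) by simp
  also have "\<dots> = (LINT (z::real^'n)|lborel. gauss z * f x)"
  proof (intro Bochner_Integration.integral_cong refl)
    fix z :: "real ^ 'n"
    have "gauss z * (LINT s|lborel. bessel_weight s * f (x - s *\<^sub>R z))
     - (\<Sum>i\<in>UNIV. dgauss i z * (LINT s|lborel. dbessel_weight s * partial i f (x - s *\<^sub>R z)))
     = gauss z * ((LINT s|lborel. bessel_weight s * f (x - s *\<^sub>R z))
    + (\<Sum>i\<in>UNIV. z $ i / 2 * (LINT s|lborel. dbessel_weight s * partial i f (x - s *\<^sub>R z))))"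
      by (simp add: dgauss_def distrib_left sum_distrib_left sum_negf mult_ac)
    then show "gauss z * (LINT s|lborel. bessel_weight s * f (x - s *\<^sub>R z))
     - (\<Sum>i\<in>UNIV. dgauss i z * (LINT s|lborel. dbessel_weight s * partial i f (x - s *\<^sub>R z))) = gauss z * f x"
      by (simp only: radial_ftc[OF f])
  qed
  also have "\<dots> = f x" using integral_gauss[where 'n='n] by simp
  finally show ?thesis .
qed

text \<open>
  In \<open>bessel_representation\<close> the second term is \<open>\<Delta>(B * f)\<close>: each kernel \<open>dbessel\<^sub>i\<close> stands for a further
  derivative of \<open>f\<close>.
\<close>

lemma conv_bessel_inverse:
  assumes f: "nice f"
  shows "conv bessel f x - laplacian (conv bessel f) x = f x"
proof -
  have "partials [i, i] (conv bessel f) = conv (dbessel i) (partial i f)" for i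
    using f by (simp add: partial_conv integrable_bessel integrable_dbessel nice_partial conv_bessel_partial)
  then show ?thesis using bessel_representation[OF f, of x] by (simp add: laplacian_def)
qed

text \<open>
  One of the two derivatives can be carried by the kernel and the other by \<open>f\<close>, and it does not matter
  which is applied first.
\<close>

lemma partial_commute_conv_bessel:
  assumes f: "nice f"
  shows "partial i (partial j (conv bessel f)) = partial j (partial i (conv bessel f))"
proof -
  have 1: "partial j (conv bessel f) = conv bessel (partial j f)" if "nice f" for f :: "real ^ 'a \<Rightarrow> real" and j
    using that by (simp add: partial_conv integrable_bessel)
  have "partial i (partial j (conv bessel f)) = partial i (conv (dbessel j) f)"
    by (simp add: 1 f conv_bessel_partial)
  also have "\<dots> = conv (dbessel j) (partial i f)"
    by (simp add: partial_conv integrable_dbessel f)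
  also have "\<dots> = conv bessel (partial j (partial i f))"
    by (simp add: conv_bessel_partial nice_partial f)
  also have "\<dots> = partial j (partial i (conv bessel f))"
    by (simp add: 1 f nice_partial)
  finally show ?thesis .
qed

text \<open>
  Square \<open>f = v - \<Delta>v\<close> and integrate by parts; the mixed derivatives come from
  \<open>\<integral> \<partial>\<^sub>i\<^sub>i v \<partial>\<^sub>j\<^sub>j v = \<integral> (\<partial>\<^sub>i\<^sub>j v)\<^sup>2\<close>.
\<close>

lemma bessel_energy:
  fixes f :: "real ^ 'n::finite \<Rightarrow> real"
  assumes f: "nice f" and v_def: "v = conv bessel f"
  shows "(LINT x|lborel. (f x)\<^sup>2) = (LINT x|lborel. (v x)\<^sup>2) + 2 * (\<Sum>i\<in>UNIV. LINT x|lborel. (partial i v x)\<^sup>2)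
    + (\<Sum>i\<in>UNIV. \<Sum>j\<in>UNIV. LINT x|lborel. (partial i (partial j v) x)\<^sup>2)"
proof -
  have v: "nice v" unfolding v_def by (rule nice_conv[OF integrable_bessel f])
  have fv: "f x = v x - (\<Sum>i\<in>UNIV. partial i (partial i v) x)" for x
    using conv_bessel_inverse[OF f, of x] by (simp add: laplacian_def v_def)
  have sq: "(f x)\<^sup>2 = v x * v x - (\<Sum>i\<in>UNIV. 2 * (v x * partial i (partial i v) x))
      + (\<Sum>i\<in>UNIV. \<Sum>j\<in>UNIV. partial i (partial i v) x * partial j (partial j v) x)" for x
  proof -
    let ?S = "\<Sum>i\<in>UNIV. partial i (partial i v) x"
    have "(f x)\<^sup>2 = v x * v x - 2 * (v x * ?S) + ?S * ?S" unfolding fv by (simp add: power2_eq_square algebra_simps)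
    moreover have "?S * ?S = (\<Sum>i\<in>UNIV. \<Sum>j\<in>UNIV. partial i (partial i v) x * partial j (partial j v) x)"
      by (rule sum_product)
    moreover have "2 * (v x * ?S) = (\<Sum>i\<in>UNIV. 2 * (v x * partial i (partial i v) x))"
      by (simp only: sum_distrib_left)
    ultimately show ?thesis by simp
  qed
  have 1: "(LINT x|lborel. v x * partial i (partial i v) x) = - (LINT x|lborel. (partial i v x)\<^sup>2)" for i
    using nice_integration_by_parts[OF v nice_partial[OF v], of i i] by (simp add: power2_eq_square)
  have c: "partial i (partial j v) = partial j (partial i v)" for i j
    unfolding v_def by (rule partial_commute_conv_bessel[OF f])
  have c2: "partial i (partial j (partial k v)) = partial j (partial i (partial k v))" for i j k
  proof -
    have "partial k v = conv bessel (partial k f)"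
      unfolding v_def by (simp add: partial_conv integrable_bessel f)
    then show ?thesis using partial_commute_conv_bessel[OF nice_partial[OF f]] by simp
  qed
  have 2: "(LINT x|lborel. partial i (partial i v) x * partial j (partial j v) x) = (LINT x|lborel. (partial i (partial j v) x)\<^sup>2)" for i j
  proof -
    have "(LINT x|lborel. partial i (partial i v) x * partial j (partial j v) x)
      = - (LINT x|lborel. partial i v x * partial i (partial j (partial j v)) x)"
      by (intro nice_integration_by_parts nice_partial v)
    also have "partial i (partial j (partial j v)) = partial j (partial i (partial j v))" by (rule c2)
    also have "- (LINT x|lborel. partial i v x * partial j (partial i (partial j v)) x)
      = (LINT x|lborel. partial j (partial i v) x * partial i (partial j v) x)"
      by (subst nice_integration_by_parts) (auto intro: nice_partial v)
    also have "partial j (partial i v) = partial i (partial j v)" by (rule c)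
    finally show ?thesis by (simp add: power2_eq_square)
  qed
  have int: "integrable lborel (\<lambda>x. v x * v x)" "integrable lborel (\<lambda>x. v x * partial i (partial i v) x)"
    "integrable lborel (\<lambda>x. partial i (partial i v) x * partial j (partial j v) x)" for i j
    by (intro nice_times_integrable nice_partial v)+
  have "(LINT x|lborel. (f x)\<^sup>2) = (LINT x|lborel. v x * v x) - (\<Sum>i\<in>UNIV. 2 * (LINT x|lborel. v x * partial i (partial i v) x))
      + (\<Sum>i\<in>UNIV. \<Sum>j\<in>UNIV. LINT x|lborel. partial i (partial i v) x * partial j (partial j v) x)"
    unfolding sq by (simp add: int)
  then show ?thesis unfolding 1 2 by (simp add: sum_negf sum_distrib_left power2_eq_square)
qed

lemma bessel_energy_bound:
  fixes f :: "real ^ 'n::finite \<Rightarrow> real"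
  assumes f: "nice f" and l: "length is \<le> 2"
  shows "(LINT x|lborel. (partials is (conv bessel f) x)\<^sup>2) \<le> (LINT x|lborel. (f x)\<^sup>2)"
proof -
  let ?v = "conv bessel f"
  let ?S1 = "\<Sum>i\<in>UNIV. LINT x|lborel. (partial i ?v x)\<^sup>2"
  let ?S2 = "\<Sum>i\<in>UNIV. \<Sum>j\<in>UNIV. LINT x|lborel. (partial i (partial j ?v) x)\<^sup>2"
  have e: "(LINT x|lborel. (f x)\<^sup>2) = (LINT x|lborel. (?v x)\<^sup>2) + 2 * ?S1 + ?S2"
    by (rule bessel_energy[OF f refl])
  have p0: "0 \<le> (LINT x|lborel. (?v x)\<^sup>2)" by simp
  have p1: "(LINT x|lborel. (partial i ?v x)\<^sup>2) \<le> ?S1" for i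
    by (rule member_le_sum[of i UNIV "\<lambda>i. LINT x|lborel. (partial i ?v x)\<^sup>2"]) auto
  have p1': "0 \<le> ?S1" by (intro sum_nonneg) auto
  have p2': "0 \<le> ?S2" by (intro sum_nonneg) auto
  have p2: "(LINT x|lborel. (partial i (partial j ?v) x)\<^sup>2) \<le> ?S2" for i j
  proof -
    have "(LINT x|lborel. (partial i (partial j ?v) x)\<^sup>2) \<le> (\<Sum>j\<in>UNIV. LINT x|lborel. (partial i (partial j ?v) x)\<^sup>2)"
      by (rule member_le_sum[of j UNIV "\<lambda>j. LINT x|lborel. (partial i (partial j ?v) x)\<^sup>2"]) auto
    also have "\<dots> \<le> ?S2"
      by (rule member_le_sum[of i UNIV "\<lambda>i. \<Sum>j\<in>UNIV. LINT x|lborel. (partial i (partial j ?v) x)\<^sup>2"]) (auto intro: sum_nonneg)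
    finally show ?thesis .
  qed
  consider "is = []" | i where "is = [i]" | i j where "is = [i, j]"
    using l by (cases "is" rule: list.exhaust[case_names n c]; cases "tl is") (auto simp: numeral_2_eq_2 le_Suc_eq)
  then show ?thesis
  proof cases
    case 1 then show ?thesis using e p1' p2' by simp
  next
    case 2 show ?thesis unfolding 2 partials_Cons partials_Nil using e p0 p1[of i] p1' p2' by linarith
  next
    case 3 show ?thesis unfolding 3 partials_Cons partials_Nil using e p0 p2[of i j] p1' p2' by linarith
  qed
qed

section \<open>Approximation by test functions\<close>

lemma AE_lborel_notin_negligible:
  assumes "negligible N" shows "AE x in lborel. x \<notin> N"
proof -
  have "AE x in lebesgue. x \<notin> N"
    using assms by (simp add: negligible_iff_null_sets AE_not_in)
  then show ?thesis by (simp add: AE_completion_iff)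
qed

text \<open>
  A measurable function is an almost everywhere limit of continuous functions. These can be truncated
  at height \<open>M\<close>, replaced by polynomials on growing balls by the Stone-Weierstrass theorem, and
  multiplied by the cutoffs.
\<close>

lemma test_function_approximation:
  fixes f :: "real ^ 'n::finite \<Rightarrow> real"
  assumes f: "f \<in> borel_measurable borel" and M: "\<And>x. \<bar>f x\<bar> \<le> M"
  obtains \<phi> where "\<And>n::nat. \<phi> n \<in> test_functions" "\<And>n x. \<bar>\<phi> n x\<bar> \<le> M + 1"
    "AE x in lborel. (\<lambda>n. \<phi> n x) \<longlonglongrightarrow> f x"
proof -
  have "f \<in> borel_measurable lebesgue"
    using f by (simp add: measurable_completion)
  then have "f measurable_on UNIV"
    using measurable_on_iff_borel_measurable[of UNIV f] by (simp add: lebesgue_on_UNIV_eq)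
  then obtain N g where N: "negligible N" and g: "\<And>n. continuous_on UNIV (g n)"
    and lim: "\<And>x. x \<notin> N \<Longrightarrow> (\<lambda>n. g n x) \<longlonglongrightarrow> f x"
    unfolding measurable_on_def by auto
  define G where "G n x = max (- M) (min M (g n x))" for n x
  have "\<exists>p. real_polynomial_function p \<and> (\<forall>x\<in>cball 0 (real (Suc n)). \<bar>G n x - p x\<bar> < 1 / real (Suc n))" for n
  proof -
    have "continuous_on (cball 0 (real (Suc n))) (G n)"
      unfolding G_def by (intro continuous_intros continuous_on_subset[OF g]) auto
    then show ?thesis
      using Stone_Weierstrass_real_polynomial_function[of "cball 0 (real (Suc n))" "G n" "1 / real (Suc n)"]
      by (metis compact_cball divide_pos_pos of_nat_0_less_iff zero_less_Suc zero_less_one)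
  qed
  then obtain p where p: "\<And>n. real_polynomial_function (p n)"
    and ap: "\<And>n x. x \<in> cball 0 (real (Suc n)) \<Longrightarrow> \<bar>G n x - p n x\<bar> < 1 / real (Suc n)"
    by metis
  have M0: "0 \<le> M" using M[of 0] by simp
  have Gb: "\<bar>G n x\<bar> \<le> M" for n x using M0 by (auto simp: G_def)
  define \<phi> where "\<phi> n x = bump ((1 / real (Suc n)) *\<^sub>R x) * p n x" for n x
  have "\<phi> n \<in> test_functions" for n
    unfolding \<phi>_def[abs_def] by (intro test_functions_cutoff smooth_real_polynomial_function p)
  moreover have "\<bar>\<phi> n x\<bar> \<le> M + 1" for n x
  proof (cases "norm x \<le> real (Suc n)")
    case True
    then have "\<bar>G n x - p n x\<bar> < 1 / real (Suc n)" using ap[of x n] by simp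
    moreover have "1 / real (Suc n) \<le> 1" by simp
    ultimately have "\<bar>p n x\<bar> \<le> M + 1" using Gb[of n x] by linarith
    then have "bump ((1 / real (Suc n)) *\<^sub>R x) * \<bar>p n x\<bar> \<le> 1 * (M + 1)"
      by (intro mult_mono bump_le_1) auto
    then show ?thesis by (simp add: \<phi>_def abs_mult bump_nonneg)
  next
    case False
    then have "bump ((1 / real (Suc n)) *\<^sub>R x) = 0" by (intro bump_outside) (auto simp: divide_simps)
    then show ?thesis using M0 by (simp add: \<phi>_def)
  qed
  moreover have "AE x in lborel. (\<lambda>n. \<phi> n x) \<longlonglongrightarrow> f x"
    using AE_lborel_notin_negligible[OF N]
  proof eventually_elim
    case (elim x)
    have 1: "(\<lambda>n. G n x) \<longlonglongrightarrow> max (- M) (min M (f x))"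
      unfolding G_def by (intro tendsto_intros lim elim)
    have 2: "(\<lambda>n. p n x - G n x) \<longlonglongrightarrow> 0"
    proof (rule Lim_null_comparison[OF _ LIMSEQ_Suc[OF lim_1_over_n]])
      show "\<forall>\<^sub>F n in sequentially. norm (p n x - G n x) \<le> 1 / real (Suc n)"
        using eventually_ge_at_top[of "nat \<lceil>norm x\<rceil>"]
      proof eventually_elim
        case (elim n)
        then have "norm x \<le> real (Suc n)" by linarith
        then show ?case using ap[of x n] by (simp add: abs_minus_commute)
      qed
    qed
    have "(\<lambda>n. \<phi> n x) \<longlonglongrightarrow> 1 * (0 + max (- M) (min M (f x)))"
      using tendsto_mult[OF cutoff_tendsto_1[of x] tendsto_add[OF 2 1]] by (simp add: \<phi>_def)
    then show ?case using M[of x] by (simp add: abs_le_iff min_def max_def split: if_splits)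
  qed
  ultimately show ?thesis using that by blast
qed

lemma smooth_const: "smooth (\<lambda>x. c)"
  by (simp add: smooth_def)

lemma cutoff_test_function: "(\<lambda>x. bump ((1 / real (Suc n)) *\<^sub>R x)) \<in> test_functions"
  using test_functions_cutoff[OF smooth_const[of 1], of n] by simp

lemma test_functions_smooth: "v \<in> test_functions \<Longrightarrow> smooth v"
  by (simp add: test_functions_iff)

text \<open>
  Testing against approximations of the sign of \<open>f\<close> shows that \<open>|f|\<close> times any cutoff has integral zero.
\<close>

lemma AE_eq_0_if_orthogonal_to_test_functions:
  fixes f :: "real ^ 'n::finite \<Rightarrow> real"
  assumes [measurable]: "f \<in> borel_measurable borel"
    and int: "\<And>\<phi>. \<phi> \<in> test_functions \<Longrightarrow> integrable lborel (\<lambda>x. f x * \<phi> x)"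
    and orth: "\<And>\<phi>. \<phi> \<in> test_functions \<Longrightarrow> (LINT x|lborel. f x * \<phi> x) = 0"
  shows "AE x in lborel. f x = 0"
proof -
  have "AE x in lborel. \<bar>f x\<bar> * bump ((1 / real (Suc n)) *\<^sub>R x) = 0" for n
  proof -
    let ?\<chi> = "\<lambda>x. bump ((1 / real (Suc n)) *\<^sub>R x)"
    have [measurable]: "?\<chi> \<in> borel_measurable borel"
      by (intro nice_measurable test_functions_nice cutoff_test_function)
    obtain \<phi> where \<phi>: "\<And>k::nat. \<phi> k \<in> test_functions" "\<And>k x. \<bar>\<phi> k x\<bar> \<le> 1 + 1"
      and lim: "AE x in lborel. (\<lambda>k. \<phi> k x) \<longlonglongrightarrow> sgn (f x)"
      using test_function_approximation[of "\<lambda>x. sgn (f x)" 1] by (auto simp: abs_sgn_eq)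
    have [measurable]: "\<phi> k \<in> borel_measurable borel" for k
      by (intro nice_measurable test_functions_nice \<phi>)
    have I: "integrable lborel (\<lambda>x. f x * ?\<chi> x)" by (rule int[OF cutoff_test_function])
    have "(\<lambda>k. LINT x|lborel. f x * (?\<chi> x * \<phi> k x)) \<longlonglongrightarrow> (LINT x|lborel. f x * (?\<chi> x * sgn (f x)))"
    proof (rule integral_dominated_convergence[where w="\<lambda>x. 2 * \<bar>f x * ?\<chi> x\<bar>"])
      show "integrable lborel (\<lambda>x. 2 * \<bar>f x * ?\<chi> x\<bar>)" using I by simp
      show "AE x in lborel. (\<lambda>k. f x * (?\<chi> x * \<phi> k x)) \<longlonglongrightarrow> f x * (?\<chi> x * sgn (f x))"
        using lim by eventually_elim (intro tendsto_intros)
      show "AE x in lborel. norm (f x * (?\<chi> x * \<phi> k x)) \<le> 2 * \<bar>f x * ?\<chi> x\<bar>" for k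
      proof (intro AE_I2)
        fix x
        have "\<bar>f x * ?\<chi> x\<bar> * \<bar>\<phi> k x\<bar> \<le> \<bar>f x * ?\<chi> x\<bar> * 2"
          using \<phi>(2)[of k x] by (intro mult_left_mono) auto
        then show "norm (f x * (?\<chi> x * \<phi> k x)) \<le> 2 * \<bar>f x * ?\<chi> x\<bar>" by (simp add: abs_mult mult_ac)
      qed
    qed measurable
    moreover have "(LINT x|lborel. f x * (?\<chi> x * \<phi> k x)) = 0" for k
      by (intro orth test_functions_cutoff test_functions_smooth \<phi>)
    ultimately have "(LINT x|lborel. f x * (?\<chi> x * sgn (f x))) = 0" by (simp add: LIMSEQ_const_iff)
    moreover have e: "f x * (?\<chi> x * sgn (f x)) = \<bar>f x\<bar> * ?\<chi> x" for x by (auto simp: sgn_if)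
    ultimately have "(LINT x|lborel. \<bar>f x\<bar> * ?\<chi> x) = 0" by (simp only: e)
    moreover have "integrable lborel (\<lambda>x. \<bar>f x\<bar> * ?\<chi> x)"
      using integrable_abs[OF I] by (simp add: abs_mult bump_nonneg)
    ultimately show ?thesis
      by (subst (asm) integral_nonneg_eq_0_iff_AE) (auto simp: bump_nonneg)
  qed
  then have "AE x in lborel. \<forall>n. \<bar>f x\<bar> * bump ((1 / real (Suc n)) *\<^sub>R x) = 0"
    unfolding AE_all_countable by blast
  then show ?thesis
  proof eventually_elim
    case (elim x)
    define n where "n = nat \<lceil>norm x\<rceil>"
    have "norm x < real (Suc n)" unfolding n_def by linarith
    then have "0 < bump ((1 / real (Suc n)) *\<^sub>R x)" by (intro bump_pos) (simp add: divide_simps)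
    then show ?case using elim[rule_format, of n] by simp
  qed
qed

lemma power_add_le: "0 \<le> a \<Longrightarrow> 0 \<le> b \<Longrightarrow> (a + b) ^ p \<le> 2 ^ p * (a ^ p + (b::real) ^ p)"
proof -
  assume a: "0 \<le> a" "0 \<le> b"
  have "(a + b) ^ p \<le> (2 * max a b) ^ p" using a by (intro power_mono) auto
  also have "\<dots> = 2 ^ p * max a b ^ p" by (simp add: power_mult_distrib)
  also have "\<dots> \<le> 2 ^ p * (a ^ p + b ^ p)" using a by (intro mult_left_mono) (auto simp: max_def)
  finally show ?thesis .
qed

text \<open>
  First truncate \<open>f\<close> in height and cut it off in space, then approximate the bounded function that
  remains; both steps are dominated.
\<close>

lemma test_functions_dense:
  fixes f :: "real ^ 'n::finite \<Rightarrow> real"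
  assumes [measurable]: "f \<in> borel_measurable borel" and p: "p > 0"
    and int: "integrable lborel (\<lambda>x. \<bar>f x\<bar> ^ p)" and e: "0 < e"
  obtains \<phi> where "\<phi> \<in> test_functions" "integrable lborel (\<lambda>x. \<bar>f x - \<phi> x\<bar> ^ p)"
    "(LINT x|lborel. \<bar>f x - \<phi> x\<bar> ^ p) < e"
proof -
  define e' where "e' = e / (2 ^ p * 2)"
  have e': "0 < e'" using e by (simp add: e'_def)
  let ?\<chi> = "\<lambda>n x. bump ((1 / real (Suc n)) *\<^sub>R x)"
  have \<chi>m [measurable]: "?\<chi> n \<in> borel_measurable borel" for n
    by (intro nice_measurable test_functions_nice cutoff_test_function)
  define c where "c n x = max (- real n) (min (real n) (f x))" for n x
  have [measurable]: "c n \<in> borel_measurable borel" for n unfolding c_def[abs_def] by measurable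
  define F where "F n x = ?\<chi> n x * c n x" for n x
  have Fm [measurable]: "F n \<in> borel_measurable borel" for n unfolding F_def[abs_def] by measurable
  have le: "\<bar>f x - F n x\<bar> \<le> \<bar>f x\<bar>" for n x
  proof -
    have c: "0 \<le> c n x \<and> c n x \<le> f x \<or> f x \<le> c n x \<and> c n x \<le> 0"
      unfolding c_def by (cases "0 \<le> f x") auto
    have "\<bar>F n x\<bar> \<le> \<bar>c n x\<bar>" 
      by (simp add: F_def abs_mult bump_nonneg bump_le_1 mult_left_le_one_le del: of_nat_Suc)
    moreover have "0 \<le> c n x \<Longrightarrow> 0 \<le> F n x" "c n x \<le> 0 \<Longrightarrow> F n x \<le> 0"
      by (auto simp: F_def bump_nonneg mult_nonneg_nonpos)
    ultimately show ?thesis using c by linarith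
  qed
  have powle: "\<bar>f x - F n x\<bar> ^ p \<le> \<bar>f x\<bar> ^ p" for n x by (intro power_mono le) auto
  have i1: "integrable lborel (\<lambda>x. \<bar>f x - F n x\<bar> ^ p)" for n
    by (rule Bochner_Integration.integrable_bound[OF int]) (use powle in auto)
  have "(\<lambda>n. LINT x|lborel. \<bar>f x - F n x\<bar> ^ p) \<longlonglongrightarrow> (LINT (x::real^'n)|lborel. 0)"
  proof (rule integral_dominated_convergence[OF _ _ int])
    show "AE x in lborel. (\<lambda>n. \<bar>f x - F n x\<bar> ^ p) \<longlonglongrightarrow> 0"
    proof (intro AE_I2)
      fix x
      have "(\<lambda>n. c n x) \<longlonglongrightarrow> f x"
      proof (rule tendsto_eventually)
        show "\<forall>\<^sub>F n in sequentially. c n x = f x"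
          using eventually_ge_at_top[of "nat \<lceil>\<bar>f x\<bar>\<rceil>"]
        proof eventually_elim
          case (elim n)
          then have "\<bar>f x\<bar> \<le> real n" by linarith
          then show ?case by (auto simp: c_def)
        qed
      qed
      then have "(\<lambda>n. F n x) \<longlonglongrightarrow> 1 * f x"
        unfolding F_def by (intro tendsto_mult cutoff_tendsto_1)
      then have "(\<lambda>n. \<bar>f x - F n x\<bar> ^ p) \<longlonglongrightarrow> \<bar>f x - 1 * f x\<bar> ^ p" by (intro tendsto_intros)
      then show "(\<lambda>n. \<bar>f x - F n x\<bar> ^ p) \<longlonglongrightarrow> 0" using p by (simp add: power_0_left)
    qed
  qed (use powle in auto)
  then have "\<forall>\<^sub>F n in sequentially. (LINT x|lborel. \<bar>f x - F n x\<bar> ^ p) < e'"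
    using e' by (intro order_tendstoD(2)) auto
  then obtain n where n: "(LINT x|lborel. \<bar>f x - F n x\<bar> ^ p) < e'"
    using eventually_happens'[of sequentially] by (auto simp: trivial_limit_sequentially)
  have cb: "\<bar>c n x\<bar> \<le> real n" for x by (auto simp: c_def)
  obtain \<phi> where \<phi>: "\<And>k::nat. \<phi> k \<in> test_functions" "\<And>k x. \<bar>\<phi> k x\<bar> \<le> real n + 1"
      and lim: "AE x in lborel. (\<lambda>k. \<phi> k x) \<longlonglongrightarrow> c n x"
    using test_function_approximation[of "c n" "real n"] cb by auto
  have [measurable]: "\<phi> k \<in> borel_measurable borel" for k
    by (intro nice_measurable test_functions_nice \<phi>)
  define w :: "real ^ 'n \<Rightarrow> real" where "w x = ?\<chi> n x * (2 * real n + 1) ^ p" for x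
  have wi: "integrable lborel w"
    unfolding w_def by (intro integrable_mult_left nice_integrable test_functions_nice cutoff_test_function)
  have bd: "\<bar>F n x - ?\<chi> n x * \<phi> k x\<bar> ^ p \<le> w x" for k x
  proof -
    have "\<bar>c n x - \<phi> k x\<bar> \<le> 2 * real n + 1" using cb[of x] \<phi>(2)[of k x] by linarith
    then have "\<bar>c n x - \<phi> k x\<bar> ^ p \<le> (2 * real n + 1) ^ p" by (intro power_mono) auto
    moreover have "?\<chi> n x ^ p \<le> ?\<chi> n x ^ 1" using p by (intro power_decreasing bump_nonneg bump_le_1) auto
    ultimately have "?\<chi> n x ^ p * \<bar>c n x - \<phi> k x\<bar> ^ p \<le> ?\<chi> n x * (2 * real n + 1) ^ p"
      by (intro mult_mono) (auto simp: bump_nonneg)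
    moreover have "F n x - ?\<chi> n x * \<phi> k x = ?\<chi> n x * (c n x - \<phi> k x)" by (simp add: F_def algebra_simps)
    ultimately show ?thesis by (simp add: abs_mult power_mult_distrib bump_nonneg w_def)
  qed
  have i2: "integrable lborel (\<lambda>x. \<bar>F n x - ?\<chi> n x * \<phi> k x\<bar> ^ p)" for k
    by (rule Bochner_Integration.integrable_bound[OF wi], measurable)
      (use bd in \<open>auto intro: order_trans[OF _ abs_ge_self]\<close>)
  have "(\<lambda>k. LINT x|lborel. \<bar>F n x - ?\<chi> n x * \<phi> k x\<bar> ^ p) \<longlonglongrightarrow> (LINT (x::real^'n)|lborel. 0)"
  proof (rule integral_dominated_convergence[OF _ _ wi])
    show "AE x in lborel. (\<lambda>k. \<bar>F n x - ?\<chi> n x * \<phi> k x\<bar> ^ p) \<longlonglongrightarrow> 0"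
      using lim
    proof eventually_elim
      case (elim x)
      then have "(\<lambda>k. \<bar>F n x - ?\<chi> n x * \<phi> k x\<bar> ^ p) \<longlonglongrightarrow> \<bar>F n x - ?\<chi> n x * c n x\<bar> ^ p" by (intro tendsto_intros)
      then show ?case using p by (simp add: F_def power_0_left)
    qed
    show "(\<lambda>x. \<bar>F n x - ?\<chi> n x * \<phi> k x\<bar> ^ p) \<in> borel_measurable lborel" for k by measurable
    show "AE x in lborel. norm (\<bar>F n x - ?\<chi> n x * \<phi> k x\<bar> ^ p) \<le> w x" for k
      by (intro AE_I2) (simp add: bd del: of_nat_Suc)
  qed auto
  then have "\<forall>\<^sub>F k in sequentially. (LINT x|lborel. \<bar>F n x - ?\<chi> n x * \<phi> k x\<bar> ^ p) < e'"
    using e' by (intro order_tendstoD(2)) auto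
  then obtain k where k: "(LINT x|lborel. \<bar>F n x - ?\<chi> n x * \<phi> k x\<bar> ^ p) < e'"
    using eventually_happens'[of sequentially] by (auto simp: trivial_limit_sequentially)
  define \<psi> where "\<psi> x = ?\<chi> n x * \<phi> k x" for x
  have \<psi>: "\<psi> \<in> test_functions"
    unfolding \<psi>_def[abs_def] by (intro test_functions_cutoff test_functions_smooth \<phi>)
  have [measurable]: "\<psi> \<in> borel_measurable borel" by (intro nice_measurable test_functions_nice \<psi>)
  have tri: "\<bar>f x - \<psi> x\<bar> ^ p \<le> 2 ^ p * (\<bar>f x - F n x\<bar> ^ p + \<bar>F n x - \<psi> x\<bar> ^ p)" for x
    by (rule order_trans[OF power_mono power_add_le]) auto
  have i3: "integrable lborel (\<lambda>x. 2 ^ p * (\<bar>f x - F n x\<bar> ^ p + \<bar>F n x - \<psi> x\<bar> ^ p))"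
    using i1[of n] i2[of k] by (simp add: \<psi>_def)
  have i4: "integrable lborel (\<lambda>x. \<bar>f x - \<psi> x\<bar> ^ p)"
    by (rule Bochner_Integration.integrable_bound[OF i3], measurable)
      (use tri in \<open>auto intro: order_trans[OF _ abs_ge_self]\<close>)
  have "(LINT x|lborel. \<bar>f x - \<psi> x\<bar> ^ p) \<le> (LINT x|lborel. 2 ^ p * (\<bar>f x - F n x\<bar> ^ p + \<bar>F n x - \<psi> x\<bar> ^ p))"
    by (rule integral_mono[OF i4 i3 tri])
  also have "\<dots> = 2 ^ p * ((LINT x|lborel. \<bar>f x - F n x\<bar> ^ p) + (LINT x|lborel. \<bar>F n x - \<psi> x\<bar> ^ p))"
    using i1[of n] i2[of k] by (simp add: \<psi>_def)
  also have "\<dots> < 2 ^ p * (e' + e')"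
    using n k by (intro mult_strict_left_mono add_strict_mono) (auto simp: \<psi>_def)
  also have "\<dots> = e" by (simp add: e'_def)
  finally show ?thesis using that[OF \<psi> i4] by blast
qed

section \<open>Completeness of the square-integrable functions\<close>

lemma square_integrable_times:
  fixes f g :: "'a \<Rightarrow> real"
  assumes [measurable]: "f \<in> borel_measurable M" "g \<in> borel_measurable M"
    and f: "integrable M (\<lambda>x. (f x)\<^sup>2)" and g: "integrable M (\<lambda>x. (g x)\<^sup>2)"
  shows "integrable M (\<lambda>x. f x * g x)"
proof (rule Bochner_Integration.integrable_bound)
  show "integrable M (\<lambda>x. (f x)\<^sup>2 + (g x)\<^sup>2)" using f g by simp
  have "\<bar>a * b\<bar> \<le> a\<^sup>2 + b\<^sup>2" for a b :: real
  proof -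
    have "0 \<le> (\<bar>a\<bar> - \<bar>b\<bar>)\<^sup>2" by simp
    also have "\<dots> = a\<^sup>2 + b\<^sup>2 - 2 * \<bar>a * b\<bar>" by (simp add: power2_diff abs_mult)
    finally show ?thesis using abs_ge_zero[of "a * b"] by linarith
  qed
  then show "AE x in M. norm (f x * g x) \<le> norm ((f x)\<^sup>2 + (g x)\<^sup>2)" by simp
qed measurable

lemma square_integrable_diff:
  fixes f g :: "'a \<Rightarrow> real"
  assumes "f \<in> borel_measurable M" "g \<in> borel_measurable M"
    "integrable M (\<lambda>x. (f x)\<^sup>2)" "integrable M (\<lambda>x. (g x)\<^sup>2)"
  shows "integrable M (\<lambda>x. (f x - g x)\<^sup>2)"
  using square_integrable_times[OF assms] assms(3,4) by (simp add: power2_diff mult.assoc)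

text \<open>
  The inequality \<open>|a b| \<le> a\<^sup>2 / d + d b\<^sup>2\<close> serves as Cauchy-Schwarz: choose \<open>d\<close> first, then \<open>n\<close>.
\<close>

lemma L2_tendsto_weak:
  fixes F :: "nat \<Rightarrow> 'a::euclidean_space \<Rightarrow> real"
  assumes [measurable]: "\<And>n. F n \<in> borel_measurable M" "y \<in> borel_measurable M" "\<phi> \<in> borel_measurable M"
    and F: "\<And>n. integrable M (\<lambda>x. (F n x)\<^sup>2)" and y: "integrable M (\<lambda>x. (y x)\<^sup>2)" and \<phi>: "integrable M (\<lambda>x. (\<phi> x)\<^sup>2)"
    and lim: "(\<lambda>n. LINT x|M. (F n x - y x)\<^sup>2) \<longlonglongrightarrow> 0"
  shows "(\<lambda>n. LINT x|M. F n x * \<phi> x) \<longlonglongrightarrow> (LINT x|M. y x * \<phi> x)"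
proof -
  define A where "A = (LINT x|M. (\<phi> x)\<^sup>2)"
  have A: "0 \<le> A" by (simp add: A_def)
  have bd: "\<bar>(LINT x|M. F n x * \<phi> x) - (LINT x|M. y x * \<phi> x)\<bar> \<le> (LINT x|M. (F n x - y x)\<^sup>2) / d + d * A" if d: "0 < d" for n d
  proof -
    have i: "integrable M (\<lambda>x. (F n x - y x)\<^sup>2)" by (rule square_integrable_diff) (use F y in auto)
    have "(LINT x|M. F n x * \<phi> x) - (LINT x|M. y x * \<phi> x) = (LINT x|M. (F n x - y x) * \<phi> x)"
      by (simp add: left_diff_distrib square_integrable_times F y \<phi>)
    also have "\<bar>\<dots>\<bar> \<le> (LINT x|M. (F n x - y x)\<^sup>2 / d + d * (\<phi> x)\<^sup>2)"
      unfolding real_norm_def[symmetric]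
    proof (rule Bochner_Integration.integral_norm_bound_integral)
      show "integrable M (\<lambda>x. (F n x - y x) * \<phi> x)" by (rule square_integrable_times) (use i \<phi> in auto)
      show "integrable M (\<lambda>x. (F n x - y x)\<^sup>2 / d + d * (\<phi> x)\<^sup>2)" using i \<phi> by simp
      fix x
      have "\<bar>a * b\<bar> \<le> a\<^sup>2 / d + d * b\<^sup>2" for a b :: real
      proof -
        have "0 \<le> (\<bar>a\<bar> - d * \<bar>b\<bar>)\<^sup>2 / d" using d by simp
        also have "\<dots> = a\<^sup>2 / d + d * b\<^sup>2 - 2 * \<bar>a * b\<bar>"
          using d by (simp add: power2_eq_square field_simps abs_mult)
        finally show ?thesis by simp
      qed
      then show "norm ((F n x - y x) * \<phi> x) \<le> (F n x - y x)\<^sup>2 / d + d * (\<phi> x)\<^sup>2" by simp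
    qed
    also have "\<dots> = (LINT x|M. (F n x - y x)\<^sup>2) / d + d * A" using i \<phi> by (simp add: A_def)
    finally show ?thesis .
  qed
  show ?thesis
  proof (rule LIMSEQ_I)
    fix r :: real assume r: "0 < r"
    define d where "d = r / (2 * (A + 1))"
    have d: "0 < d" "d * A < r / 2"
    proof -
      show "0 < d" using A r by (simp add: d_def)
      have "d * A < d * (A + 1)" using \<open>0 < d\<close> by simp
      also have "\<dots> = r / 2" using A by (simp add: d_def field_simps)
      finally show "d * A < r / 2" .
    qed
    obtain N where N: "\<And>n. n \<ge> N \<Longrightarrow> \<bar>LINT x|M. (F n x - y x)\<^sup>2\<bar> < d * r / 2"
      using LIMSEQ_D[OF lim, of "d * r / 2"] d r by auto
    show "\<exists>N. \<forall>n\<ge>N. norm ((LINT x|M. F n x * \<phi> x) - (LINT x|M. y x * \<phi> x)) < r"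
    proof (intro exI[of _ N] allI impI)
      fix n assume "n \<ge> N"
      then have "(LINT x|M. (F n x - y x)\<^sup>2) < d * r / 2" using N by force
      then have "(LINT x|M. (F n x - y x)\<^sup>2) / d < r / 2" using d by (simp add: divide_less_eq mult.commute)
      then show "norm ((LINT x|M. F n x * \<phi> x) - (LINT x|M. y x * \<phi> x)) < r"
        unfolding real_norm_def using bd[OF d(1), of n] d(2) by linarith
    qed
  qed
qed

text \<open>
  Along a subsequence the differences satisfy \<open>\<integral> d\<^sub>k\<^sup>2 \<le> 4\<^bsup>-k\<^esup>\<close>, so \<open>\<Sum> 2\<^sup>k d\<^sub>k\<^sup>2\<close> is integrable and finite almost
  everywhere. From \<open>2 |d\<^sub>k| \<le> 2\<^bsup>-k\<^esup> + 2\<^sup>k d\<^sub>k\<^sup>2\<close> the subsequence converges pointwise almost everywhere, and Fatou's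
  lemma turns this into convergence in the mean.
\<close>

lemma L2_complete:
  fixes F :: "nat \<Rightarrow> 'a \<Rightarrow> real"
  assumes [measurable]: "\<And>n. F n \<in> borel_measurable M"
    and F: "\<And>n. integrable M (\<lambda>x. (F n x)\<^sup>2)"
    and cauchy: "\<And>e. 0 < e \<Longrightarrow> \<exists>N. \<forall>m\<ge>N. \<forall>n\<ge>N. (LINT x|M. (F m x - F n x)\<^sup>2) < e"
  obtains y where "y \<in> borel_measurable M" "integrable M (\<lambda>x. (y x)\<^sup>2)"
    "(\<lambda>n. LINT x|M. (F n x - y x)\<^sup>2) \<longlonglongrightarrow> 0"
proof -
  have di: "integrable M (\<lambda>x. (F m x - F n x)\<^sup>2)" for m n by (rule square_integrable_diff) (use F in auto)
  have "\<exists>N. \<forall>m\<ge>N. \<forall>n\<ge>N. (LINT x|M. (F m x - F n x)\<^sup>2) < (1/4) ^ k" for k by (rule cauchy) simp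
  then obtain N where N: "\<And>k m n. m \<ge> N k \<Longrightarrow> n \<ge> N k \<Longrightarrow> (LINT x|M. (F m x - F n x)\<^sup>2) < (1/4) ^ k" by metis
  define r where "r k = (\<Sum>j\<le>k. N j) + k" for k
  have rN: "N k \<le> r k" for k unfolding r_def by (simp add: member_le_sum trans_le_add1)
  have rm: "r k \<le> r (Suc k)" for k by (simp add: r_def)
  have rk: "k \<le> r k" for k by (simp add: r_def)
  \<comment> \<open>Consecutive differences along the rapidly convergent subsequence.\<close>
  define d where "d k x = F (r (Suc k)) x - F (r k) x" for k x
  have [measurable]: "d k \<in> borel_measurable M" for k unfolding d_def[abs_def] by measurable
  have d4: "(LINT x|M. (d k x)\<^sup>2) \<le> (1/4) ^ k" for k
    unfolding d_def using N[of k "r (Suc k)" "r k"] rN[of k] rm[of k] by simp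
  have "(\<integral>\<^sup>+x. (\<Sum>k. ennreal (2 ^ k * (d k x)\<^sup>2)) \<partial>M) = (\<Sum>k. \<integral>\<^sup>+x. ennreal (2 ^ k * (d k x)\<^sup>2) \<partial>M)"
    by (rule nn_integral_suminf) measurable
  also have "\<dots> \<le> (\<Sum>k. ennreal ((1/2) ^ k))"
  proof (intro suminf_le summableI)
    fix k
    have "(\<integral>\<^sup>+x. ennreal (2 ^ k * (d k x)\<^sup>2) \<partial>M) = ennreal (2 ^ k * (LINT x|M. (d k x)\<^sup>2))"
      using di[of "r (Suc k)" "r k"] by (subst nn_integral_eq_integral) (auto simp: d_def)
    also have "\<dots> \<le> ennreal (2 ^ k * (1/4) ^ k)" by (intro ennreal_leI mult_left_mono d4) auto
    also have "2 ^ k * (1/4) ^ k = (1/2::real) ^ k" by (simp flip: power_mult_distrib)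
    finally show "(\<integral>\<^sup>+x. ennreal (2 ^ k * (d k x)\<^sup>2) \<partial>M) \<le> ennreal ((1/2) ^ k)" .
  qed
  also have "\<dots> < \<infinity>"
    by (subst suminf_ennreal2) (auto intro: summable_geometric)
  finally have "AE x in M. (\<Sum>k. ennreal (2 ^ k * (d k x)\<^sup>2)) \<noteq> \<infinity>"
    by (intro nn_integral_PInf_AE) auto
  then have conv: "AE x in M. convergent (\<lambda>k. F (r k) x)"
  proof eventually_elim
    case (elim x)
    then have s: "summable (\<lambda>k. 2 ^ k * (d k x)\<^sup>2)" by (intro summable_suminf_not_top) auto
    have "summable (\<lambda>k. (1/2) ^ k + 2 ^ k * (d k x)\<^sup>2)" by (intro summable_add s summable_geometric) auto
    then have "summable (\<lambda>k. d k x)"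
    proof (rule summable_comparison_test'[where N=0])
      fix k :: nat
      have "0 \<le> (1 - 2 ^ k * \<bar>d k x\<bar>)\<^sup>2 / 2 ^ k" by simp
      also have "\<dots> = (1/2) ^ k + 2 ^ k * (d k x)\<^sup>2 - 2 * \<bar>d k x\<bar>"
        by (simp add: power2_eq_square field_simps power_one_over)
      finally show "norm (d k x) \<le> (1/2) ^ k + 2 ^ k * (d k x)\<^sup>2" by simp
    qed
    then have "convergent (\<lambda>n. \<Sum>k<n. d k x)" by (simp add: summable_iff_convergent)
    moreover have "(\<Sum>k<n. d k x) = F (r n) x - F (r 0) x" for n
      unfolding d_def by (rule sum_lessThan_telescope)
    ultimately have "convergent (\<lambda>n. F (r n) x - F (r 0) x)" by simp
    from convergent_add[OF this convergent_const[of "F (r 0) x"]] show ?case by simp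
  qed
  define y where "y x = lim (\<lambda>k. F (r k) x)" for x
  have ym [measurable]: "y \<in> borel_measurable M" unfolding y_def[abs_def] by measurable
  have lim: "AE x in M. (\<lambda>k. F (r k) x) \<longlonglongrightarrow> y x"
    using conv unfolding y_def by eventually_elim (simp add: convergent_LIMSEQ_iff)
  \<comment> \<open>Fatou's lemma along the subsequence, with \<open>n\<close> fixed.\<close>
  have key: "(\<integral>\<^sup>+x. ennreal ((F n x - y x)\<^sup>2) \<partial>M) \<le> ennreal e"
    if e: "0 < e" and n: "\<And>m. m \<ge> K \<Longrightarrow> (LINT x|M. (F n x - F m x)\<^sup>2) < e" for n e K
  proof -
    have "(\<integral>\<^sup>+x. ennreal ((F n x - y x)\<^sup>2) \<partial>M) = (\<integral>\<^sup>+x. liminf (\<lambda>k. ennreal ((F n x - F (r k) x)\<^sup>2)) \<partial>M)"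
    proof (rule nn_integral_cong_AE, use lim in eventually_elim)
      case (elim x)
      then have "(\<lambda>k. ennreal ((F n x - F (r k) x)\<^sup>2)) \<longlonglongrightarrow> ennreal ((F n x - y x)\<^sup>2)"
        by (intro tendsto_ennrealI tendsto_intros)
      then show ?case by (intro lim_imp_Liminf[symmetric]) auto
    qed
    also have "\<dots> \<le> liminf (\<lambda>k. \<integral>\<^sup>+x. ennreal ((F n x - F (r k) x)\<^sup>2) \<partial>M)"
      by (rule nn_integral_liminf) measurable
    also have "\<dots> \<le> ennreal e"
    proof (rule Liminf_le)
      have "\<forall>\<^sub>F k in sequentially. K \<le> k" by (rule eventually_ge_at_top)
      then show "\<forall>\<^sub>F k in sequentially. (\<integral>\<^sup>+x. ennreal ((F n x - F (r k) x)\<^sup>2) \<partial>M) \<le> ennreal e"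
      proof eventually_elim
        case (elim k)
        then have "K \<le> r k" using rk[of k] by simp
        then have "(LINT x|M. (F n x - F (r k) x)\<^sup>2) \<le> e" using n by force
        then show ?case using di[of n "r k"] by (subst nn_integral_eq_integral) (auto intro: ennreal_leI)
      qed
    qed simp
    finally show ?thesis .
  qed
  obtain N1 where N1: "\<And>m n. m \<ge> N1 \<Longrightarrow> n \<ge> N1 \<Longrightarrow> (LINT x|M. (F m x - F n x)\<^sup>2) < 1"
    using cauchy[of 1] by auto
  have "(\<integral>\<^sup>+x. ennreal ((F N1 x - y x)\<^sup>2) \<partial>M) \<le> ennreal 1"
    by (rule key[where K=N1]) (use N1 in auto)
  then have "integrable M (\<lambda>x. (F N1 x - y x)\<^sup>2)"
    by (intro integrableI_nonneg) (auto intro: le_less_trans)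
  then have "integrable M (\<lambda>x. (F N1 x - (F N1 x - y x))\<^sup>2)"
    using F by (intro square_integrable_diff[where f="F N1" and g="\<lambda>x. F N1 x - y x"]) auto
  then have y2: "integrable M (\<lambda>x. (y x)\<^sup>2)" by simp
  have "(\<lambda>n. LINT x|M. (F n x - y x)\<^sup>2) \<longlonglongrightarrow> 0"
  proof (rule LIMSEQ_I)
    fix e :: real assume e: "0 < e"
    obtain K where K: "\<And>m n. m \<ge> K \<Longrightarrow> n \<ge> K \<Longrightarrow> (LINT x|M. (F m x - F n x)\<^sup>2) < e / 2"
      using cauchy[of "e / 2"] e by auto
    show "\<exists>N. \<forall>n\<ge>N. norm ((LINT x|M. (F n x - y x)\<^sup>2) - 0) < e"
    proof (intro exI[of _ K] allI impI)
      fix n assume n: "n \<ge> K"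
      have "(\<integral>\<^sup>+x. ennreal ((F n x - y x)\<^sup>2) \<partial>M) \<le> ennreal (e / 2)"
        by (rule key[where K=K]) (use K n e in auto)
      moreover have "(\<integral>\<^sup>+x. ennreal ((F n x - y x)\<^sup>2) \<partial>M) = ennreal (LINT x|M. (F n x - y x)\<^sup>2)"
        by (intro nn_integral_eq_integral square_integrable_diff F y2) auto
      ultimately have "(LINT x|M. (F n x - y x)\<^sup>2) \<le> e / 2" using e by (simp add: ennreal_le_iff)
      then show "norm ((LINT x|M. (F n x - y x)\<^sup>2) - 0) < e" using e by simp
    qed
  qed
  then show ?thesis using that[OF ym y2] by blast
qed

section \<open>Sums of integrable and bounded functions\<close>

text \<open>
  The space \<open>L\<^sup>m + L\<^sup>\<infinity>\<close>. Only the large values of \<open>f\<close> count, so these spaces decrease as \<open>m\<close> grows and a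
  single exponent records the integrability of a sum of terms with different growth.
\<close>

definition LpLinf :: "real \<Rightarrow> (real ^ 'n::finite \<Rightarrow> real) \<Rightarrow> bool" where
  "LpLinf m f \<longleftrightarrow> f \<in> borel_measurable borel \<and>
    (\<exists>C\<ge>0. integrable lborel (\<lambda>x. (max 0 (\<bar>f x\<bar> - C)) powr m))"

lemma LpLinf_measurable [measurable_dest]: "LpLinf m f \<Longrightarrow> f \<in> borel_measurable borel"
  by (simp add: LpLinf_def)

lemma LpLinfI:
  fixes f :: "real ^ 'n::finite \<Rightarrow> real"
  assumes [measurable]: "f \<in> borel_measurable borel" "b \<in> borel_measurable borel"
    and le: "AE x in lborel. \<bar>f x\<bar> \<le> C + b x" and b: "\<And>x. 0 \<le> b x" and C: "0 \<le> C" and m: "0 \<le> m"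
    and int: "integrable lborel (\<lambda>x. b x powr m)"
  shows "LpLinf m f"
  unfolding LpLinf_def
proof (intro conjI exI[of _ C] C Bochner_Integration.integrable_bound[OF int])
  show "AE x in lborel. norm ((max 0 (\<bar>f x\<bar> - C)) powr m) \<le> norm (b x powr m)"
    using le
  proof eventually_elim
    case (elim x)
    then have "max 0 (\<bar>f x\<bar> - C) \<le> b x" using b[of x] by auto
    then show ?case using m by (simp add: powr_mono2)
  qed
qed measurable

lemma LpLinfE:
  fixes f :: "real ^ 'n::finite \<Rightarrow> real"
  assumes "LpLinf m f"
  obtains C b where "0 \<le> C" "\<And>x. 0 \<le> b x" "b \<in> borel_measurable borel" "\<And>x. \<bar>f x\<bar> \<le> C + b x"
    "integrable lborel (\<lambda>x. b x powr m)"
proof -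
  have [measurable]: "f \<in> borel_measurable borel" using assms by (simp add: LpLinf_def)
  obtain C where C: "0 \<le> C" "integrable lborel (\<lambda>x. (max 0 (\<bar>f x\<bar> - C)) powr m)"
    using assms by (auto simp: LpLinf_def)
  show ?thesis
    by (rule that[of C "\<lambda>x. max 0 (\<bar>f x\<bar> - C)"]) (use C in \<open>auto simp: max_def\<close>)
qed

lemma powr_add_le:
  fixes a b :: real
  assumes "0 \<le> a" "0 \<le> b" "0 \<le> m"
  shows "(a + b) powr m \<le> 2 powr m * (a powr m + b powr m)"
proof -
  have "(a + b) powr m \<le> (2 * max a b) powr m" using assms by (intro powr_mono2) auto
  also have "\<dots> = 2 powr m * max a b powr m" by (rule powr_mult)
  also have "\<dots> \<le> 2 powr m * (a powr m + b powr m)"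
    by (intro mult_left_mono) (auto simp: max_def)
  finally show ?thesis .
qed

lemma LpLinf_bounded:
  fixes f :: "real ^ 'n::finite \<Rightarrow> real"
  assumes "f \<in> borel_measurable borel" "AE x in lborel. \<bar>f x\<bar> \<le> C" "0 < m"
  shows "LpLinf m f"
proof (rule LpLinfI[of f "\<lambda>_. 0" "\<bar>C\<bar>"])
  show "AE x in lborel. \<bar>f x\<bar> \<le> \<bar>C\<bar> + 0" using assms(2) by eventually_elim auto
qed (use assms in auto)

lemma LpLinf_mono_AE:
  fixes f g :: "real ^ 'n::finite \<Rightarrow> real"
  assumes "LpLinf m g" and [measurable]: "f \<in> borel_measurable borel" and le: "AE x in lborel. \<bar>f x\<bar> \<le> \<bar>g x\<bar>" and "0 \<le> m"
  shows "LpLinf m f"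
proof -
  obtain C b where b: "0 \<le> C" "\<And>x. 0 \<le> b x" "b \<in> borel_measurable borel" "\<And>x. \<bar>g x\<bar> \<le> C + b x"
    "integrable lborel (\<lambda>x. b x powr m)" using LpLinfE[OF assms(1)] by metis
  show ?thesis
  proof (rule LpLinfI[OF _ b(3) _ b(2) b(1) \<open>0 \<le> m\<close> b(5)])
    show "AE x in lborel. \<bar>f x\<bar> \<le> C + b x"
      using le by eventually_elim (use b(4) order_trans in blast)
  qed measurable
qed

lemma LpLinf_add:
  fixes f g :: "real ^ 'n::finite \<Rightarrow> real"
  assumes f: "LpLinf m f" and g: "LpLinf m g" and m: "0 \<le> m"
  shows "LpLinf m (\<lambda>x. f x + g x)"
proof -
  obtain C b where b: "0 \<le> C" "\<And>x. 0 \<le> b x" "b \<in> borel_measurable borel" "\<And>x. \<bar>f x\<bar> \<le> C + b x"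
    "integrable lborel (\<lambda>x. b x powr m)" using LpLinfE[OF f] by metis
  obtain D d where d: "0 \<le> D" "\<And>x. 0 \<le> d x" "d \<in> borel_measurable borel" "\<And>x. \<bar>g x\<bar> \<le> D + d x"
    "integrable lborel (\<lambda>x. d x powr m)" using LpLinfE[OF g] by metis
  have [measurable]: "b \<in> borel_measurable borel" "d \<in> borel_measurable borel"
    "f \<in> borel_measurable borel" "g \<in> borel_measurable borel"
    using b d f g by (auto simp: LpLinf_def)
  have i: "integrable lborel (\<lambda>x. 2 powr m * (b x powr m + d x powr m))" using b d by simp
  show ?thesis
  proof (rule LpLinfI[of _ "\<lambda>x. b x + d x" "C + D"])
    show "AE x in lborel. \<bar>f x + g x\<bar> \<le> (C + D) + (b x + d x)"
    proof (intro AE_I2)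
      fix x show "\<bar>f x + g x\<bar> \<le> (C + D) + (b x + d x)" using b(4)[of x] d(4)[of x] by linarith
    qed
    show "integrable lborel (\<lambda>x. (b x + d x) powr m)"
      by (rule Bochner_Integration.integrable_bound[OF i], measurable)
        (use powr_add_le[OF b(2) d(2) m] in \<open>auto intro: order_trans[OF _ abs_ge_self]\<close>)
  qed (use b(1,2) d(1,2) m in auto)
qed

lemma LpLinf_mult_bounded:
  fixes f g :: "real ^ 'n::finite \<Rightarrow> real"
  assumes f: "LpLinf m f" and [measurable]: "g \<in> borel_measurable borel" and g: "AE x in lborel. \<bar>g x\<bar> \<le> D" and m: "0 \<le> m"
  shows "LpLinf m (\<lambda>x. g x * f x)"
proof -
  obtain C b where b: "0 \<le> C" "\<And>x. 0 \<le> b x" "b \<in> borel_measurable borel" "\<And>x. \<bar>f x\<bar> \<le> C + b x"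
    "integrable lborel (\<lambda>x. b x powr m)" using LpLinfE[OF f] by metis
  have [measurable]: "b \<in> borel_measurable borel" "f \<in> borel_measurable borel"
    using b f by (auto simp: LpLinf_def)
  show ?thesis
  proof (rule LpLinfI[of _ "\<lambda>x. \<bar>D\<bar> * b x" "\<bar>D\<bar> * C"])
    show "AE x in lborel. \<bar>g x * f x\<bar> \<le> \<bar>D\<bar> * C + \<bar>D\<bar> * b x"
      using g
    proof eventually_elim
      case (elim x)
      then have "\<bar>g x\<bar> * \<bar>f x\<bar> \<le> \<bar>D\<bar> * (C + b x)" by (intro mult_mono b(4)) auto
      then show ?case by (simp add: abs_mult distrib_left)
    qed
    show "integrable lborel (\<lambda>x. (\<bar>D\<bar> * b x) powr m)"
      using b by (simp add: powr_mult)
  qed (use b m in auto)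
qed

lemma LpLinf_cmult:
  fixes f :: "real ^ 'n::finite \<Rightarrow> real"
  shows "LpLinf m f \<Longrightarrow> 0 \<le> m \<Longrightarrow> LpLinf m (\<lambda>x. c * f x)"
  by (rule LpLinf_mult_bounded[where D="\<bar>c\<bar>"]) auto

lemma LpLinf_antimono:
  fixes f :: "real ^ 'n::finite \<Rightarrow> real"
  assumes f: "LpLinf m f" and m: "0 \<le> m'" "m' \<le> m"
  shows "LpLinf m' f"
proof -
  obtain C b where b: "0 \<le> C" "\<And>x. 0 \<le> b x" "b \<in> borel_measurable borel" "\<And>x. \<bar>f x\<bar> \<le> C + b x"
    "integrable lborel (\<lambda>x. b x powr m)" using LpLinfE[OF f] by metis
  have [measurable]: "b \<in> borel_measurable borel" "f \<in> borel_measurable borel"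
    using b f by (auto simp: LpLinf_def)
  show ?thesis
  proof (rule LpLinfI[of _ "\<lambda>x. if b x < 1 then 0 else b x" "C + 1"])
    show "AE x in lborel. \<bar>f x\<bar> \<le> C + 1 + (if b x < 1 then 0 else b x)"
    proof (intro AE_I2)
      fix x show "\<bar>f x\<bar> \<le> C + 1 + (if b x < 1 then 0 else b x)" using b(4)[of x] by auto
    qed
    show "integrable lborel (\<lambda>x. (if b x < 1 then 0 else b x) powr m')"
    proof (rule Bochner_Integration.integrable_bound[OF b(5)])
      show "AE x in lborel. norm ((if b x < 1 then 0 else b x) powr m') \<le> norm (b x powr m)"
        using m by (auto intro!: AE_I2 powr_mono)
    qed measurable
  qed (use b m in auto)
qed

lemma LpLinf_powr:
  fixes f :: "real ^ 'n::finite \<Rightarrow> real"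
  assumes f: "LpLinf m f" and s: "0 < s" and m: "0 \<le> m"
  shows "LpLinf (m / s) (\<lambda>x. \<bar>f x\<bar> powr s)"
proof -
  obtain C b where b: "0 \<le> C" "\<And>x. 0 \<le> b x" "b \<in> borel_measurable borel" "\<And>x. \<bar>f x\<bar> \<le> C + b x"
    "integrable lborel (\<lambda>x. b x powr m)" using LpLinfE[OF f] by metis
  have [measurable]: "b \<in> borel_measurable borel" "f \<in> borel_measurable borel"
    using b f by (auto simp: LpLinf_def)
  show ?thesis
  proof (rule LpLinfI[of _ "\<lambda>x. 2 powr s * b x powr s" "2 powr s * C powr s"])
    show "AE x in lborel. \<bar>\<bar>f x\<bar> powr s\<bar> \<le> 2 powr s * C powr s + 2 powr s * b x powr s"
    proof (intro AE_I2)
      fix x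
      have "\<bar>f x\<bar> powr s \<le> (C + b x) powr s" using s b(4)[of x] by (intro powr_mono2) auto
      also have "\<dots> \<le> 2 powr s * (C powr s + b x powr s)" using s b by (intro powr_add_le) auto
      finally show "\<bar>\<bar>f x\<bar> powr s\<bar> \<le> 2 powr s * C powr s + 2 powr s * b x powr s" by (simp add: distrib_left)
    qed
    show "integrable lborel (\<lambda>x. (2 powr s * b x powr s) powr (m / s))"
      using b s by (simp add: powr_mult powr_powr)
  qed (use s m in auto)
qed

lemma LpLinf_of_square_integrable:
  fixes f :: "real ^ 'n::finite \<Rightarrow> real"
  assumes [measurable]: "f \<in> borel_measurable borel" and "integrable lborel (\<lambda>x. (f x)\<^sup>2)"
  shows "LpLinf 2 f"
  by (rule LpLinfI[of f "\<lambda>x. \<bar>f x\<bar>" 0]) (use assms in auto)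

lemma LpLinf_1E:
  fixes f :: "real ^ 'n::finite \<Rightarrow> real"
  assumes "LpLinf 1 f"
  obtains C b where "0 \<le> C" "\<And>x. 0 \<le> b x" "integrable lborel b" "\<And>x. \<bar>f x\<bar> \<le> C + b x"
proof -
  obtain C b where b: "0 \<le> C" "\<And>x. 0 \<le> b x" "b \<in> borel_measurable borel" "\<And>x. \<bar>f x\<bar> \<le> C + b x"
    "integrable lborel (\<lambda>x. b x powr 1)" using LpLinfE[OF assms] by metis
  moreover have "(\<lambda>x. b x powr 1) = b" using b(2) by auto
  ultimately show ?thesis using that by metis
qed

lemma LpLinf_1_times_integrable:
  fixes f \<phi> :: "real ^ 'n::finite \<Rightarrow> real"
  assumes f: "LpLinf 1 f" and \<phi>: "integrable lborel \<phi>" "\<And>x. \<bar>\<phi> x\<bar> \<le> D"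
  shows "integrable lborel (\<lambda>x. f x * \<phi> x)"
proof -
  obtain C b where b: "0 \<le> C" "\<And>x. 0 \<le> b x" "integrable lborel b" "\<And>x. \<bar>f x\<bar> \<le> C + b x"
    using LpLinf_1E[OF f] by metis
  have [measurable]: "f \<in> borel_measurable borel" "\<phi> \<in> borel_measurable borel"
    using f \<phi> borel_measurable_integrable by (auto simp: LpLinf_def)
  have i: "integrable lborel (\<lambda>x. C * \<bar>\<phi> x\<bar> + D * b x)" using \<phi> b by simp
  show ?thesis
  proof (rule Bochner_Integration.integrable_bound[OF i])
    show "AE x in lborel. norm (f x * \<phi> x) \<le> norm (C * \<bar>\<phi> x\<bar> + D * b x)"
    proof (intro AE_I2)
      fix x
      have "\<bar>f x\<bar> * \<bar>\<phi> x\<bar> \<le> (C + b x) * \<bar>\<phi> x\<bar>" by (intro mult_right_mono b) auto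
      also have "\<dots> \<le> C * \<bar>\<phi> x\<bar> + D * b x" using mult_right_mono[OF \<phi>(2) b(2), of x x] by (simp add: algebra_simps)
      finally show "norm (f x * \<phi> x) \<le> norm (C * \<bar>\<phi> x\<bar> + D * b x)" by (simp add: abs_mult)
    qed
  qed measurable
qed

lemma LpLinf_1_times_nice: "LpLinf 1 f \<Longrightarrow> nice \<phi> \<Longrightarrow> integrable lborel (\<lambda>x. f x * \<phi> x)"
  using LpLinf_1_times_integrable nice_bounded nice_integrable by metis

section \<open>Weak solutions are Bessel potentials\<close>

text \<open>
  Fubini; the two summands of \<open>h\<close> are treated with \<open>\<phi>\<close> integrable and with \<open>\<phi>\<close> bounded, respectively.
\<close>

lemma conv_adjoint:
  fixes K h \<phi> :: "real ^ 'n::finite \<Rightarrow> real"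
  assumes K: "integrable lborel K" and h: "LpLinf 1 h" and \<phi>: "nice \<phi>"
  shows "(LINT x|lborel. h x * conv K \<phi> x) = (LINT x|lborel. conv (\<lambda>y. K (- y)) h x * \<phi> x)"
    and "integrable lborel (\<lambda>x. conv (\<lambda>y. K (- y)) h x * \<phi> x)"
proof -
  obtain C b where b: "0 \<le> C" "\<And>x. 0 \<le> b x" "integrable lborel b" "\<And>x. \<bar>h x\<bar> \<le> C + b x"
    using LpLinf_1E[OF h] by metis
  obtain D where D: "\<And>x. \<bar>\<phi> x\<bar> \<le> D" using nice_bounded[OF \<phi>] by blast
  have [measurable]: "h \<in> borel_measurable borel" "\<phi> \<in> borel_measurable borel" "K \<in> borel_measurable borel" "b \<in> borel_measurable borel"
    using h \<phi> K b borel_measurable_integrable by (auto simp: LpLinf_def nice_measurable)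
  have K': "integrable lborel (\<lambda>y. K (- y))" using integrable_reflect[of K 0] K by simp
  define H where "H x y = h x * \<phi> y * K (x - y)" for x y
  have "integrable (lborel \<Otimes>\<^sub>M lborel) (\<lambda>(y, x). \<phi> y * K (x - y))"
    by (rule integrable_conv_pair) (use \<phi> K nice_integrable in auto)
  from lborel_pair.integrable_product_swap[OF this]
  have 1: "integrable (lborel \<Otimes>\<^sub>M lborel) (\<lambda>p. \<phi> (snd p) * K (fst p - snd p))" by (simp add: case_prod_beta')
  have "integrable (lborel \<Otimes>\<^sub>M lborel) (\<lambda>(x, y). b x * (\<lambda>y. K (- y)) (y - x))"
    by (rule integrable_conv_pair[OF b(3) K'])
  then have 2: "integrable (lborel \<Otimes>\<^sub>M lborel) (\<lambda>p. b (fst p) * K (fst p - snd p))" by (simp add: case_prod_beta')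
  have 3: "integrable (lborel \<Otimes>\<^sub>M lborel) (\<lambda>p. C * \<bar>\<phi> (snd p) * K (fst p - snd p)\<bar> + D * \<bar>b (fst p) * K (fst p - snd p)\<bar>)"
    using 1 2 by simp
  have int: "integrable (lborel \<Otimes>\<^sub>M lborel) (case_prod H)"
  proof (rule Bochner_Integration.integrable_bound[OF 3])
    show "case_prod H \<in> borel_measurable (lborel \<Otimes>\<^sub>M lborel)" unfolding H_def by measurable
    show "AE p in lborel \<Otimes>\<^sub>M lborel. norm (case_prod H p) \<le> norm (C * \<bar>\<phi> (snd p) * K (fst p - snd p)\<bar> + D * \<bar>b (fst p) * K (fst p - snd p)\<bar>)"
    proof (intro AE_I2)
      fix p :: "(real ^ 'n) \<times> (real ^ 'n)"
      obtain x y where p: "p = (x, y)" by fastforce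
      have "\<bar>h x\<bar> * (\<bar>\<phi> y\<bar> * \<bar>K (x - y)\<bar>) \<le> (C + b x) * (\<bar>\<phi> y\<bar> * \<bar>K (x - y)\<bar>)"
        by (intro mult_right_mono b) auto
      also have "\<dots> = C * (\<bar>\<phi> y\<bar> * \<bar>K (x - y)\<bar>) + \<bar>\<phi> y\<bar> * (b x * \<bar>K (x - y)\<bar>)" by (simp add: algebra_simps)
      also have "\<dots> \<le> C * (\<bar>\<phi> y\<bar> * \<bar>K (x - y)\<bar>) + D * (b x * \<bar>K (x - y)\<bar>)"
        by (intro add_left_mono mult_right_mono D) (auto simp: b)
      also have "\<dots> \<le> norm (C * \<bar>\<phi> y * K (x - y)\<bar> + D * \<bar>b x * K (x - y)\<bar>)"
        using b(2)[of x] by (simp add: abs_mult)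
      finally show "norm (case_prod H p) \<le> norm (C * \<bar>\<phi> (snd p) * K (fst p - snd p)\<bar> + D * \<bar>b (fst p) * K (fst p - snd p)\<bar>)"
        by (simp add: p H_def abs_mult mult.assoc)
    qed
  qed
  have i1: "(LINT y|lborel. H x y) = h x * conv K \<phi> x" for x
    by (simp add: H_def mult.assoc conv_commute[of K \<phi>]) (simp add: conv_def)
  have i2: "(LINT x|lborel. H x y) = conv (\<lambda>y. K (- y)) h y * \<phi> y" for y
  proof -
    have "(LINT x|lborel. H x y) = (LINT x|lborel. (h x * K (- (y - x))) * \<phi> y)" by (simp add: H_def mult_ac)
    also have "\<dots> = conv h (\<lambda>y. K (- y)) y * \<phi> y" unfolding conv_def by (rule integral_mult_left_zero)
    finally show ?thesis by (simp add: conv_commute[of "\<lambda>y. K (- y)" h])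
  qed
  show "(LINT x|lborel. h x * conv K \<phi> x) = (LINT x|lborel. conv (\<lambda>y. K (- y)) h x * \<phi> x)"
    using lborel_pair.Fubini_integral[OF int] unfolding i1 i2 by simp
  show "integrable lborel (\<lambda>x. conv (\<lambda>y. K (- y)) h x * \<phi> x)"
    using lborel_pair.integrable_snd[OF int] unfolding i2 .
qed

lemma laplacian_mult:
  fixes \<psi> :: "real ^ 'n::finite \<Rightarrow> real"
  assumes \<psi>: "nice \<psi>" and \<kappa>: "smooth \<kappa>"
  shows "laplacian (\<lambda>x. \<kappa> x * \<psi> x) x = \<kappa> x * laplacian \<psi> x
    + (\<Sum>i\<in>UNIV. 2 * (partial i \<kappa> x * partial i \<psi> x)) + (\<Sum>i\<in>UNIV. partial i (partial i \<kappa>) x * \<psi> x)"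
proof -
  note d = smooth_differentiable[OF \<kappa>] nice_differentiable[OF \<psi>]
    smooth_differentiable[OF smooth_partial[OF \<kappa>]] nice_differentiable[OF nice_partial[OF \<psi>]]
  have 1: "partial i (\<lambda>x. \<kappa> x * \<psi> x) = (\<lambda>x. partial i \<kappa> x * \<psi> x + \<kappa> x * partial i \<psi> x)" for i
    by (rule ext) (intro partial_mult d)
  have "partial i (partial i (\<lambda>x. \<kappa> x * \<psi> x)) x
      = \<kappa> x * partial i (partial i \<psi>) x + 2 * (partial i \<kappa> x * partial i \<psi> x) + partial i (partial i \<kappa>) x * \<psi> x" for i
    unfolding 1 by (subst partial_add) (auto intro!: derivative_intros d simp: partial_mult d)
  then show ?thesis by (simp add: laplacian_def sum.distrib sum_distrib_left)
qed

text \<open>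
  Apply the hypothesis to \<open>\<psi>\<close> times a cutoff of radius \<open>n\<close>. Every derivative that hits the cutoff brings a
  factor \<open>1 / n\<close>, and the remaining terms converge by domination.
\<close>

lemma weak_helmholtz_extends:
  fixes f h \<psi> :: "real ^ 'n::finite \<Rightarrow> real"
  assumes f: "LpLinf 1 f" and h: "LpLinf 1 h" and \<psi>: "nice \<psi>"
    and weak: "\<And>\<phi>. \<phi> \<in> test_functions \<Longrightarrow> (LINT x|lborel. f x * (\<phi> x - laplacian \<phi> x)) = (LINT x|lborel. h x * \<phi> x)"
  shows "(LINT x|lborel. f x * (\<psi> x - laplacian \<psi> x)) = (LINT x|lborel. h x * \<psi> x)"
proof -
  have bn: "nice (bump :: real ^ 'n \<Rightarrow> real)"
  proof -
    have "(\<lambda>x::real^'n. bump ((1 / real (Suc 0)) *\<^sub>R x)) \<in> test_functions" by (rule cutoff_test_function)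
    then show ?thesis by (intro test_functions_nice) simp
  qed
  obtain D where D: "0 \<le> D" "\<And>i x. \<bar>partial i bump (x::real^'n)\<bar> \<le> D" "\<And>i j x. \<bar>partial i (partial j bump) (x::real^'n)\<bar> \<le> D"
    using nice_partials_bound[OF bn] by metis
  define r where "r n = 1 / real (Suc n)" for n
  have r: "0 \<le> r n" "r n \<le> 1" for n by (auto simp: r_def)
  have r0: "r \<longlonglongrightarrow> 0" unfolding r_def[abs_def] by (rule LIMSEQ_Suc[OF lim_1_over_n])
  define \<kappa> where "\<kappa> n x = bump (r n *\<^sub>R x)" for n and x :: "real ^ 'n"
  have \<kappa>s: "smooth (\<kappa> n)" for n unfolding \<kappa>_def[abs_def] by (intro smooth_scaled smooth_bump)
  have p1: "partial i (\<kappa> n) = (\<lambda>x. r n * partial i bump (r n *\<^sub>R x))" for i n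
    unfolding \<kappa>_def[abs_def] by (rule ext) (intro partial_scaled smooth_differentiable smooth_bump)
  have p2: "partial i (partial i (\<kappa> n)) x = r n * (r n * partial i (partial i bump) (r n *\<^sub>R x))" for i n x
  proof -
    have d: "partial i bump differentiable at y" for y :: "real ^ 'n"
      by (intro smooth_differentiable smooth_partial smooth_bump)
    have "(\<lambda>x. partial i bump (r n *\<^sub>R x)) differentiable (at x)" for x
      by (intro smooth_differentiable smooth_scaled smooth_partial smooth_bump)
    then have "partial i (\<lambda>x. r n * partial i bump (r n *\<^sub>R x)) x = r n * partial i (\<lambda>x. partial i bump (r n *\<^sub>R x)) x"
      by (subst partial_mult) auto
    then show ?thesis unfolding p1 by (simp add: partial_scaled d)
  qed
  \<comment> \<open>The terms of \<open>\<Delta>(\<kappa>\<^sub>n \<psi>)\<close> in which a derivative falls on the cutoff.\<close>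
  define E where "E n x = (\<Sum>i\<in>UNIV. 2 * (partial i (\<kappa> n) x * partial i \<psi> x)) + (\<Sum>i\<in>UNIV. partial i (partial i (\<kappa> n)) x * \<psi> x)" for n x
  have test: "(\<lambda>x. \<kappa> n x * \<psi> x) \<in> test_functions" for n
    unfolding \<kappa>_def r_def by (rule test_functions_cutoff[OF nice_smooth[OF \<psi>]])
  have eq: "(LINT x|lborel. f x * (\<kappa> n x * (\<psi> x - laplacian \<psi> x) - E n x)) = (LINT x|lborel. h x * (\<kappa> n x * \<psi> x))" for n
    using weak[OF test[of n]] laplacian_mult[OF \<psi> \<kappa>s[of n]] by (simp add: E_def algebra_simps)
  have lapn: "integrable lborel (\<lambda>x. f x * laplacian \<psi> x)" "integrable lborel (\<lambda>x. f x * (\<psi> x - laplacian \<psi> x))"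
  proof -
    show 1: "integrable lborel (\<lambda>x. f x * laplacian \<psi> x)"
      unfolding laplacian_def sum_distrib_left
      by (intro Bochner_Integration.integrable_sum LpLinf_1_times_nice f nice_partials \<psi>)
    show "integrable lborel (\<lambda>x. f x * (\<psi> x - laplacian \<psi> x))"
      using 1 LpLinf_1_times_nice[OF f \<psi>] by (simp add: right_diff_distrib)
  qed
  have \<kappa>b: "\<bar>\<kappa> n x\<bar> \<le> 1" for n x by (simp add: \<kappa>_def bump_nonneg bump_le_1)
  have \<kappa>l: "(\<lambda>n. \<kappa> n x) \<longlonglongrightarrow> 1" for x unfolding \<kappa>_def r_def by (rule cutoff_tendsto_1)
  define w where "w x = \<bar>f x * (\<psi> x - laplacian \<psi> x)\<bar> + ((\<Sum>i\<in>UNIV. 2 * D * \<bar>f x * partial i \<psi> x\<bar>) + (\<Sum>i\<in>(UNIV::'n set). D * \<bar>f x * \<psi> x\<bar>))" for x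
  have wi: "integrable lborel w"
    unfolding w_def
    by (intro Bochner_Integration.integrable_add Bochner_Integration.integrable_sum integrable_mult_right integrable_abs lapn
        LpLinf_1_times_nice f \<psi> nice_partial)
  have a1: "\<bar>partial i (\<kappa> n) x\<bar> \<le> r n * D" for i n x
    unfolding p1 using r[of n] D(1,2) by (simp add: abs_mult mult_left_mono)
  have a2: "\<bar>partial i (partial i (\<kappa> n)) x\<bar> \<le> r n * D" for i n x
  proof -
    have "r n * (r n * \<bar>partial i (partial i bump) (r n *\<^sub>R x)\<bar>) \<le> r n * (1 * D)"
      using r[of n] D(1) by (intro mult_left_mono mult_mono D(3)) auto
    then show ?thesis unfolding p2 using r[of n] by (simp add: abs_mult)
  qed
  have a1': "\<bar>partial i (\<kappa> n) x\<bar> \<le> D" "\<bar>partial i (partial i (\<kappa> n)) x\<bar> \<le> D" for i n x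
    using a1[of i n x] a2[of i n x] r[of n] D(1) mult_left_le_one_le[of D "r n"] by linarith+
  have El: "(\<lambda>n. E n x) \<longlonglongrightarrow> 0" for x
  proof -
    have rD: "(\<lambda>n. r n * D) \<longlonglongrightarrow> 0" using tendsto_mult_left_zero[OF r0] by simp
    have 1: "(\<lambda>n. partial i (\<kappa> n) x) \<longlonglongrightarrow> 0" for i
      by (rule Lim_null_comparison[OF _ rD]) (simp add: a1)
    have 2: "(\<lambda>n. partial i (partial i (\<kappa> n)) x) \<longlonglongrightarrow> 0" for i
      by (rule Lim_null_comparison[OF _ rD]) (simp add: a2)
    have "(\<lambda>n. E n x) \<longlonglongrightarrow> (\<Sum>i\<in>UNIV. 2 * (0 * partial i \<psi> x)) + (\<Sum>i\<in>(UNIV::'n set). 0 * \<psi> x)"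
      unfolding E_def by (intro tendsto_intros 1 2)
    then show ?thesis by simp
  qed
  have [measurable]: "f \<in> borel_measurable borel" "h \<in> borel_measurable borel" "\<psi> \<in> borel_measurable borel" "\<kappa> n \<in> borel_measurable borel"
     "partial i (\<kappa> n) \<in> borel_measurable borel" "partial i (partial i (\<kappa> n)) \<in> borel_measurable borel" "partial i \<psi> \<in> borel_measurable borel" for n i
    using f h \<psi> by (auto simp: LpLinf_def nice_measurable nice_partial intro!: borel_measurable_continuous_onI smooth_continuous \<kappa>s smooth_partial)
  have [measurable]: "laplacian \<psi> \<in> borel_measurable borel"
    unfolding laplacian_def[abs_def] by (intro borel_measurable_sum nice_measurable nice_partials \<psi>)
  have Em [measurable]: "E n \<in> borel_measurable borel" for n unfolding E_def[abs_def] by measurable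
  have "(\<lambda>n. LINT x|lborel. f x * (\<kappa> n x * (\<psi> x - laplacian \<psi> x) - E n x)) \<longlonglongrightarrow> (LINT x|lborel. f x * (\<psi> x - laplacian \<psi> x))"
  proof (rule integral_dominated_convergence[OF _ _ wi])
    show "AE x in lborel. (\<lambda>n. f x * (\<kappa> n x * (\<psi> x - laplacian \<psi> x) - E n x)) \<longlonglongrightarrow> f x * (\<psi> x - laplacian \<psi> x)"
    proof (intro AE_I2)
      fix x
      have "(\<lambda>n. f x * (\<kappa> n x * (\<psi> x - laplacian \<psi> x) - E n x)) \<longlonglongrightarrow> f x * (1 * (\<psi> x - laplacian \<psi> x) - 0)"
        by (intro tendsto_intros \<kappa>l El)
      then show "(\<lambda>n. f x * (\<kappa> n x * (\<psi> x - laplacian \<psi> x) - E n x)) \<longlonglongrightarrow> f x * (\<psi> x - laplacian \<psi> x)" by simp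
    qed
    show "AE x in lborel. norm (f x * (\<kappa> n x * (\<psi> x - laplacian \<psi> x) - E n x)) \<le> w x" for n
    proof (intro AE_I2)
      fix x
      have "\<bar>f x * (\<kappa> n x * (\<psi> x - laplacian \<psi> x))\<bar> \<le> \<bar>f x * (\<psi> x - laplacian \<psi> x)\<bar>"
        using mult_right_mono[OF \<kappa>b[of n x], of "\<bar>f x * (\<psi> x - laplacian \<psi> x)\<bar>"] by (simp add: abs_mult mult_ac)
      moreover have "\<bar>f x * E n x\<bar> \<le> (\<Sum>i\<in>UNIV. 2 * D * \<bar>f x * partial i \<psi> x\<bar>) + (\<Sum>i\<in>(UNIV::'n set). D * \<bar>f x * \<psi> x\<bar>)"
      proof -
        let ?a = "\<lambda>i. 2 * partial i (\<kappa> n) x * (f x * partial i \<psi> x)"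
        let ?b = "\<lambda>i. partial i (partial i (\<kappa> n)) x * (f x * \<psi> x)"
        have e: "f x * E n x = (\<Sum>i\<in>UNIV. ?a i) + (\<Sum>i\<in>UNIV. ?b i)"
          by (simp add: E_def distrib_left sum_distrib_left mult_ac)
        have "\<bar>\<Sum>i\<in>UNIV. ?a i\<bar> \<le> (\<Sum>i\<in>UNIV. 2 * D * \<bar>f x * partial i \<psi> x\<bar>)"
          using a1' by (intro order_trans[OF sum_abs] sum_mono) (auto simp: abs_mult intro!: mult_right_mono)
        moreover have "\<bar>\<Sum>i\<in>UNIV. ?b i\<bar> \<le> (\<Sum>i\<in>(UNIV::'n set). D * \<bar>f x * \<psi> x\<bar>)"
          using a1' by (intro order_trans[OF sum_abs] sum_mono) (auto simp: abs_mult intro!: mult_right_mono)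
        ultimately show ?thesis unfolding e by linarith
      qed
      ultimately show "norm (f x * (\<kappa> n x * (\<psi> x - laplacian \<psi> x) - E n x)) \<le> w x"
        unfolding w_def right_diff_distrib real_norm_def by linarith
    qed
  qed measurable
  moreover have "(\<lambda>n. LINT x|lborel. h x * (\<kappa> n x * \<psi> x)) \<longlonglongrightarrow> (LINT x|lborel. h x * \<psi> x)"
  proof (rule integral_dominated_convergence[OF _ _ integrable_abs[OF LpLinf_1_times_nice[OF h \<psi>]]])
    show "AE x in lborel. (\<lambda>n. h x * (\<kappa> n x * \<psi> x)) \<longlonglongrightarrow> h x * \<psi> x"
      using tendsto_mult[OF tendsto_const tendsto_mult[OF \<kappa>l tendsto_const]] by fastforce
    show "AE x in lborel. norm (h x * (\<kappa> n x * \<psi> x)) \<le> \<bar>h x * \<psi> x\<bar>" for n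
    proof (intro AE_I2)
      fix x
      show "norm (h x * (\<kappa> n x * \<psi> x)) \<le> \<bar>h x * \<psi> x\<bar>"
        using mult_right_mono[OF \<kappa>b[of n x], of "\<bar>h x * \<psi> x\<bar>"] by (simp add: abs_mult mult_ac)
    qed
  qed measurable
  ultimately show ?thesis unfolding eq using LIMSEQ_unique by blast
qed

text \<open>
  The function \<open>\<psi> = B * \<phi>\<close> is nice and solves \<open>\<psi> - \<Delta>\<psi> = \<phi>\<close>. Used in the weak equation it shows that \<open>f\<close> and
  \<open>B * h\<close> have the same integral against \<open>\<phi>\<close>.
\<close>

lemma bessel_potential_of_weak_helmholtz:
  fixes f h :: "real ^ 'n::finite \<Rightarrow> real"
  assumes f: "LpLinf 1 f" and h: "LpLinf 1 h"
    and weak: "\<And>\<phi>. \<phi> \<in> test_functions \<Longrightarrow> (LINT x|lborel. f x * (\<phi> x - laplacian \<phi> x)) = (LINT x|lborel. h x * \<phi> x)"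
  shows "AE x in lborel. f x = conv bessel h x"
proof -
  have be: "(\<lambda>y. bessel (- y :: real ^ 'n)) = bessel" by (auto simp: bessel_even)
  have [measurable]: "f \<in> borel_measurable borel" "h \<in> borel_measurable borel" using f h by (auto simp: LpLinf_def)
  have "AE x in lborel. f x - conv bessel h x = 0"
  proof (rule AE_eq_0_if_orthogonal_to_test_functions)
    fix \<phi> :: "real ^ 'n \<Rightarrow> real" assume "\<phi> \<in> test_functions"
    then have \<phi>: "nice \<phi>" by (rule test_functions_nice)
    have i1: "integrable lborel (\<lambda>x. f x * \<phi> x)" by (rule LpLinf_1_times_nice[OF f \<phi>])
    have i2: "integrable lborel (\<lambda>x. conv bessel h x * \<phi> x)"
      using conv_adjoint(2)[OF integrable_bessel h \<phi>] by (simp add: be)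
    show "integrable lborel (\<lambda>x. (f x - conv bessel h x) * \<phi> x)"
      using i1 i2 by (simp add: left_diff_distrib)
    have "(LINT x|lborel. f x * \<phi> x) = (LINT x|lborel. f x * (conv bessel \<phi> x - laplacian (conv bessel \<phi>) x))"
      by (simp add: conv_bessel_inverse \<phi>)
    also have "\<dots> = (LINT x|lborel. h x * conv bessel \<phi> x)"
      by (rule weak_helmholtz_extends[OF f h nice_conv[OF integrable_bessel \<phi>] weak])
    also have "\<dots> = (LINT x|lborel. conv bessel h x * \<phi> x)"
      using conv_adjoint(1)[OF integrable_bessel h \<phi>] by (simp add: be)
    finally show "(LINT x|lborel. (f x - conv bessel h x) * \<phi> x) = 0"
      using i1 i2 by (simp add: left_diff_distrib)
  qed measurable
  then show ?thesis by simp
qed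

section \<open>Young's inequality\<close>

text \<open>
  Together with \<open>optimise_scale\<close> this replaces the inequalities of Jensen and Hoelder: a power is
  linearised with a free scale \<open>l\<close>, the linear bound is integrated, and \<open>l\<close> is chosen afterwards.
\<close>

lemma scale_split:
  fixes a l p :: real
  assumes "0 \<le> a" "0 < l" "1 \<le> p"
  shows "a \<le> l + l powr (1 - p) * a powr p"
proof (cases "a \<le> l")
  case False
  then have a: "0 < a" using assms by simp
  have "a = a powr (1 - p) * a powr p" using a by (simp flip: powr_add)
  also have "\<dots> \<le> l powr (1 - p) * a powr p"
    using False assms by (intro mult_right_mono powr_mono2') auto
  finally show ?thesis using assms by simp
qed (simp add: add_increasing2)

text \<open>
  Take \<open>l = J\<^bsup>1/p\<^esup>\<close>.
\<close>

lemma optimise_scale: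
  fixes b c J p :: real
  assumes b: "0 \<le> b" and J: "0 \<le> J" and c: "0 \<le> c" and p: "1 \<le> p"
    and le: "\<And>l. 0 < l \<Longrightarrow> b \<le> c * (l + l powr (1 - p) * J)"
  shows "b powr p \<le> (2 * c) powr p * J"
proof (cases "J = 0")
  case True
  have "b \<le> c * l" if "0 < l" for l using le[OF that] True by simp
  then have "b \<le> 0"
  proof (cases "c = 0")
    case False
    show ?thesis
    proof (rule field_le_epsilon)
      fix e :: real assume "0 < e"
      then show "b \<le> 0 + e" using \<open>\<And>l. 0 < l \<Longrightarrow> b \<le> c * l\<close>[of "e / c"] False c by simp
    qed
  qed (use \<open>\<And>l. 0 < l \<Longrightarrow> b \<le> c * l\<close>[of 1] in simp)
  then have "b = 0" using b by simp
  then show ?thesis using True p by simp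
next
  case False
  then have J0: "0 < J" using J by simp
  define l where "l = J powr (1 / p)"
  have "l powr (1 - p) * J = J powr ((1 / p) * (1 - p)) * J powr 1"
    using J0 by (simp add: l_def powr_powr)
  also have "\<dots> = J powr ((1 / p) * (1 - p) + 1)" by (simp only: powr_add)
  also have "(1 / p) * (1 - p) + 1 = 1 / p" using p by (simp add: field_simps)
  finally have "b \<le> c * (l + l)" using le[of l] J0 by (simp add: l_def)
  then have "b powr p \<le> (2 * c * l) powr p" using b p by (intro powr_mono2) auto
  also have "\<dots> = (2 * c) powr p * l powr p" by (rule powr_mult)
  also have "l powr p = J" using J0 p by (simp add: l_def powr_powr)
  finally show ?thesis .
qed

text \<open>
  Put \<open>X = a\<^sup>q\<close>, \<open>Y = b\<^sup>r\<close> and \<open>S = X + Y\<close>. Then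
  \<open>a b = (X Y)\<^bsup>1/p\<^esup> X\<^bsup>1-1/r\<^esup> Y\<^sup>t \<le> (X Y)\<^bsup>1/p\<^esup> S\<^bsup>1-1/p\<^esup> = S (X Y / S)\<^bsup>1/p\<^esup>\<close>, to which \<open>scale_split\<close> applies.
\<close>

lemma young_pointwise:
  fixes a b p q r t :: real
  assumes a: "0 \<le> a" and b: "0 \<le> b" and t: "0 \<le> t" "t < 1" and r: "1 \<le> r" and q: "q = 1 / (1 - t)"
    and tr: "t < 1 / r" and p: "p = 1 / (1 / r - t)" and l: "0 < l"
  shows "a * b \<le> l * (a powr q + b powr r) + l powr (1 - p) * (a powr q * b powr r)"
proof (cases "a = 0 \<or> b = 0")
  case True
  then show ?thesis using l by auto
next
  case False
  then have ab: "0 < a" "0 < b" using a b by auto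
  define X Y where "X = a powr q" and "Y = b powr r"
  define S where "S = X + Y"
  have XY: "0 < X" "0 < Y" "0 < S" "X \<le> S" "Y \<le> S" using ab by (auto simp: X_def Y_def S_def intro!: add_pos_pos)
  have "1 / r \<le> 1" using r by simp
  then have p1: "1 \<le> p" unfolding p using tr t by (subst le_divide_eq_1_pos) auto
  have ip: "1 / p = 1 / r - t" using tr by (simp add: p)
  have aX: "a = X powr (1 - t)" using ab t by (simp add: X_def q powr_powr)
  have bY: "b = Y powr (1 / r)" using ab r by (simp add: Y_def powr_powr)
  have "a * b = (X powr (1/p) * X powr (1 - 1/r)) * (Y powr (1/p) * Y powr t)"
    unfolding aX bY by (simp only: powr_add[symmetric] ip) (simp add: algebra_simps)
  also have "\<dots> \<le> (X powr (1/p) * S powr (1 - 1/r)) * (Y powr (1/p) * S powr t)"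
    using XY t r by (intro mult_mono mult_left_mono powr_mono2) auto
  also have "\<dots> = (X * Y) powr (1/p) * S powr ((1 - 1/r) + t)"
    by (simp add: powr_mult powr_add)
  also have "(1 - 1/r) + t = 1 - 1/p" using ip by simp
  also have "(X * Y) powr (1/p) * S powr (1 - 1/p) = S * (X * Y / S) powr (1/p)"
    using XY by (simp add: powr_diff powr_divide)
  also have "\<dots> \<le> S * (l + l powr (1 - p) * ((X * Y / S) powr (1/p)) powr p)"
    using XY l p1 by (intro mult_left_mono scale_split) auto
  also have "((X * Y / S) powr (1/p)) powr p = X * Y / S" using XY p1 by (simp add: powr_powr)
  also have "S * (l + l powr (1 - p) * (X * Y / S)) = l * S + l powr (1 - p) * (X * Y)"
    using XY by (simp add: field_simps)
  finally show ?thesis by (simp add: X_def Y_def S_def)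
qed

lemma young_pointwise_conjugate:
  fixes a b q r t :: real
  assumes a: "0 \<le> a" and b: "0 \<le> b" and t: "0 < t" "t < 1" and q: "q = 1 / (1 - t)" and r: "r = 1 / t"
  shows "a * b \<le> a powr q + b powr r"
proof -
  define X Y where "X = a powr q" and "Y = b powr r"
  have XY: "0 \<le> X" "0 \<le> Y" by (auto simp: X_def Y_def)
  have aX: "a = X powr (1 - t)" using a t by (simp add: X_def q powr_powr)
  have bY: "b = Y powr t" using b t by (simp add: Y_def r powr_powr)
  have "a * b \<le> (X + Y) powr (1 - t) * (X + Y) powr t"
    unfolding aX bY using XY t by (intro mult_mono powr_mono2) auto
  also have "\<dots> = X + Y" using XY by (simp flip: powr_add)
  finally show ?thesis by (simp add: X_def Y_def)
qed

text \<open>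
  Young's inequality with \<open>1/p = 1/r + 1/q - 1\<close>. Integrating \<open>young_pointwise\<close> bounds the convolution at
  \<open>x\<close> by \<open>c (l + l\<^bsup>1-p\<^esup> h(x))\<close> for every \<open>l\<close>, where \<open>h = K\<^sup>q * b\<^sup>r\<close> is integrable; optimising \<open>l\<close> separately
  for each \<open>x\<close> yields \<open>(K * b)\<^sup>p \<le> C h\<close>.
\<close>

lemma young_conv:
  fixes K b :: "real ^ 'n::finite \<Rightarrow> real"
  assumes [measurable]: "K \<in> borel_measurable borel" "b \<in> borel_measurable borel"
    and K: "\<And>x. 0 \<le> K x" "integrable lborel (\<lambda>x. K x powr q)"
    and b: "\<And>x. 0 \<le> b x" "integrable lborel (\<lambda>x. b x powr r)"
    and t: "0 \<le> t" "t < 1" and r: "1 \<le> r" and q: "q = 1 / (1 - t)" and tr: "t < 1 / r" and p: "p = 1 / (1 / r - t)"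
  shows "AE x in lborel. integrable lborel (\<lambda>y. K y * b (x - y))"
    and "integrable lborel (\<lambda>x. conv K b x powr p)"
proof -
  define Kq br where "Kq x = K x powr q" and "br x = b x powr r" for x
  have Kq: "integrable lborel Kq" and br: "integrable lborel br" using K(2) b(2) by (simp_all add: Kq_def[abs_def] br_def[abs_def])
  have nn: "0 \<le> Kq x" "0 \<le> br x" for x by (auto simp: Kq_def br_def)
  have ae: "AE x in lborel. integrable lborel (\<lambda>y. Kq y * br (x - y))" by (rule AE_integrable_conv[OF Kq br])
  have ibr: "integrable lborel (\<lambda>y. br (x - y))" for x
    using integrable_reflect[of br x] br borel_measurable_integrable by auto
  have eqbr: "(LINT y|lborel. br (x - y)) = (LINT y|lborel. br y)" for x
    using integral_reflect[of br x] br borel_measurable_integrable by auto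
  define c where "c = max 1 ((LINT x|lborel. Kq x) + (LINT x|lborel. br x))"
  have c: "1 \<le> c" "(LINT x|lborel. Kq x) + (LINT x|lborel. br x) \<le> c" by (auto simp: c_def)
  have "1 / r \<le> 1" using r by simp
  then have p1: "1 \<le> p" unfolding p using tr t by (subst le_divide_eq_1_pos) auto
  have point: "K y * b (x - y) \<le> l * (Kq y + br (x - y)) + l powr (1 - p) * (Kq y * br (x - y))" if "0 < l" for l x y
    unfolding Kq_def br_def by (rule young_pointwise[OF K(1) b(1) t r q tr p that])
  have int: "integrable lborel (\<lambda>y. l * (Kq y + br (x - y)) + l powr (1 - p) * (Kq y * br (x - y)))"
    if "integrable lborel (\<lambda>y. Kq y * br (x - y))" for x l
    using that Kq ibr by (intro Bochner_Integration.integrable_add integrable_mult_right) auto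
  have int2: "integrable lborel (\<lambda>y. K y * b (x - y))"
    if i: "integrable lborel (\<lambda>y. Kq y * br (x - y))" for x
  proof (rule Bochner_Integration.integrable_bound[OF int[OF i, of 1]])
    show "AE y in lborel. norm (K y * b (x - y)) \<le> norm (1 * (Kq y + br (x - y)) + 1 powr (1 - p) * (Kq y * br (x - y)))"
      using point[of 1 _ x] K b nn by (intro AE_I2) auto
  qed measurable
  show "AE x in lborel. integrable lborel (\<lambda>y. K y * b (x - y))"
    using ae by eventually_elim (rule int2)
  have le: "conv K b x powr p \<le> (2 * c) powr p * conv Kq br x"
    if i: "integrable lborel (\<lambda>y. Kq y * br (x - y))" for x
  proof (rule optimise_scale[OF _ _ _ p1])
    show "0 \<le> conv K b x" "0 \<le> conv Kq br x" "0 \<le> c"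
      using c K b nn by (auto simp: conv_def)
    fix l :: real assume l: "0 < l"
    have "conv K b x \<le> (LINT y|lborel. l * (Kq y + br (x - y)) + l powr (1 - p) * (Kq y * br (x - y)))"
      unfolding conv_def by (rule integral_mono[OF int2[OF i] int[OF i] point[OF l]])
    also have "\<dots> = l * ((LINT y|lborel. Kq y) + (LINT y|lborel. br y)) + l powr (1 - p) * conv Kq br x"
      using i Kq ibr eqbr[of x] by (simp add: conv_def)
    also have "\<dots> \<le> l * c + l powr (1 - p) * (c * conv Kq br x)"
    proof (intro add_mono mult_left_mono c)
      have "0 \<le> conv Kq br x" using nn by (auto simp: conv_def)
      then show "conv Kq br x \<le> c * conv Kq br x" using mult_right_mono[OF c(1)] by fastforce
    qed (use l in auto)
    finally show "conv K b x \<le> c * (l + l powr (1 - p) * conv Kq br x)" by (simp add: algebra_simps)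
  qed
  have i3: "integrable lborel (\<lambda>x. (2 * c) powr p * conv Kq br x)" using integrable_conv[OF Kq br] by simp
  show "integrable lborel (\<lambda>x. conv K b x powr p)"
  proof (rule Bochner_Integration.integrable_bound[OF i3])
    show "AE x in lborel. norm (conv K b x powr p) \<le> norm ((2 * c) powr p * conv Kq br x)"
      using ae by eventually_elim (use le in \<open>auto intro: order_trans[OF _ abs_ge_self]\<close>)
  qed measurable
qed

lemma young_conv_bounded:
  fixes K b :: "real ^ 'n::finite \<Rightarrow> real"
  assumes [measurable]: "K \<in> borel_measurable borel" "b \<in> borel_measurable borel"
    and K: "\<And>x. 0 \<le> K x" "integrable lborel (\<lambda>x. K x powr q)"
    and b: "\<And>x. 0 \<le> b x" "integrable lborel (\<lambda>x. b x powr r)"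
    and t: "0 < t" "t < 1" and q: "q = 1 / (1 - t)" and r: "r = 1 / t"
  shows "integrable lborel (\<lambda>y. K y * b (x - y))"
    and "conv K b x \<le> (LINT y|lborel. K y powr q) + (LINT y|lborel. b y powr r)"
proof -
  have ib: "integrable lborel (\<lambda>y. b (x - y) powr r)"
    using integrable_reflect[of "\<lambda>y. b y powr r" x] b by simp
  have eb: "(LINT y|lborel. b (x - y) powr r) = (LINT y|lborel. b y powr r)"
    by (rule integral_reflect[of "\<lambda>y. b y powr r"]) simp
  have point: "K y * b (x - y) \<le> K y powr q + b (x - y) powr r" for y
    by (rule young_pointwise_conjugate[OF K(1) b(1) t q r])
  have i: "integrable lborel (\<lambda>y. K y powr q + b (x - y) powr r)" using K ib by simp
  show int: "integrable lborel (\<lambda>y. K y * b (x - y))"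
    by (rule Bochner_Integration.integrable_bound[OF i], measurable)
      (use point K b in \<open>auto intro!: order_trans[OF _ abs_ge_self]\<close>)
  have "conv K b x \<le> (LINT y|lborel. K y powr q + b (x - y) powr r)"
    unfolding conv_def by (rule integral_mono[OF int i point])
  also have "\<dots> = (LINT y|lborel. K y powr q) + (LINT y|lborel. b y powr r)" using K ib eb by simp
  finally show "conv K b x \<le> (LINT y|lborel. K y powr q) + (LINT y|lborel. b y powr r)" .
qed

lemma conv_split_bound:
  fixes K f b :: "real ^ 'n::finite \<Rightarrow> real"
  assumes [measurable]: "f \<in> borel_measurable borel"
    and K: "integrable lborel K" and f: "\<And>x. \<bar>f x\<bar> \<le> C + b x"
    and i: "integrable lborel (\<lambda>y. \<bar>K y\<bar> * b (x - y))"
  shows "\<bar>conv K f x\<bar> \<le> C * (LINT y|lborel. \<bar>K y\<bar>) + conv (\<lambda>y. \<bar>K y\<bar>) b x"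
proof -
  have i2: "integrable lborel (\<lambda>y. C * \<bar>K y\<bar> + \<bar>K y\<bar> * b (x - y))" using K i by simp
  have "\<bar>conv K f x\<bar> \<le> (LINT y|lborel. \<bar>K y * f (x - y)\<bar>)" unfolding conv_def by (rule integral_abs_bound)
  also have "\<dots> \<le> (LINT y|lborel. C * \<bar>K y\<bar> + \<bar>K y\<bar> * b (x - y))"
  proof (rule integral_mono'[OF i2])
    fix y
    have "\<bar>K y\<bar> * \<bar>f (x - y)\<bar> \<le> \<bar>K y\<bar> * (C + b (x - y))" by (intro mult_left_mono f) auto
    then show le: "\<bar>K y * f (x - y)\<bar> \<le> C * \<bar>K y\<bar> + \<bar>K y\<bar> * b (x - y)" by (simp add: abs_mult algebra_simps)
    show "0 \<le> C * \<bar>K y\<bar> + \<bar>K y\<bar> * b (x - y)" using le abs_ge_zero[of "K y * f (x - y)"] by linarith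
  qed
  also have "\<dots> = C * (LINT y|lborel. \<bar>K y\<bar>) + conv (\<lambda>y. \<bar>K y\<bar>) b x" using K i by (simp add: conv_def)
  finally show ?thesis .
qed

lemma LpLinf_conv:
  fixes K f :: "real ^ 'n::finite \<Rightarrow> real" and t :: real
  assumes K: "integrable lborel K" "integrable lborel (\<lambda>x. \<bar>K x\<bar> powr (1 / (1 - t)))"
    and f: "LpLinf (1 / \<rho>) f" and t: "0 \<le> t" "t < 1" and \<rho>: "t < \<rho>" "\<rho> \<le> 1"
  shows "LpLinf (1 / (\<rho> - t)) (conv K f)"
proof -
  obtain C b where b: "0 \<le> C" "\<And>x. 0 \<le> b x" "b \<in> borel_measurable borel" "\<And>x. \<bar>f x\<bar> \<le> C + b x"
    "integrable lborel (\<lambda>x. b x powr (1 / \<rho>))" using LpLinfE[OF f] by metis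
  have [measurable]: "K \<in> borel_measurable borel" "f \<in> borel_measurable borel" "b \<in> borel_measurable borel"
    using K f b borel_measurable_integrable by (auto simp: LpLinf_def)
  have "1 \<le> 1 / \<rho>" "t < 1 / (1 / \<rho>)" "1 / (\<rho> - t) = 1 / (1 / (1 / \<rho>) - t)" using t \<rho> by auto
  note y = young_conv[OF _ b(3) _ K(2) b(2) b(5) t this(1) refl this(2,3)]
  show ?thesis
  proof (rule LpLinfI[of _ "conv (\<lambda>y. \<bar>K y\<bar>) b" "C * (LINT y|lborel. \<bar>K y\<bar>)"])
    show "AE x in lborel. \<bar>conv K f x\<bar> \<le> C * (LINT y|lborel. \<bar>K y\<bar>) + conv (\<lambda>y. \<bar>K y\<bar>) b x"
    proof -
      have "AE x in lborel. integrable lborel (\<lambda>y. \<bar>K y\<bar> * b (x - y))" by (rule y(1)) auto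
      then show ?thesis
        by eventually_elim (intro conv_split_bound K b(4), measurable)
    qed
    show "integrable lborel (\<lambda>x. conv (\<lambda>y. \<bar>K y\<bar>) b x powr (1 / (\<rho> - t)))" by (rule y(2)) auto
    show "0 \<le> conv (\<lambda>y. \<bar>K y\<bar>) b x" for x using b by (auto simp: conv_def)
  qed (use b \<rho> in auto)
qed

lemma conv_bounded_of_LpLinf:
  fixes K f :: "real ^ 'n::finite \<Rightarrow> real" and t :: real
  assumes K: "integrable lborel K" "integrable lborel (\<lambda>x. \<bar>K x\<bar> powr (1 / (1 - t)))"
    and f: "LpLinf (1 / t) f" and t: "0 < t" "t < 1"
  shows "\<exists>C. \<forall>x. \<bar>conv K f x\<bar> \<le> C"
proof -
  obtain C b where b: "0 \<le> C" "\<And>x. 0 \<le> b x" "b \<in> borel_measurable borel" "\<And>x. \<bar>f x\<bar> \<le> C + b x"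
    "integrable lborel (\<lambda>x. b x powr (1 / t))" using LpLinfE[OF f] by metis
  have [measurable]: "K \<in> borel_measurable borel" "f \<in> borel_measurable borel" "b \<in> borel_measurable borel"
    using K f b borel_measurable_integrable by (auto simp: LpLinf_def)
  note y = young_conv_bounded[OF _ b(3) _ K(2) b(2) b(5) t refl refl]
  have "\<bar>conv K f x\<bar> \<le> C * (LINT y|lborel. \<bar>K y\<bar>) + ((LINT y|lborel. \<bar>K y\<bar> powr (1 / (1 - t))) + (LINT y|lborel. b y powr (1 / t)))" for x
  proof -
    have "\<bar>conv K f x\<bar> \<le> C * (LINT y|lborel. \<bar>K y\<bar>) + conv (\<lambda>y. \<bar>K y\<bar>) b x"
      by (rule conv_split_bound[OF _ K(1) b(4) y(1)]) auto
    moreover have "conv (\<lambda>y. \<bar>K y\<bar>) b x \<le> (LINT y|lborel. \<bar>K y\<bar> powr (1 / (1 - t))) + (LINT y|lborel. b y powr (1 / t))"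
      by (rule y(2)) auto
    ultimately show ?thesis by simp
  qed
  then show ?thesis by blast
qed

section \<open>Integrability of the Bessel kernel\<close>

text \<open>
  Jensen's inequality for the superposition. The weight is factored as \<open>\<mu> \<alpha>\<close> with
  \<open>\<mu>(s) = s\<^bsup>-\<beta>\<^esup> e\<^bsup>-s\<^sup>2\<^esup>\<close>, and the \<open>q\<close>-th power of \<open>bessel\<close> is dominated by a superposition of dilates of
  \<open>gauss\<^sup>q\<close> with weight \<open>s\<^sup>e e\<^bsup>-s\<^sup>2\<^esup>\<close>. For \<open>\<beta>\<close> close to \<open>1\<close> the exponent satisfies \<open>e > -1\<close>, because
  \<open>t N < 2\<close>.
\<close>

lemma bessel_Lq:
  fixes t :: real
  assumes t: "0 \<le> t" "t < 1" "t * CARD('n) < 2"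
  shows "integrable lborel (\<lambda>x. \<bar>bessel (x :: real ^ 'n::finite)\<bar> powr (1 / (1 - t)))"
proof -
  define q where "q = 1 / (1 - t)"
  have q: "1 \<le> q" using t by (simp add: q_def)
  define N where "N = real CARD('n)"
  have N: "1 \<le> N" by (simp add: N_def)
  have tN: "t * N < 2" using t by (simp add: N_def)
  obtain \<beta> where \<beta>: "0 < \<beta>" "\<beta> < 1" "t * (N + 1 - \<beta>) < 2"
  proof
    \<comment> \<open>The choice \<open>\<beta> = 1 - d\<close>; the room in \<open>t N < 2\<close> absorbs \<open>t d \<le>
      d\<close>.\<close>
    define d where "d = min (1/2) ((2 - t * N) / 4)"
    have d: "0 < d" "d \<le> 1/2" using tN by (auto simp: d_def)
    have d2: "d \<le> (2 - t * N) / 4" unfolding d_def by (rule min.cobounded2)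
    show "0 < 1 - d" "1 - d < 1" using d by auto
    define a where "a = t * d"
    have "a \<le> 1 * d" unfolding a_def using t d by (intro mult_right_mono) auto
    moreover have "t * (N + 1 - (1 - d)) = t * N + a" by (simp add: a_def algebra_simps)
    ultimately show "t * (N + 1 - (1 - d)) < 2" using d d2 tN by simp
  qed
  define e where "e = (q - 1) * (\<beta> + 1 - N) + 1"
  have e: "-1 < e"
  proof -
    have qt: "(q - 1) = t / (1 - t)" using t by (simp add: q_def field_simps)
    have "t * (N - 1 - \<beta>) < 2 * (1 - t)" using \<beta>(3) by (simp add: algebra_simps)
    then have "(q - 1) * (N - 1 - \<beta>) < 2" unfolding qt using t by (simp add: field_simps)
    then show ?thesis by (simp add: e_def algebra_simps)
  qed
  define \<mu> where "\<mu> s = (if s > 0 then s powr (- \<beta>) * exp (- s\<^sup>2) else 0)" for s :: real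
  define w2 where "w2 s = 2 powr q * (if s > 0 then s powr e * exp (- s\<^sup>2) else 0)" for s :: real
  have \<mu>: "integrable lborel \<mu>" unfolding \<mu>_def by (rule integrable_powr_exp) (use \<beta> in auto)
  have w2: "integrable lborel w2" unfolding w2_def by (intro integrable_mult_right integrable_powr_exp e)
  define g2 :: "real ^ 'n \<Rightarrow> real" where "g2 z = gauss z powr q" for z
  have g2: "integrable lborel g2"
  proof -
    let ?c = "LINT z|lborel. exp (- (1/4) * (norm (z::real^'n))\<^sup>2)"
    have "g2 = (\<lambda>z. exp (- (q/4) * (norm z)\<^sup>2) / ?c powr q)"
      unfolding g2_def gauss_def using gauss_norm_pos[where 'n='n]
      by (auto simp: powr_divide exp_powr_real mult_ac)
    moreover have "integrable lborel (\<lambda>z::real^'n. exp (- (q/4) * (norm z)\<^sup>2) / ?c powr q)"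
      using q by (intro integrable_divide integrable_gaussian) auto
    ultimately show ?thesis by simp
  qed
  define J where "J = mix w2 g2"
  have J: "integrable lborel J" unfolding J_def by (rule integrable_mix[OF w2 _ g2]) (simp add: w2_def)
  have aeJ: "AE y in lborel. integrable lborel (\<lambda>s. w2 s / s ^ CARD('n) * g2 ((1 / s) *\<^sub>R y))"
    by (rule AE_integrable_mix[OF w2 _ g2]) (simp add: w2_def)
  define c where "c = max 1 (LINT s|lborel. \<mu> s)"
  have c: "1 \<le> c" "(LINT s|lborel. \<mu> s) \<le> c" by (auto simp: c_def)
  have J0: "0 \<le> J y" for y
    unfolding J_def mix_def by (intro integral_nonneg_AE AE_I2) (auto simp: w2_def g2_def)
  have point: "bessel_weight s / s ^ CARD('n) * gauss ((1 / s) *\<^sub>R y)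
      \<le> l * \<mu> s + l powr (1 - q) * (w2 s / s ^ CARD('n) * g2 ((1 / s) *\<^sub>R y))" if l: "0 < l" for l s and y :: "real ^ 'n"
  proof (cases "0 < s")
    case True
    define G where "G = gauss ((1 / s) *\<^sub>R y)"
    have G: "0 \<le> G" by (simp add: G_def gauss_nonneg)
    \<comment> \<open>The factor \<open>\<alpha>(s) = 2 s\<^bsup>1+\<beta>\<^esup>\<close> of the weight times the dilated
      Gaussian.\<close>
    define A where "A = 2 * s powr (1 + \<beta>) * (G * s powr (- N))"
    have A: "0 \<le> A" using G by (simp add: A_def)
    have sN: "s ^ CARD('n) = s powr N" using True by (simp add: N_def powr_realpow)
    have 1: "bessel_weight s / s ^ CARD('n) * G = \<mu> s * A"
    proof -
      have "\<mu> s * A = (s powr (- \<beta>) * s powr (1 + \<beta>)) * 2 * exp (- s\<^sup>2) * (G * s powr (- N))"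
        using True by (simp add: \<mu>_def A_def mult_ac)
      also have "s powr (- \<beta>) * s powr (1 + \<beta>) = s" using True by (simp flip: powr_add)
      finally show ?thesis using True unfolding sN by (simp add: bessel_weight_def powr_minus divide_inverse mult_ac)
    qed
    have 2: "\<mu> s * A powr q = w2 s / s ^ CARD('n) * g2 ((1 / s) *\<^sub>R y)"
    proof -
      have "A powr q = 2 powr q * s powr ((1 + \<beta>) * q) * (G powr q * s powr (- N * q))"
        by (simp add: A_def powr_mult powr_powr)
      then have "\<mu> s * A powr q = 2 powr q * exp (- s\<^sup>2) * G powr q * (s powr (- \<beta>) * s powr ((1 + \<beta>) * q) * s powr (- N * q))"
        using True by (simp add: \<mu>_def mult_ac)
      also have "s powr (- \<beta>) * s powr ((1 + \<beta>) * q) * s powr (- N * q) = s powr (e - N)"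
        unfolding powr_add[symmetric] by (rule arg_cong[of _ _ "(powr) s"]) (simp add: e_def algebra_simps)
      also have "s powr (e - N) = s powr e / s powr N" by (rule powr_diff)
      finally show ?thesis using True unfolding sN by (simp add: w2_def g2_def G_def)
    qed
    have "\<mu> s * A \<le> \<mu> s * (l + l powr (1 - q) * A powr q)"
      using True by (intro mult_left_mono scale_split A l q) (simp add: \<mu>_def)
    also have "\<dots> = l * \<mu> s + l powr (1 - q) * (\<mu> s * A powr q)" by (simp add: algebra_simps)
    finally show ?thesis unfolding 1[symmetric] 2 G_def .
  qed (simp add: bessel_weight_def \<mu>_def w2_def)
  have le: "\<bar>bessel y\<bar> powr q \<le> (2 * c) powr q * J y"
    if i: "integrable lborel (\<lambda>s. w2 s / s ^ CARD('n) * g2 ((1 / s) *\<^sub>R y))" for y :: "real ^ 'n"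
  proof (rule optimise_scale[OF _ J0 _ q])
    fix l :: real assume l: "0 < l"
    have i2: "integrable lborel (\<lambda>s. l * \<mu> s + l powr (1 - q) * (w2 s / s ^ CARD('n) * g2 ((1 / s) *\<^sub>R y)))"
      by (intro Bochner_Integration.integrable_add integrable_mult_right \<mu> i)
    have "bessel y \<le> (LINT s|lborel. l * \<mu> s + l powr (1 - q) * (w2 s / s ^ CARD('n) * g2 ((1 / s) *\<^sub>R y)))"
      unfolding bessel_def mix_def
    proof (rule integral_mono'[OF i2 point[OF l]])
      fix s :: real
      have "0 \<le> bessel_weight s / s ^ CARD('n) * gauss ((1 / s) *\<^sub>R y)" by (auto simp: bessel_weight_def gauss_nonneg)
      then show "0 \<le> l * \<mu> s + l powr (1 - q) * (w2 s / s ^ CARD('n) * g2 ((1 / s) *\<^sub>R y))" 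
        using point[OF l, of s y] by linarith
    qed
    also have "\<dots> = l * (LINT s|lborel. \<mu> s) + l powr (1 - q) * J y"
      unfolding J_def mix_def
      by (subst Bochner_Integration.integral_add)
        (intro integrable_mult_right \<mu> i, intro integrable_mult_right \<mu> i, simp only: integral_mult_right_zero)
    also have "\<dots> \<le> l * c + l powr (1 - q) * (c * J y)"
      using l c J0[of y] mult_right_mono[OF c(1) J0[of y]] by (intro add_mono mult_left_mono) auto
    finally show "\<bar>bessel y\<bar> \<le> c * (l + l powr (1 - q) * J y)" using bessel_nonneg[of y] by (simp add: algebra_simps)
  qed (use c in auto)
  have i3: "integrable lborel (\<lambda>y. (2 * c) powr q * J y)" using J by simp
  have "integrable lborel (\<lambda>x. \<bar>bessel (x :: real ^ 'n)\<bar> powr q)"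
  proof (rule Bochner_Integration.integrable_bound[OF i3])
    show "AE x in lborel. norm (\<bar>bessel (x :: real ^ 'n)\<bar> powr q) \<le> norm ((2 * c) powr q * J x)"
      using aeJ by eventually_elim (use le in \<open>auto intro: order_trans[OF _ abs_ge_self]\<close>)
  qed measurable
  then show ?thesis by (simp add: q_def)
qed

section \<open>From integrability to boundedness\<close>

text \<open>
  The power \<open>\<sigma> + 1\<close> multiplies the reciprocal exponent \<open>\<rho> - t\<close> of \<open>u\<close> by \<open>\<sigma> + 1\<close>. Since \<open>\<rho> \<le> 1/2\<close>, the bound on
  \<open>k\<close> keeps the result at most \<open>\<rho> - k + t\<close>, so that one more convolution with \<open>B\<close> improves \<open>\<rho>\<close> by \<open>k\<close>.
\<close>

lemma nonlinearity_LpLinf: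
  fixes u w F :: "real ^ 'n::finite \<Rightarrow> real" and t :: real
  assumes [measurable]: "F \<in> borel_measurable borel"
    and F: "AE x in lborel. \<bar>F x\<bar> \<le> 2 * \<bar>w x\<bar> + A * \<bar>u x\<bar> + A * \<bar>u x\<bar> powr (\<sigma> + 1)" and A: "0 \<le> A"
    and w: "LpLinf (1 / \<rho>) w" and u: "LpLinf (1 / (\<rho> - t)) u"
    and \<sigma>: "0 < \<sigma>" and t: "0 < t" and \<rho>: "t < \<rho>" "\<rho> \<le> 1/2"
    and k: "k \<le> t" "k \<le> (\<sigma> + 2) * t - \<sigma> / 2"
  shows "LpLinf (1 / (\<rho> - k + t)) F"
proof -
  let ?m = "1 / (\<rho> - k + t)"
  have m: "0 \<le> ?m" using t \<rho> k by auto
  have [measurable]: "u \<in> borel_measurable borel" "w \<in> borel_measurable borel" using u w by (auto simp: LpLinf_def)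
  have "LpLinf (1 / (\<rho> - t) / (\<sigma> + 1)) (\<lambda>x. \<bar>u x\<bar> powr (\<sigma> + 1))" using \<sigma> \<rho> by (intro LpLinf_powr u) auto
  then have "LpLinf ?m (\<lambda>x. \<bar>u x\<bar> powr (\<sigma> + 1))"
  proof (rule LpLinf_antimono[OF _ m])
    have "\<sigma> * \<rho> \<le> \<sigma> * (1/2)" using \<sigma> \<rho> by (intro mult_left_mono) auto
    then have "(\<rho> - t) * (\<sigma> + 1) \<le> \<rho> - k + t" using k by (simp add: algebra_simps)
    then show "?m \<le> 1 / (\<rho> - t) / (\<sigma> + 1)"
      using \<rho> \<sigma> by (simp add: divide_left_mono frac_le)
  qed
  then have 1: "LpLinf ?m (\<lambda>x. A * \<bar>u x\<bar> powr (\<sigma> + 1))" by (rule LpLinf_cmult[OF _ m])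
  have "LpLinf ?m u" by (rule LpLinf_antimono[OF u m]) (use t \<rho> k in \<open>auto intro!: divide_left_mono\<close>)
  then have "LpLinf ?m (\<lambda>x. \<bar>u x\<bar>)" by (rule LpLinf_mono_AE) (use m in auto)
  then have 2: "LpLinf ?m (\<lambda>x. A * \<bar>u x\<bar>)" by (rule LpLinf_cmult[OF _ m])
  have "LpLinf ?m w" by (rule LpLinf_antimono[OF w m]) (use t \<rho> k in \<open>auto intro!: divide_left_mono\<close>)
  then have "LpLinf ?m (\<lambda>x. \<bar>w x\<bar>)" by (rule LpLinf_mono_AE) (use m in auto)
  then have 3: "LpLinf ?m (\<lambda>x. 2 * \<bar>w x\<bar>)" by (rule LpLinf_cmult[OF _ m])
  show ?thesis
  proof (rule LpLinf_mono_AE[OF LpLinf_add[OF LpLinf_add[OF 3 2 m] 1 m]])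
    show "AE x in lborel. \<bar>F x\<bar> \<le> \<bar>2 * \<bar>w x\<bar> + A * \<bar>u x\<bar> + A * \<bar>u x\<bar> powr (\<sigma> + 1)\<bar>"
      using F by eventually_elim (rule order_trans[OF _ abs_ge_self])
  qed (use m in auto)
qed

text \<open>
  Each round through the system lowers the reciprocal exponent of \<open>w\<close> by the fixed amount \<open>k > 0\<close>, from
  \<open>1/2\<close> down to \<open>t\<close>. At the exponent \<open>1/t\<close>, conjugate to that of the kernel, a convolution is bounded:
  first \<open>u = B * w\<close>, and then, as \<open>F\<close> is controlled by \<open>w\<close> alone, also \<open>w = B * F\<close>.
\<close>

lemma bessel_system_essentially_bounded:
  fixes u w F :: "real ^ 'n::finite \<Rightarrow> real" and t :: real
  assumes [measurable]: "F \<in> borel_measurable borel" "u \<in> borel_measurable borel" "w \<in> borel_measurable borel"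
    and F: "AE x in lborel. \<bar>F x\<bar> \<le> 2 * \<bar>w x\<bar> + A * \<bar>u x\<bar> + A * \<bar>u x\<bar> powr (\<sigma> + 1)" and A: "0 \<le> A"
    and uw: "AE x in lborel. u x = conv bessel w x" and wF: "AE x in lborel. w x = conv bessel F x"
    and w: "LpLinf 2 w"
    and \<sigma>: "0 < \<sigma>" and t: "0 < t" "t < 1/2" "t * CARD('n) < 2" "\<sigma> / 2 < (\<sigma> + 2) * t"
  obtains C where "AE x in lborel. \<bar>u x\<bar> \<le> C" "AE x in lborel. \<bar>w x\<bar> \<le> C"
proof -
  \<comment> \<open>The linear terms of the system gain \<open>t\<close>, the power gains the other quantity.\<close>
  define k where "k = min t ((\<sigma> + 2) * t - \<sigma> / 2)"
  have k: "0 < k" "k \<le> t" "k \<le> (\<sigma> + 2) * t - \<sigma> / 2" using t by (auto simp: k_def)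
  have Lq: "integrable lborel (\<lambda>x. \<bar>bessel (x :: real ^ 'n)\<bar> powr (1 / (1 - t)))"
    by (rule bessel_Lq) (use t in auto)
  note conv_class = LpLinf_conv[OF integrable_bessel Lq _ less_imp_le[OF t(1)]]
  have step: "LpLinf (1 / (\<rho> - k)) w" if w: "LpLinf (1 / \<rho>) w" and \<rho>: "t < \<rho>" "\<rho> \<le> 1/2" for \<rho>
  proof -
    have "LpLinf (1 / (\<rho> - t)) (conv bessel w)" by (rule conv_class[OF w]) (use t \<rho> in auto)
    then have u: "LpLinf (1 / (\<rho> - t)) u"
      by (rule LpLinf_mono_AE) (use uw \<rho> in auto)
    have "LpLinf (1 / (\<rho> - k + t)) F"
      by (rule nonlinearity_LpLinf[OF _ F A w u \<sigma> t(1) \<rho> k(2,3)]) measurable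
    then have "LpLinf (1 / ((\<rho> - k + t) - t)) (conv bessel F)"
      by (rule conv_class) (use t \<rho> k in auto)
    then have "LpLinf (1 / (\<rho> - k)) (conv bessel F)" by simp
    then show ?thesis
      by (rule LpLinf_mono_AE) (use wF \<rho> k in auto)
  qed
  \<comment> \<open>The reciprocal exponent is stopped at \<open>t\<close>, the value at which a single convolution with the
    kernel becomes bounded.\<close>
  have iter: "LpLinf (1 / max t (1/2 - real n * k)) w" for n
  proof (induction n)
    case 0
    then show ?case using w t by (simp add: max_def)
  next
    case (Suc n)
    show ?case
    proof (cases "1/2 - real n * k \<le> t")
      case True
      then have "1/2 - real (Suc n) * k \<le> t" using k(1) by (simp add: algebra_simps)
      then show ?thesis using Suc True by (simp add: max_def split: if_splits)
    next
      case False
      have "LpLinf (1 / ((1/2 - real n * k) - k)) w"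
        by (rule step) (use Suc False k(1) in \<open>auto simp: max_def\<close>)
      then show ?thesis
        by (rule LpLinf_antimono)
          (use False t k in \<open>auto simp: algebra_simps intro!: divide_left_mono mult_pos_pos\<close>)
    qed
  qed
  obtain n :: nat where "1/2 < real n * k" using reals_Archimedean3[OF k(1)] by blast
  then have wt: "LpLinf (1 / t) w" using iter[of n] t by (simp add: max_def split: if_splits)
  obtain C where C: "\<And>x. \<bar>conv bessel w x\<bar> \<le> C"
    using conv_bounded_of_LpLinf[OF integrable_bessel Lq wt] t by auto
  have uC: "AE x in lborel. \<bar>u x\<bar> \<le> C" using uw by eventually_elim (use C in auto)
  have C0: "0 \<le> C" using C[of 0] by simp
  have "LpLinf (1 / t) (\<lambda>x. 2 * \<bar>w x\<bar> + (A * C + A * C powr (\<sigma> + 1)))"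
  proof (rule LpLinf_add)
    have "LpLinf (1 / t) (\<lambda>x. \<bar>w x\<bar>)" by (rule LpLinf_mono_AE[OF wt]) (use t in auto)
    then show "LpLinf (1 / t) (\<lambda>x. 2 * \<bar>w x\<bar>)" by (rule LpLinf_cmult) (use t in auto)
    show "LpLinf (1 / t) (\<lambda>x::real^'n. A * C + A * C powr (\<sigma> + 1))"
      by (rule LpLinf_bounded[of _ "\<bar>A * C + A * C powr (\<sigma> + 1)\<bar>"]) (use t in auto)
  qed (use t in auto)
  then have "LpLinf (1 / t) F"
  proof (rule LpLinf_mono_AE)
    show "AE x in lborel. \<bar>F x\<bar> \<le> \<bar>2 * \<bar>w x\<bar> + (A * C + A * C powr (\<sigma> + 1))\<bar>"
      using F uC
    proof eventually_elim
      case (elim x)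
      have "A * \<bar>u x\<bar> \<le> A * C" "A * \<bar>u x\<bar> powr (\<sigma> + 1) \<le> A * C powr (\<sigma> + 1)"
        using elim A \<sigma> by (auto intro!: mult_left_mono powr_mono2)
      then show ?case using elim(1) by linarith
    qed
  qed (use t in auto)
  then obtain D where D: "\<And>x. \<bar>conv bessel F x\<bar> \<le> D"
    using conv_bounded_of_LpLinf[OF integrable_bessel Lq] t by auto
  have wD: "AE x in lborel. \<bar>w x\<bar> \<le> D" using wF by eventually_elim (use D in auto)
  show ?thesis
  proof (rule that[of "max C D"])
    show "AE x in lborel. \<bar>u x\<bar> \<le> max C D" using uC by eventually_elim auto
    show "AE x in lborel. \<bar>w x\<bar> \<le> max C D" using wD by eventually_elim auto
  qed
qed

section \<open>Regularity of Bessel potentials\<close>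

lemma conv_cong_AE:
  fixes K f g :: "real ^ 'n::finite \<Rightarrow> real"
  assumes [measurable]: "K \<in> borel_measurable borel" "f \<in> borel_measurable borel" "g \<in> borel_measurable borel"
    and eq: "AE x in lborel. f x = g x"
  shows "conv K f x = conv K g x"
proof -
  have "conv f K x = conv g K x"
    unfolding conv_def by (rule integral_cong_AE) (use eq in \<open>auto elim: eventually_mono\<close>)
  then show ?thesis by (simp add: conv_commute[of K])
qed

lemma conv_left_commute:
  fixes K L f :: "real ^ 'n::finite \<Rightarrow> real"
  assumes K: "integrable lborel K" and L: "integrable lborel L"
    and [measurable]: "f \<in> borel_measurable borel" and f: "\<And>x. \<bar>f x\<bar> \<le> C"
  shows "conv K (conv L f) x = conv L (conv K f) x"
proof -
  have [measurable]: "K \<in> borel_measurable borel" "L \<in> borel_measurable borel"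
    using K L borel_measurable_integrable by auto
  define h where "h y z = K y * L z * f (x - y - z)" for y z
  have "integrable (lborel \<Otimes>\<^sub>M lborel) (\<lambda>p. (case p of (y, z) \<Rightarrow> K y * L z) * f (x - fst p - snd p))"
    by (rule integrable_times_bounded[OF integrable_tensor[OF K L]]) (use f in auto)
  moreover have "(\<lambda>p. (case p of (y, z) \<Rightarrow> K y * L z) * f (x - fst p - snd p)) = case_prod h"
    by (auto simp: h_def fun_eq_iff)
  ultimately have int: "integrable (lborel \<Otimes>\<^sub>M lborel) (case_prod h)" by simp
  have 1: "(LINT z|lborel. h y z) = K y * conv L f (x - y)" for y
    by (simp add: h_def conv_def mult.assoc)
  have 2: "(LINT y|lborel. h y z) = L z * conv K f (x - z)" for z
  proof -
    have "h y z = L z * (K y * f (x - z - y))" for y by (simp add: h_def mult_ac diff_diff_eq add.commute)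
    then show ?thesis by (simp add: conv_def)
  qed
  show ?thesis using lborel_pair.Fubini_integral[OF int] unfolding 1 2 by (simp add: conv_def)
qed

lemma conv_diff_left_bound:
  fixes K L f :: "real ^ 'n::finite \<Rightarrow> real"
  assumes K: "integrable lborel K" and L: "integrable lborel L"
    and f: "f \<in> borel_measurable borel" "\<And>x. \<bar>f x\<bar> \<le> M"
  shows "\<bar>conv K f x - conv L f x\<bar> \<le> (LINT y|lborel. \<bar>K y - L y\<bar>) * M"
proof -
  have "conv K f x - conv L f x = conv (\<lambda>y. K y - L y) f x"
    unfolding conv_def using integrable_conv_bounded[OF K f] integrable_conv_bounded[OF L f]
    by (simp add: left_diff_distrib)
  then show ?thesis using conv_bound[of "\<lambda>y. K y - L y" f M x] K L f by simp
qed

lemma L1_approximation: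
  fixes K :: "real ^ 'n::finite \<Rightarrow> real"
  assumes K: "integrable lborel K" and e: "0 < e"
  obtains \<phi> where "\<phi> \<in> test_functions" "(LINT x|lborel. \<bar>K x - \<phi> x\<bar>) < e"
proof -
  have "K \<in> borel_measurable borel" using K borel_measurable_integrable by auto
  then show ?thesis
    using test_functions_dense[of K 1 e] that K e by auto
qed

lemma test_functions_boundedE:
  assumes "\<phi> \<in> test_functions"
  obtains R C where "0 < R" "0 \<le> C" "\<And>x. norm x > R \<Longrightarrow> \<phi> x = 0" "\<And>x. \<bar>\<phi> x\<bar> \<le> C"
proof -
  obtain R where R: "\<And>x. norm x > R \<Longrightarrow> \<phi> x = 0" using assms by (auto simp: test_functions_iff)
  obtain C where C: "\<And>x. \<bar>\<phi> x\<bar> \<le> C" using nice_bounded[OF test_functions_nice[OF assms]] by blast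
  show ?thesis
  proof (rule that[of "max R 1" C])
    show "0 \<le> C" using C[of 0] by linarith
  qed (use R C in auto)
qed

lemma continuous_conv_test_function:
  fixes \<phi> f :: "real ^ 'n::finite \<Rightarrow> real"
  assumes \<phi>: "\<phi> \<in> test_functions" and [measurable]: "f \<in> borel_measurable borel" and f: "\<And>x. \<bar>f x\<bar> \<le> M"
  shows "continuous_on UNIV (conv \<phi> f)"
  unfolding continuous_on_eq_continuous_at[OF open_UNIV] continuous_at_sequentially o_def
proof (intro ballI allI impI)
  fix x and xs :: "nat \<Rightarrow> real ^ 'n" assume xs: "xs \<longlonglongrightarrow> x"
  obtain R C where R: "0 < R" "\<And>x. norm x > R \<Longrightarrow> \<phi> x = 0" and C: "0 \<le> C" "\<And>x. \<bar>\<phi> x\<bar> \<le> C"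
    using test_functions_boundedE[OF \<phi>] by metis
  have [measurable]: "\<phi> \<in> borel_measurable borel" by (intro nice_measurable test_functions_nice \<phi>)
  have M: "0 \<le> M" using f[of 0] by simp
  obtain S where S: "\<And>n. norm (xs n) \<le> S"
    using convergent_imp_Bseq[OF convergentI[OF xs]] by (auto simp: Bseq_def)
  have "(\<lambda>n. LINT y|lborel. f y * \<phi> (xs n - y)) \<longlonglongrightarrow> (LINT y|lborel. f y * \<phi> (x - y))"
  proof (rule integral_dominated_convergence[where w="\<lambda>y. indicator (cball 0 (R + S)) y * (M * C)"])
    have "integrable lborel (indicator (cball 0 (R + S)) :: real ^ 'n \<Rightarrow> real)"
      by (rule integrable_real_indicator) (use emeasure_lborel_cball_finite[of "0::real^'n" "R + S"] in auto)
    then show "integrable lborel (\<lambda>y::real^'n. indicator (cball 0 (R + S)) y * (M * C))" by simp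
    show "AE y in lborel. (\<lambda>n. f y * \<phi> (xs n - y)) \<longlonglongrightarrow> f y * \<phi> (x - y)"
    proof (intro AE_I2 tendsto_mult tendsto_const)
      fix y
      have "isCont \<phi> (x - y)"
        using smooth_continuous[OF test_functions_smooth[OF \<phi>]] by (simp add: continuous_on_eq_continuous_at)
      then show "(\<lambda>n. \<phi> (xs n - y)) \<longlonglongrightarrow> \<phi> (x - y)"
        by (rule isCont_tendsto_compose) (intro tendsto_intros xs)
    qed
    show "AE y in lborel. norm (f y * \<phi> (xs n - y)) \<le> indicator (cball 0 (R + S)) y * (M * C)" for n
    proof (intro AE_I2)
      fix y
      show "norm (f y * \<phi> (xs n - y)) \<le> indicator (cball 0 (R + S)) y * (M * C)"
      proof (cases "norm y \<le> R + S")
        case True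
        then show ?thesis using f C M by (auto simp: abs_mult intro!: mult_mono)
      next
        case False
        then have "norm (xs n - y) > R" using S[of n] norm_triangle_ineq2[of y "xs n"] by (simp add: norm_minus_commute)
        then show ?thesis using R(2) M C by simp
      qed
    qed
  qed measurable
  then show "(\<lambda>n. conv \<phi> f (xs n)) \<longlonglongrightarrow> conv \<phi> f x"
    by (simp add: conv_commute[of \<phi>]) (simp add: conv_def)
qed

text \<open>
  Approximating \<open>K\<close> by test functions in the mean approximates the convolution uniformly.
\<close>

lemma continuous_conv_bounded:
  fixes K f :: "real ^ 'n::finite \<Rightarrow> real"
  assumes K: "integrable lborel K" and f: "f \<in> borel_measurable borel" "\<And>x. \<bar>f x\<bar> \<le> M"
  shows "continuous_on UNIV (conv K f)"
proof -
  have M: "0 \<le> M" using f(2)[of 0] by simp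
  have "\<exists>\<phi>. \<phi> \<in> test_functions \<and> (LINT x|lborel. \<bar>K x - \<phi> x\<bar>) < 1 / real (Suc n)" for n
    using L1_approximation[OF K, of "1 / real (Suc n)"] by (metis divide_pos_pos of_nat_0_less_iff zero_less_Suc zero_less_one)
  then obtain \<phi> where \<phi>: "\<And>n. \<phi> n \<in> test_functions" "\<And>n. (LINT x|lborel. \<bar>K x - \<phi> n x\<bar>) < 1 / real (Suc n)"
    by metis
  show ?thesis
  proof (rule uniform_limit_theorem[where F=sequentially and f="\<lambda>n. conv (\<phi> n) f"])
    show "\<forall>\<^sub>F n in sequentially. continuous_on UNIV (conv (\<phi> n) f)"
      by (intro always_eventually allI continuous_conv_test_function[OF \<phi>(1) f])
    have lim: "(\<lambda>n. 1 / real (Suc n) * M) \<longlonglongrightarrow> 0"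
      by (intro tendsto_mult_left_zero LIMSEQ_Suc[OF lim_1_over_n])
    show "uniform_limit UNIV (\<lambda>n. conv (\<phi> n) f) (conv K f) sequentially"
    proof (rule uniform_limitI)
      fix e :: real assume "0 < e"
      then have "\<forall>\<^sub>F n in sequentially. 1 / real (Suc n) * M < e"
        by (rule order_tendstoD(2)[OF lim])
      then show "\<forall>\<^sub>F n in sequentially. \<forall>x\<in>UNIV. dist (conv (\<phi> n) f x) (conv K f x) < e"
      proof eventually_elim
        case (elim n)
        show ?case
        proof
          fix x
          have "\<bar>conv K f x - conv (\<phi> n) f x\<bar> \<le> (LINT y|lborel. \<bar>K y - \<phi> n y\<bar>) * M"
            by (intro conv_diff_left_bound K f nice_integrable test_functions_nice \<phi>)
          also have "\<dots> \<le> 1 / real (Suc n) * M" using \<phi>(2)[of n] M by (intro mult_right_mono) auto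
          also have "\<dots> < e" by (rule elim)
          finally show "dist (conv (\<phi> n) f x) (conv K f x) < e" by (simp add: dist_real_def abs_minus_commute)
        qed
      qed
    qed
  qed simp
qed

lemma conv_tendsto_pointwise:
  fixes K f :: "real ^ 'n::finite \<Rightarrow> real"
  assumes K: "integrable lborel K" and [measurable]: "f \<in> borel_measurable borel"
    and \<phi>: "\<And>n::nat. \<phi> n \<in> borel_measurable borel" "\<And>n x. \<bar>\<phi> n x\<bar> \<le> M"
    and lim: "AE x in lborel. (\<lambda>n. \<phi> n x) \<longlonglongrightarrow> f x"
  shows "(\<lambda>n. conv K (\<phi> n) x) \<longlonglongrightarrow> conv K f x"
proof -
  note [measurable] = \<phi>(1)
  have [measurable]: "K \<in> borel_measurable borel" using K borel_measurable_integrable by auto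
  have "(\<lambda>n. LINT y|lborel. \<phi> n y * K (x - y)) \<longlonglongrightarrow> (LINT y|lborel. f y * K (x - y))"
  proof (rule integral_dominated_convergence[where w="\<lambda>y. M * \<bar>K (x - y)\<bar>"])
    show "integrable lborel (\<lambda>y. M * \<bar>K (x - y)\<bar>)" using integrable_reflect[of K x] K by simp
    show "AE y in lborel. (\<lambda>n. \<phi> n y * K (x - y)) \<longlonglongrightarrow> f y * K (x - y)"
      using lim by eventually_elim (intro tendsto_intros)
    show "AE y in lborel. norm (\<phi> n y * K (x - y)) \<le> M * \<bar>K (x - y)\<bar>" for n
      using \<phi>(2) by (intro AE_I2) (auto simp: abs_mult intro!: mult_right_mono)
  qed measurable
  then show ?thesis
    by (simp add: conv_commute[of K]) (simp add: conv_def)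
qed

text \<open>
  For test functions this is the fundamental theorem of calculus combined with \<open>conv_bessel_partial\<close>. As
  only integrable kernels occur on both sides, the identity survives bounded almost everywhere
  convergence, and the singular kernel itself is never differentiated.
\<close>

lemma conv_bessel_ftc:
  fixes f :: "real ^ 'n::finite \<Rightarrow> real"
  assumes [measurable]: "f \<in> borel_measurable borel" and f: "\<And>x. \<bar>f x\<bar> \<le> M"
  shows "conv bessel f (x + h) - conv bessel f x
    = (LBINT s. (\<Sum>i\<in>UNIV. h $ i * conv (dbessel i) f (x + s *\<^sub>R h)) * indicator {0..1} s)"
proof -
  obtain \<phi> where \<phi>: "\<And>n::nat. \<phi> n \<in> test_functions" "\<And>n x. \<bar>\<phi> n x\<bar> \<le> M + 1"
    and lim: "AE x in lborel. (\<lambda>n. \<phi> n x) \<longlonglongrightarrow> f x"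
    by (rule test_function_approximation[OF assms(1) f]) (rule that)
  have n: "nice (\<phi> n)" for n by (rule test_functions_nice[OF \<phi>(1)])
  have m: "\<phi> n \<in> borel_measurable borel" for n by (rule nice_measurable[OF n])
  note [measurable] = m
  have p: "partial i (conv bessel (\<phi> n)) = conv (dbessel i) (\<phi> n)" for i n
    using n by (simp add: partial_conv integrable_bessel conv_bessel_partial)
  have ftc: "conv bessel (\<phi> n) (x + h) - conv bessel (\<phi> n) x
    = (LBINT s. (\<Sum>i\<in>UNIV. h $ i * conv (dbessel i) (\<phi> n) (x + s *\<^sub>R h)) * indicator {0..1} s)" for n
  proof -
    have nv: "nice (conv bessel (\<phi> n))" by (rule nice_conv[OF integrable_bessel n])
    have D: "((\<lambda>s. conv bessel (\<phi> n) (x + s *\<^sub>R h)) has_real_derivative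
        (\<Sum>i\<in>UNIV. h $ i * conv (dbessel i) (\<phi> n) (x + s *\<^sub>R h))) (at s)" for s
    proof -
      have "((\<lambda>s. conv bessel (\<phi> n) (x + s *\<^sub>R h)) has_derivative
          (\<lambda>t. \<Sum>i\<in>UNIV. (t *\<^sub>R h) $ i * partial i (conv bessel (\<phi> n)) (x + s *\<^sub>R h))) (at s)"
        by (rule has_derivative_compose[where f="\<lambda>s. x + s *\<^sub>R h", OF _ has_derivative_partials[OF nice_differentiable[OF nv]]])
          (auto intro!: derivative_eq_intros)
      moreover have "(\<lambda>t. \<Sum>i\<in>UNIV. (t *\<^sub>R h) $ i * partial i (conv bessel (\<phi> n)) (x + s *\<^sub>R h))
          = (*) (\<Sum>i\<in>UNIV. h $ i * conv (dbessel i) (\<phi> n) (x + s *\<^sub>R h))"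
        unfolding p by (rule ext) (simp add: sum_distrib_left sum_distrib_right mult_ac)
      ultimately show ?thesis by (simp add: has_field_derivative_def)
    qed
    have c: "isCont (\<lambda>s. \<Sum>i\<in>UNIV. h $ i * conv (dbessel i) (\<phi> n) (x + s *\<^sub>R h)) s" for s
    proof -
      have "continuous_on UNIV (\<lambda>s. \<Sum>i\<in>UNIV. h $ i * conv (dbessel i) (\<phi> n) (x + s *\<^sub>R h))"
        by (intro continuous_intros continuous_on_compose2[OF nice_continuous[OF nice_conv[OF integrable_dbessel n]]]) auto
      then show ?thesis by (simp add: continuous_on_eq_continuous_at)
    qed
    show ?thesis
      using integral_FTC_Icc_real[OF _ D c, of 0 1] by simp
  qed
  define A where "A = (\<Sum>i\<in>UNIV. \<bar>h $ i\<bar> * ((LINT y|lborel. \<bar>dbessel i (y::real^'n)\<bar>) * (M + 1)))"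
  have "(\<lambda>n. LBINT s. (\<Sum>i\<in>UNIV. h $ i * conv (dbessel i) (\<phi> n) (x + s *\<^sub>R h)) * indicator {0..1} s)
    \<longlonglongrightarrow> (LBINT s. (\<Sum>i\<in>UNIV. h $ i * conv (dbessel i) f (x + s *\<^sub>R h)) * indicator {0..1} s)"
  proof (rule integral_dominated_convergence[where w="\<lambda>s. A * indicator {0..1} s"])
    show "AE s in lborel. (\<lambda>n. (\<Sum>i\<in>UNIV. h $ i * conv (dbessel i) (\<phi> n) (x + s *\<^sub>R h)) * indicator {0..1} s)
        \<longlonglongrightarrow> (\<Sum>i\<in>UNIV. h $ i * conv (dbessel i) f (x + s *\<^sub>R h)) * indicator {0..1} s"
      by (intro AE_I2 tendsto_intros conv_tendsto_pointwise[OF integrable_dbessel _ m \<phi>(2) lim] assms)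
    show "AE s in lborel. norm ((\<Sum>i\<in>UNIV. h $ i * conv (dbessel i) (\<phi> n) (x + s *\<^sub>R h)) * indicator {0..1} s) \<le> A * indicator {0..1} s" for n
    proof (intro AE_I2)
      fix s
      have "\<bar>\<Sum>i\<in>UNIV. h $ i * conv (dbessel i) (\<phi> n) (x + s *\<^sub>R h)\<bar> \<le> A"
        unfolding A_def using conv_bound[OF integrable_dbessel m \<phi>(2)]
        by (intro order_trans[OF sum_abs] sum_mono) (auto simp: abs_mult intro!: mult_left_mono)
      then show "norm ((\<Sum>i\<in>UNIV. h $ i * conv (dbessel i) (\<phi> n) (x + s *\<^sub>R h)) * indicator {0..1} s) \<le> A * indicator {0..1} s"
        by (auto simp: indicator_def)
    qed
    have [measurable]: "conv (dbessel i) f \<in> borel_measurable borel" "conv (dbessel i) (\<phi> n) \<in> borel_measurable borel" for i n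
      by measurable
    show "(\<lambda>s. (\<Sum>i\<in>UNIV. h $ i * conv (dbessel i) f (x + s *\<^sub>R h)) * indicator {0..1} s) \<in> borel_measurable lborel"
      "(\<lambda>s. (\<Sum>i\<in>UNIV. h $ i * conv (dbessel i) (\<phi> n) (x + s *\<^sub>R h)) * indicator {0..1} s) \<in> borel_measurable lborel" for n
      by measurable
  qed auto
  moreover have "(\<lambda>n. conv bessel (\<phi> n) (x + h) - conv bessel (\<phi> n) x) \<longlonglongrightarrow> conv bessel f (x + h) - conv bessel f x"
    by (intro tendsto_intros conv_tendsto_pointwise[OF integrable_bessel _ m \<phi>(2) lim] assms)
  ultimately show ?thesis unfolding ftc using LIMSEQ_unique by blast
qed

text \<open>
  The integrand of \<open>conv_bessel_ftc\<close> is continuous, so its mean over a short segment is close to its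
  value at \<open>x\<close>.
\<close>

lemma conv_bessel_has_derivative:
  fixes f :: "real ^ 'n::finite \<Rightarrow> real"
  assumes fm: "f \<in> borel_measurable borel" and f: "\<And>x. \<bar>f x\<bar> \<le> M"
  shows "(conv bessel f has_derivative (\<lambda>h. \<Sum>i\<in>UNIV. h $ i * conv (dbessel i) f x)) (at x)"
  unfolding has_derivative_at_alt
proof (intro conjI allI impI)
  show "bounded_linear (\<lambda>h. \<Sum>i\<in>UNIV. h $ i * conv (dbessel i) f x)"
    by (intro bounded_linear_sum bounded_linear_mult_left[THEN bounded_linear_compose] bounded_linear_vec_nth)
  fix e :: real assume e: "0 < e"
  define e' where "e' = e / CARD('n)"
  have e': "0 < e'" using e by (simp add: e'_def)
  have cont: "continuous_on UNIV (conv (dbessel i) f)" for i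
    by (rule continuous_conv_bounded[OF integrable_dbessel fm f])
  have "\<forall>i. \<exists>d>0. \<forall>z. norm (z - x) < d \<longrightarrow> \<bar>conv (dbessel i) f z - conv (dbessel i) f x\<bar> < e'"
    using cont e' by (simp add: continuous_on_iff dist_norm)
  then obtain d where d: "\<And>i. 0 < d i" "\<And>i z. norm (z - x) < d i \<Longrightarrow> \<bar>conv (dbessel i) f z - conv (dbessel i) f x\<bar> < e'"
    by metis
  define d0 where "d0 = Min (range d)"
  have d0: "0 < d0" "\<And>i. d0 \<le> d i" unfolding d0_def using d(1) by (auto intro: Min_le)
  show "\<exists>d>0. \<forall>y. norm (y - x) < d \<longrightarrow>
      norm (conv bessel f y - conv bessel f x - (\<Sum>i\<in>UNIV. (y - x) $ i * conv (dbessel i) f x)) \<le> e * norm (y - x)"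
  proof (intro exI[of _ d0] conjI d0 allI impI)
    fix y assume y: "norm (y - x) < d0"
    define h where "h = y - x"
    have y': "y = x + h" by (simp add: h_def)
    let ?G = "\<lambda>s i. conv (dbessel i) f (x + s *\<^sub>R h)"
    have c: "continuous_on {0..1} (\<lambda>s. \<Sum>i\<in>UNIV. h $ i * ?G s i)"
      by (intro continuous_intros continuous_on_compose2[OF cont]) auto
    have "integrable lborel (\<lambda>s. indicator {0..1} s *\<^sub>R (\<Sum>i\<in>UNIV. h $ i * ?G s i))"
      by (rule borel_integrable_compact[OF _ c]) simp
    then have i1: "integrable lborel (\<lambda>s. (\<Sum>i\<in>UNIV. h $ i * ?G s i) * indicator {0..1} s)"
      by (simp add: mult.commute)
    have i0: "integrable lborel (indicator {0..1} :: real \<Rightarrow> real)" by simp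
    let ?S = "\<Sum>i\<in>UNIV. h $ i * conv (dbessel i) f x"
    have i2: "integrable lborel (\<lambda>s::real. ?S * indicator {0..1} s)" using i0 by simp
    have "conv bessel f y - conv bessel f x - ?S
      = (LBINT s. (\<Sum>i\<in>UNIV. h $ i * ?G s i) * indicator {0..1} s) - (LBINT s::real. ?S * indicator {0..1} s)"
      unfolding y' using conv_bessel_ftc[OF fm f, of x h] by simp
    also have "\<dots> = (LBINT s. (\<Sum>i\<in>UNIV. h $ i * ?G s i) * indicator {0..1} s - ?S * indicator {0..1} s)"
      by (rule Bochner_Integration.integral_diff[symmetric, OF i1 i2])
    also have "norm \<dots> \<le> (LBINT s::real. (e * norm h) * indicator {0..1} s)"
    proof (rule Bochner_Integration.integral_norm_bound_integral)
      show "integrable lborel (\<lambda>s. (\<Sum>i\<in>UNIV. h $ i * ?G s i) * indicator {0..1} s - ?S * indicator {0..1} s)"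
        by (rule Bochner_Integration.integrable_diff[OF i1 i2])
      show "integrable lborel (\<lambda>s::real. (e * norm h) * indicator {0..1} s)" using i0 by simp
      fix s :: real
      show "norm ((\<Sum>i\<in>UNIV. h $ i * ?G s i) * indicator {0..1} s - ?S * indicator {0..1} s) \<le> (e * norm h) * indicator {0..1} s"
      proof (cases "s \<in> {0..1}")
        case True
        have "norm ((x + s *\<^sub>R h) - x) \<le> norm h" using True by (simp add: mult_left_le_one_le)
        then have lt: "norm ((x + s *\<^sub>R h) - x) < d i" for i using y d0(2)[of i] by (simp add: h_def)
        have "\<bar>(\<Sum>i\<in>UNIV. h $ i * ?G s i) - ?S\<bar> = \<bar>\<Sum>i\<in>UNIV. h $ i * (?G s i - conv (dbessel i) f x)\<bar>"
          by (simp add: sum_subtractf right_diff_distrib)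
        also have "\<dots> \<le> (\<Sum>i\<in>(UNIV::'n set). norm h * e')"
          using less_imp_le[OF d(2)[OF lt]] by (intro order_trans[OF sum_abs] sum_mono)
            (auto simp: abs_mult intro!: mult_mono component_le_norm_cart)
        also have "\<dots> = e * norm h" by (simp add: e'_def)
        finally show ?thesis using True by simp
      qed simp
    qed
    also have "\<dots> = e * norm h" by simp
    finally show "norm (conv bessel f y - conv bessel f x - (\<Sum>i\<in>UNIV. (y - x) $ i * conv (dbessel i) f x)) \<le> e * norm (y - x)"
      by (simp add: h_def)
  qed
qed

lemma partial_conv_bessel:
  fixes f :: "real ^ 'n::finite \<Rightarrow> real"
  assumes "f \<in> borel_measurable borel" "\<And>x. \<bar>f x\<bar> \<le> M"
  shows "partial i (conv bessel f) = conv (dbessel i) f"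
  by (rule ext, subst partial_eq[OF conv_bessel_has_derivative[OF assms]])
     (simp add: axis_def if_distrib[of "\<lambda>c. c * _"] cong: if_cong)

text \<open>
  Young's inequality with \<open>q = 1\<close> and \<open>p = r = 2\<close>.
\<close>

lemma conv_square_integrable:
  fixes K f :: "real ^ 'n::finite \<Rightarrow> real"
  assumes K: "integrable lborel K" and [measurable]: "f \<in> borel_measurable borel"
    and f: "integrable lborel (\<lambda>x. (f x)\<^sup>2)"
  shows "integrable lborel (\<lambda>x. (conv K f x)\<^sup>2)"
proof -
  have [measurable]: "K \<in> borel_measurable borel" using K borel_measurable_integrable by auto
  have K1: "integrable lborel (\<lambda>x. \<bar>K x\<bar> powr 1)" using K by simp
  have f2: "integrable lborel (\<lambda>x. \<bar>f x\<bar> powr 2)" using f by simp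
  have i: "integrable lborel (\<lambda>x. conv (\<lambda>x. \<bar>K x\<bar>) (\<lambda>x. \<bar>f x\<bar>) x powr 2)"
    by (rule young_conv(2)[where t=0, OF _ _ _ K1 _ f2]) auto
  have "AE x in lborel. integrable lborel (\<lambda>y. \<bar>K y\<bar> * \<bar>f (x - y)\<bar>)"
    by (rule young_conv(1)[where t=0 and p=2, OF _ _ _ K1 _ f2]) auto
  then have le: "AE x in lborel. norm ((conv K f x)\<^sup>2) \<le> norm (conv (\<lambda>x. \<bar>K x\<bar>) (\<lambda>x. \<bar>f x\<bar>) x powr 2)"
  proof eventually_elim
    case (elim x)
    have "\<bar>conv K f x\<bar> \<le> conv (\<lambda>x. \<bar>K x\<bar>) (\<lambda>x. \<bar>f x\<bar>) x"
      using conv_split_bound[OF _ K, of f 0 "\<lambda>x. \<bar>f x\<bar>" x] elim by simp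
    then have "\<bar>conv K f x\<bar> powr 2 \<le> conv (\<lambda>x. \<bar>K x\<bar>) (\<lambda>x. \<bar>f x\<bar>) x powr 2" by (intro powr_mono2) auto
    then show ?case by simp
  qed
  show ?thesis by (rule Bochner_Integration.integrable_bound[OF i _ le]) measurable
qed

lemma square_integrable_tail:
  fixes f :: "real ^ 'n::finite \<Rightarrow> real"
  assumes [measurable]: "f \<in> borel_measurable borel" and f: "integrable lborel (\<lambda>x. (f x)\<^sup>2)" and e: "0 < e"
  obtains r where "(LINT x|lborel. indicator {x. r \<le> norm x} x * (f x)\<^sup>2) < e"
proof -
  have "(\<lambda>n. LINT x|lborel. indicator {x. real n \<le> norm x} x * (f x)\<^sup>2) \<longlonglongrightarrow> (LINT (x::real^'n)|lborel. 0)"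
  proof (rule integral_dominated_convergence[OF _ _ f])
    show "AE x in lborel. (\<lambda>n. indicator {x. real n \<le> norm x} x * (f x)\<^sup>2) \<longlonglongrightarrow> 0"
    proof (intro AE_I2 tendsto_eventually)
      fix x
      show "\<forall>\<^sub>F n in sequentially. indicator {x. real n \<le> norm x} x * (f x)\<^sup>2 = 0"
        using eventually_gt_at_top[of "nat \<lceil>norm x\<rceil>"]
      proof eventually_elim
        case (elim n)
        then have "norm x < real n" by linarith
        then show ?case by simp
      qed
    qed
  qed (auto simp: indicator_def)
  then have "\<forall>\<^sub>F n in sequentially. (LINT x|lborel. indicator {x. real n \<le> norm x} x * (f x)\<^sup>2) < e"
    using e by (intro order_tendstoD(2)) auto
  then show ?thesis
    using that eventually_happens'[of sequentially] by (auto simp: trivial_limit_sequentially)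
qed

text \<open>
  Approximate \<open>K\<close> in the mean by a test function \<open>\<phi>\<close>. Far out, \<open>\<phi> * f\<close> only sees the values of \<open>f\<close> outside a
  large ball, where \<open>f\<close> is small in \<open>L\<^sup>2\<close>.
\<close>

lemma conv_vanishes_at_infinity:
  fixes K f :: "real ^ 'n::finite \<Rightarrow> real"
  assumes K: "integrable lborel K" and fm [measurable]: "f \<in> borel_measurable borel" and f: "\<And>x. \<bar>f x\<bar> \<le> M"
    and f2: "integrable lborel (\<lambda>x. (f x)\<^sup>2)"
  shows "(conv K f \<longlongrightarrow> 0) at_infinity"
proof (rule tendstoI)
  fix e :: real assume e: "0 < e"
  have M: "0 \<le> M" using f[of 0] by simp
  obtain \<phi> where \<phi>: "\<phi> \<in> test_functions" "(LINT x|lborel. \<bar>K x - \<phi> x\<bar>) < e / (3 * (M + 1))"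
    using L1_approximation[OF K, of "e / (3 * (M + 1))"] e M by auto
  obtain R C where R: "0 < R" "\<And>x. norm x > R \<Longrightarrow> \<phi> x = 0" and C: "0 \<le> C" "\<And>x. \<bar>\<phi> x\<bar> \<le> C"
    using test_functions_boundedE[OF \<phi>(1)] by metis
  have \<phi>n: "nice \<phi>" by (rule test_functions_nice[OF \<phi>(1)])
  have [measurable]: "\<phi> \<in> borel_measurable borel" by (rule nice_measurable[OF \<phi>n])
  have \<phi>2: "integrable lborel (\<lambda>x. (\<phi> x)\<^sup>2)" using nice_times_integrable[OF \<phi>n \<phi>n] by (simp add: power2_eq_square)
  define A where "A = (LINT x|lborel. (\<phi> x)\<^sup>2)"
  have A: "0 \<le> A" by (simp add: A_def)
  define t where "t = e / (3 * (A + 1))"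
  have t: "0 < t" "t * A < e / 3"
  proof -
    show "0 < t" using A e by (simp add: t_def)
    then have "t * A < t * (A + 1)" by simp
    also have "\<dots> = e / 3" using A by (simp add: t_def field_simps)
    finally show "t * A < e / 3" .
  qed
  obtain r where r: "(LINT x|lborel. indicator {x. r \<le> norm x} x * (f x)\<^sup>2) < t * e / 3"
    using square_integrable_tail[OF fm f2, of "t * e / 3"] t e by auto
  define f1 where "f1 x = indicator {x. r \<le> norm x} x * f x" for x
  have f1m [measurable]: "f1 \<in> borel_measurable borel" unfolding f1_def[abs_def] by measurable
  have f1sq: "(f1 x)\<^sup>2 = indicator {x. r \<le> norm x} x * (f x)\<^sup>2" for x by (simp add: f1_def indicator_def)
  have f12: "integrable lborel (\<lambda>x. (f1 x)\<^sup>2)"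
    unfolding f1sq by (rule Bochner_Integration.integrable_bound[OF f2]) (auto simp: indicator_def)
  have far: "\<bar>conv \<phi> f x\<bar> < 2 * e / 3" if x: "norm x \<ge> r + R" for x
  proof -
    have eq: "\<phi> y * f (x - y) = \<phi> y * f1 (x - y)" for y
    proof (cases "norm y \<le> R")
      case True
      then have "r \<le> norm (x - y)" using x norm_triangle_ineq2[of x y] by linarith
      then show ?thesis by (simp add: f1_def)
    qed (use R in simp)
    have i1: "integrable lborel (\<lambda>y. (f1 (x - y))\<^sup>2)" using integrable_reflect[of "\<lambda>y. (f1 y)\<^sup>2" x] f12 by simp
    have e1: "(LINT y|lborel. (f1 (x - y))\<^sup>2) = (LINT y|lborel. (f1 y)\<^sup>2)"
      by (rule integral_reflect[of "\<lambda>y. (f1 y)\<^sup>2"]) measurable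
    have i2: "integrable lborel (\<lambda>y. t * (\<phi> y)\<^sup>2 + (f1 (x - y))\<^sup>2 / t)" using \<phi>2 i1 by simp
    have "\<bar>conv \<phi> f x\<bar> = \<bar>LINT y|lborel. \<phi> y * f1 (x - y)\<bar>" by (simp add: conv_def eq)
    also have "\<dots> \<le> (LINT y|lborel. t * (\<phi> y)\<^sup>2 + (f1 (x - y))\<^sup>2 / t)"
    proof (rule order_trans[OF integral_abs_bound integral_mono'[OF i2]])
      fix y
      have "0 \<le> (t * \<bar>\<phi> y\<bar> - \<bar>f1 (x - y)\<bar>)\<^sup>2 / t" using t by simp
      also have "\<dots> = t * (\<phi> y)\<^sup>2 + (f1 (x - y))\<^sup>2 / t - 2 * \<bar>\<phi> y * f1 (x - y)\<bar>"
        using t by (simp add: power2_eq_square field_simps abs_mult)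
      finally show "\<bar>\<phi> y * f1 (x - y)\<bar> \<le> t * (\<phi> y)\<^sup>2 + (f1 (x - y))\<^sup>2 / t" by simp
      show "0 \<le> t * (\<phi> y)\<^sup>2 + (f1 (x - y))\<^sup>2 / t" using t by simp
    qed
    also have "\<dots> = t * A + (LINT y|lborel. (f1 y)\<^sup>2) / t" using \<phi>2 i1 e1 by (simp add: A_def)
    also have "(LINT y|lborel. (f1 y)\<^sup>2) / t < e / 3"
      using r t by (simp add: f1sq divide_less_eq mult.commute)
    finally show ?thesis using t by simp
  qed
  show "\<forall>\<^sub>F x in at_infinity. dist (conv K f x) 0 < e"
    unfolding eventually_at_infinity
  proof (intro exI allI impI)
    fix x :: "real ^ 'n" assume x: "norm x \<ge> r + R"
    have "\<bar>conv K f x - conv \<phi> f x\<bar> \<le> (LINT y|lborel. \<bar>K y - \<phi> y\<bar>) * M"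
      by (rule conv_diff_left_bound[OF K nice_integrable[OF \<phi>n] fm f])
    also have "\<dots> \<le> e / (3 * (M + 1)) * M" using \<phi>(2) M by (intro mult_right_mono) auto
    also have "\<dots> \<le> e / 3" using e M by (simp add: field_simps)
    finally show "dist (conv K f x) 0 < e" using far[OF x] unfolding dist_real_def by linarith
  qed
qed

section \<open>Fourth-order derivatives\<close>

lemma partial_diff:
  assumes "f differentiable (at x)" "g differentiable (at x)"
  shows "partial i (\<lambda>x. f x - g x) x = partial i f x - partial i g x"
proof -
  obtain D E where D: "(f has_derivative D) (at x)" and E: "(g has_derivative E) (at x)"
    using assms by (auto simp: differentiable_def)
  show ?thesis
    by (subst partial_eq[OF has_derivative_diff[OF D E]]) (simp add: partial_eq[OF D] partial_eq[OF E])
qed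

lemma partials_diff:
  assumes "nice f" "nice g"
  shows "partials is (\<lambda>x. f x - g x) = (\<lambda>x. partials is f x - partials is g x)"
proof (induction "is")
  case (Cons i "is")
  show ?case
    unfolding partials_Cons Cons
    by (rule ext) (intro partial_diff nice_differentiable nice_partials assms)
qed simp

lemma nice_diff:
  assumes f: "nice f" and g: "nice g"
  shows "nice (\<lambda>x. f x - g x)"
  unfolding nice_def partials_diff[OF assms]
proof (intro conjI allI)
  have "C_k k (\<lambda>x. f x + (-1) * g x)" for k
    using nice_smooth[OF f] nice_smooth[OF g] unfolding smooth_def by (intro C_k_add C_k_mult C_k_const) blast+
  then show "smooth (\<lambda>x. f x - g x)" by (simp add: smooth_def)
  fix "is"
  obtain C D where "\<And>x. \<bar>partials is f x\<bar> \<le> C" "\<And>x. \<bar>partials is g x\<bar> \<le> D"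
    using nice_bounded nice_partials f g by metis
  then have "\<bar>partials is f x - partials is g x\<bar> \<le> C + D" for x
    by (meson abs_triangle_ineq4 add_mono order_trans)
  then show "\<exists>C. \<forall>x. \<bar>partials is f x - partials is g x\<bar> \<le> C" by blast
  show "integrable lborel (\<lambda>x. partials is f x - partials is g x)"
    by (intro Bochner_Integration.integrable_diff nice_integrable nice_partials f g)
qed

lemma nice_square_integrable: "nice f \<Longrightarrow> integrable lborel (\<lambda>x. (f x)\<^sup>2)"
  using nice_times_integrable[of f f] by (simp add: power2_eq_square)

lemma nice_LpLinf_1:
  fixes f :: "real ^ 'n::finite \<Rightarrow> real"
  assumes f: "nice f" shows "LpLinf 1 f"
proof -
  obtain C where "\<And>x. \<bar>f x\<bar> \<le> C" using nice_bounded[OF f] by blast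
  then show ?thesis by (intro LpLinf_bounded[of f C]) (use nice_measurable[OF f] in auto)
qed

lemma conv_diff_nice:
  fixes f g :: "real ^ 'n::finite \<Rightarrow> real"
  assumes K: "integrable lborel K" and f: "nice f" and g: "nice g"
  shows "conv K (\<lambda>x. f x - g x) = (\<lambda>x. conv K f x - conv K g x)"
proof
  fix x
  obtain C D where "\<And>x. \<bar>f x\<bar> \<le> C" "\<And>x. \<bar>g x\<bar> \<le> D"
    using nice_bounded f g by metis
  then have "integrable lborel (\<lambda>y. K y * f (x - y))" "integrable lborel (\<lambda>y. K y * g (x - y))"
    using integrable_conv_bounded[OF K] nice_measurable f g by metis+
  then show "conv K (\<lambda>x. f x - g x) x = conv K f x - conv K g x"
    by (simp add: conv_def right_diff_distrib)
qed

lemma nice_integration_by_parts_list: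
  fixes v \<phi> :: "real ^ 'n::finite \<Rightarrow> real"
  assumes v: "nice v" and \<phi>: "nice \<phi>"
  shows "(LINT x|lborel. v x * partials is \<phi> x) = (-1) ^ length is * (LINT x|lborel. partials (rev is) v x * \<phi> x)"
  using v
proof (induction "is" arbitrary: v)
  case (Cons i "is")
  have "(LINT x|lborel. v x * partials (i # is) \<phi> x) = - (LINT x|lborel. partial i v x * partials is \<phi> x)"
    using nice_integration_by_parts[OF Cons.prems nice_partials[OF \<phi>], of i "is"] by simp
  also have "\<dots> = (-1) ^ length (i # is) * (LINT x|lborel. partials (rev (i # is)) v x * \<phi> x)"
    using Cons.IH[OF nice_partial[OF Cons.prems], of i] by (simp add: partials_append)
  finally show ?case .
qed simp

text \<open>
  At most two of the derivatives are charged to each of the two convolutions.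
\<close>

lemma bessel_bessel_energy_bound:
  fixes f :: "real ^ 'n::finite \<Rightarrow> real"
  assumes f: "nice f" and l: "length is \<le> 4"
  shows "(LINT x|lborel. (partials is (conv bessel (conv bessel f)) x)\<^sup>2) \<le> (LINT x|lborel. (f x)\<^sup>2)"
proof -
  define js ks where "js = take 2 is" and "ks = drop 2 is"
  have eq: "is = js @ ks" and len: "length js \<le> 2" "length ks \<le> 2" using l by (auto simp: js_def ks_def)
  have n: "nice (conv bessel f)" by (rule nice_conv[OF integrable_bessel f])
  have "partials is (conv bessel (conv bessel f)) = partials js (conv bessel (partials ks (conv bessel f)))"
    unfolding eq partials_append by (simp add: partials_conv[OF integrable_bessel n])
  then have "(LINT x|lborel. (partials is (conv bessel (conv bessel f)) x)\<^sup>2) \<le> (LINT x|lborel. (partials ks (conv bessel f) x)\<^sup>2)"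
    using bessel_energy_bound[OF nice_partials[OF n] len(1)] by simp
  also have "\<dots> \<le> (LINT x|lborel. (f x)\<^sup>2)" by (rule bessel_energy_bound[OF f len(2)])
  finally show ?thesis .
qed

lemma LpLinf_1_of_square_integrable:
  fixes f :: "real ^ 'n::finite \<Rightarrow> real"
  assumes "f \<in> borel_measurable borel" "integrable lborel (\<lambda>x. (f x)\<^sup>2)"
  shows "LpLinf 1 f"
  by (rule LpLinf_antimono[OF LpLinf_of_square_integrable[OF assms]]) auto

lemma conv_bessel_adjoint:
  fixes h \<phi> :: "real ^ 'n::finite \<Rightarrow> real"
  assumes "LpLinf 1 h" "nice \<phi>"
  shows "(LINT x|lborel. h x * conv bessel \<phi> x) = (LINT x|lborel. conv bessel h x * \<phi> x)"
proof -
  have "(\<lambda>y. bessel (- y :: real ^ 'n)) = bessel" by (auto simp: bessel_even)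
  then show ?thesis using conv_adjoint(1)[OF integrable_bessel assms] by simp
qed

lemma square_diff_le:
  fixes a b c :: real
  shows "(a - b)\<^sup>2 \<le> 2 * (c - a)\<^sup>2 + 2 * (c - b)\<^sup>2"
proof -
  have "0 \<le> ((c - a) + (c - b))\<^sup>2" by simp
  then show ?thesis by (simp add: power2_eq_square algebra_simps)
qed

text \<open>
  For test functions \<open>f\<^sub>n\<close> converging to \<open>F\<close> in \<open>L\<^sup>2\<close>, the energy bound makes the derivatives of
  \<open>B * B * f\<^sub>n\<close> a Cauchy sequence in \<open>L\<^sup>2\<close>. Its limit is the weak derivative because the identity that
  defines weak derivatives passes to the limit.
\<close>

lemma bessel_bessel_weak_derivative:
  fixes F :: "real ^ 'n::finite \<Rightarrow> real"
  assumes Fm [measurable]: "F \<in> borel_measurable borel" and F: "integrable lborel (\<lambda>x. (F x)\<^sup>2)" and l: "length is \<le> 4"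
  obtains y where "y \<in> borel_measurable borel" "integrable lborel (\<lambda>x. (y x)\<^sup>2)"
    "\<And>\<phi>. \<phi> \<in> test_functions \<Longrightarrow>
      (LINT x|lborel. conv bessel (conv bessel F) x * partials is \<phi> x) = (-1) ^ length is * (LINT x|lborel. y x * \<phi> x)"
proof -
  have "\<exists>\<phi>. \<phi> \<in> test_functions \<and> (LINT x|lborel. (F x - \<phi> x)\<^sup>2) < 1 / real (Suc n)" for n
  proof -
    have "integrable lborel (\<lambda>x. \<bar>F x\<bar> ^ 2)" using F by simp
    then show ?thesis using test_functions_dense[OF Fm, of 2 "1 / real (Suc n)"] by (auto simp del: of_nat_Suc)
  qed
  then obtain f where f: "\<And>n. f n \<in> test_functions" and fl: "\<And>n. (LINT x|lborel. (F x - f n x)\<^sup>2) < 1 / real (Suc n)"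
    by metis
  have n: "nice (f k)" for k by (rule test_functions_nice[OF f])
  have [measurable]: "f k \<in> borel_measurable borel" for k by (rule nice_measurable[OF n])
  define v where "v k = conv bessel (conv bessel (f k))" for k
  have nv: "nice (v k)" for k unfolding v_def by (intro nice_conv integrable_bessel n)
  have [measurable]: "v k \<in> borel_measurable borel" for k by (rule nice_measurable[OF nv])
  define d where "d k = partials (rev is) (v k)" for k
  have nd: "nice (d k)" for k unfolding d_def by (intro nice_partials nv)
  have fi: "integrable lborel (\<lambda>x. (F x - f k x)\<^sup>2)" for k
    by (rule square_integrable_diff) (use F nice_square_integrable[OF n] in auto)
  have dle: "(LINT x|lborel. (d m x - d k x)\<^sup>2) \<le> 2 / real (Suc m) + 2 / real (Suc k)" for m k
  proof -
    have nn: "nice (\<lambda>x. f m x - f k x)" by (rule nice_diff[OF n n])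
    have "(\<lambda>x. d m x - d k x) = partials (rev is) (\<lambda>x. v m x - v k x)"
      unfolding d_def by (rule partials_diff[OF nv nv, symmetric])
    also have "(\<lambda>x. v m x - v k x) = conv bessel (conv bessel (\<lambda>x. f m x - f k x))"
      unfolding v_def by (simp add: conv_diff_nice integrable_bessel n nice_conv)
    finally have e: "d m x - d k x = partials (rev is) (conv bessel (conv bessel (\<lambda>x. f m x - f k x))) x" for x
      by (rule fun_cong)
    have "(LINT x|lborel. (d m x - d k x)\<^sup>2) \<le> (LINT x|lborel. (f m x - f k x)\<^sup>2)"
      unfolding e by (rule bessel_bessel_energy_bound[OF nn]) (use l in simp)
    also have "\<dots> \<le> (LINT x|lborel. 2 * (F x - f m x)\<^sup>2 + 2 * (F x - f k x)\<^sup>2)"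
      using nice_square_integrable[OF nn] fi by (intro integral_mono square_diff_le) auto
    also have "\<dots> = 2 * (LINT x|lborel. (F x - f m x)\<^sup>2) + 2 * (LINT x|lborel. (F x - f k x)\<^sup>2)"
      using fi by simp
    also have "\<dots> \<le> 2 * (1 / real (Suc m)) + 2 * (1 / real (Suc k))"
      by (intro add_mono mult_left_mono less_imp_le fl) auto
    finally show ?thesis by simp
  qed
  have cauchy: "\<exists>N. \<forall>m\<ge>N. \<forall>k\<ge>N. (LINT x|lborel. (d m x - d k x)\<^sup>2) < e" if e: "0 < e" for e
  proof -
    obtain N :: nat where N: "4 / e < real N" using reals_Archimedean2 by blast
    show ?thesis
    proof (intro exI[of _ N] allI impI)
      fix m k assume "N \<le> m" "N \<le> k"
      then have mk: "4 / e < real (Suc m)" "4 / e < real (Suc k)" using N by linarith+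
      then have "2 / real (Suc m) < e / 2" "2 / real (Suc k) < e / 2"
        using e by (simp_all add: field_simps)
      then show "(LINT x|lborel. (d m x - d k x)\<^sup>2) < e" using dle[of m k] by linarith
    qed
  qed
  have dm: "d k \<in> borel_measurable lborel" for k using nice_measurable[OF nd] by simp
  obtain y where y: "y \<in> borel_measurable lborel" "integrable lborel (\<lambda>x. (y x)\<^sup>2)"
    "(\<lambda>k. LINT x|lborel. (d k x - y x)\<^sup>2) \<longlonglongrightarrow> 0"
    by (rule L2_complete[OF dm nice_square_integrable[OF nd] cauchy]) (assumption, rule that)
  have f0: "(\<lambda>k. LINT x|lborel. (f k x - F x)\<^sup>2) \<longlonglongrightarrow> 0"
  proof (rule Lim_null_comparison[OF _ LIMSEQ_Suc[OF lim_1_over_n]])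
    show "\<forall>\<^sub>F k in sequentially. norm (LINT x|lborel. (f k x - F x)\<^sup>2) \<le> 1 / real (Suc k)"
      using fl by (intro always_eventually allI) (auto simp: power2_commute[of "f _ _"] intro: less_imp_le)
  qed
  have L: "LpLinf 1 F" by (rule LpLinf_1_of_square_integrable[OF Fm F])
  have "LpLinf (1 / (1 - 0)) (conv bessel F)"
    by (rule LpLinf_conv) (use L in \<open>auto simp: integrable_bessel\<close>)
  then have L2: "LpLinf 1 (conv bessel F)" by simp
  show ?thesis
  proof (rule that[of y])
    show "y \<in> borel_measurable borel" "integrable lborel (\<lambda>x. (y x)\<^sup>2)" using y by auto
    fix \<phi> :: "real ^ 'n \<Rightarrow> real" assume "\<phi> \<in> test_functions"
    then have \<phi>: "nice \<phi>" by (rule test_functions_nice)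
    define \<psi> where "\<psi> = partials is \<phi>"
    have \<psi>: "nice \<psi>" unfolding \<psi>_def by (rule nice_partials[OF \<phi>])
    have b\<psi>: "nice (conv bessel \<psi>)" "nice (conv bessel (conv bessel \<psi>))" by (intro nice_conv integrable_bessel \<psi>)+
    \<comment> \<open>Both convolutions are moved to the nice function \<open>\<psi>\<close>, so that only weak convergence of
      the \<open>f\<^sub>n\<close> is used.\<close>
    have move: "(LINT x|lborel. conv bessel (conv bessel h) x * \<psi> x) = (LINT x|lborel. h x * conv bessel (conv bessel \<psi>) x)"
      if "LpLinf 1 h" "LpLinf 1 (conv bessel h)" for h
      using conv_bessel_adjoint[OF that(1) b\<psi>(1)] conv_bessel_adjoint[OF that(2) \<psi>] by simp
    have "(\<lambda>k. LINT x|lborel. f k x * conv bessel (conv bessel \<psi>) x) \<longlonglongrightarrow> (LINT x|lborel. F x * conv bessel (conv bessel \<psi>) x)"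
      by (rule L2_tendsto_weak[OF _ _ _ nice_square_integrable[OF n] F nice_square_integrable[OF b\<psi>(2)] f0])
        (use nice_measurable[OF b\<psi>(2)] in auto)
    then have 1: "(\<lambda>k. LINT x|lborel. v k x * \<psi> x) \<longlonglongrightarrow> (LINT x|lborel. conv bessel (conv bessel F) x * \<psi> x)"
      unfolding v_def by (simp add: move L L2 nice_LpLinf_1 n nice_conv integrable_bessel)
    have "(\<lambda>k. LINT x|lborel. d k x * \<phi> x) \<longlonglongrightarrow> (LINT x|lborel. y x * \<phi> x)"
      by (rule L2_tendsto_weak[OF _ _ _ nice_square_integrable[OF nd] y(2) nice_square_integrable[OF \<phi>] y(3)])
        (use nice_measurable[OF nd] nice_measurable[OF \<phi>] y in auto)
    then have "(\<lambda>k. (-1) ^ length is * (LINT x|lborel. d k x * \<phi> x)) \<longlonglongrightarrow> (-1) ^ length is * (LINT x|lborel. y x * \<phi> x)"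
      by (rule tendsto_mult_left)
    then have 2: "(\<lambda>k. LINT x|lborel. v k x * \<psi> x) \<longlonglongrightarrow> (-1) ^ length is * (LINT x|lborel. y x * \<phi> x)"
      unfolding \<psi>_def d_def by (simp add: nice_integration_by_parts_list[OF nv \<phi>])
    show "(LINT x|lborel. conv bessel (conv bessel F) x * partials is \<phi> x) = (-1) ^ length is * (LINT x|lborel. y x * \<phi> x)"
      using LIMSEQ_unique[OF 1 2] by (simp add: \<psi>_def)
  qed
qed

section \<open>Classical derivatives are weak derivatives\<close>

lemma continuous_times_test_integrable:
  fixes f \<phi> :: "real ^ 'n::finite \<Rightarrow> real"
  assumes f: "continuous_on UNIV f" and \<phi>: "\<phi> \<in> test_functions"
  shows "integrable lborel (\<lambda>x. f x * \<phi> x)"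
proof -
  obtain R where R: "\<And>x. norm x > R \<Longrightarrow> \<phi> x = 0" using \<phi> by (auto simp: test_functions_iff)
  have "continuous_on (cball 0 R) (\<lambda>x. f x * \<phi> x)"
    by (intro continuous_intros continuous_on_subset[OF f] continuous_on_subset[OF smooth_continuous[OF test_functions_smooth[OF \<phi>]]]) auto
  then have "integrable lborel (\<lambda>x. indicator (cball 0 R) x *\<^sub>R (f x * \<phi> x))"
    by (intro borel_integrable_compact) auto
  moreover have "(\<lambda>x. indicator (cball 0 R) x *\<^sub>R (f x * \<phi> x)) = (\<lambda>x. f x * \<phi> x)"
    using R by (force simp: indicator_def)
  ultimately show ?thesis by simp
qed

lemma C_k_weak_derivative:
  fixes v \<phi> :: "real ^ 'n::finite \<Rightarrow> real"
  assumes "C_k (length is) v" and \<phi>: "\<phi> \<in> test_functions"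
  shows "(LINT x|lborel. v x * partials is \<phi> x) = (-1) ^ length is * (LINT x|lborel. partials (rev is) v x * \<phi> x)"
  using assms(1)
proof (induction "is" arbitrary: v)
  case (Cons i "is")
  have v: "C_k (Suc (length is)) v" using Cons.prems by simp
  have vd: "\<And>x. v differentiable (at x)" and vp: "C_k (length is) (partial i v)" using v by auto
  have t: "partials is \<phi> \<in> test_functions" "partial i (partials is \<phi>) \<in> test_functions"
    by (intro test_functions_partials test_functions_partial \<phi>)+
  have "(LINT x|lborel. partial i v x * partials is \<phi> x) = - (LINT x|lborel. v x * partial i (partials is \<phi>) x)"
    by (intro integration_by_parts continuous_times_test_integrable vd C_k_continuous[OF vp] C_k_continuous[OF v] t
        smooth_differentiable smooth_continuous test_functions_smooth)
  then show ?case using Cons.IH[OF vp] by (simp add: partials_append)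
qed simp

section \<open>Lebesgue measurable functions and their Borel representatives\<close>

text \<open>
  The convolution arguments use product measures and therefore Borel functions, whereas weak solutions
  are measurable for the completed measure only. The following lemmas pass between the two.
\<close>

lemma borel_representative:
  fixes f :: "real ^ 'n::finite \<Rightarrow> real"
  assumes "f \<in> borel_measurable lebesgue"
  obtains f' where "f' \<in> borel_measurable borel" "AE x in lebesgue. f x = f' x"
proof -
  obtain f' where "f' \<in> borel_measurable lborel" "AE x in lborel. f x = f' x"
    using completion_ex_borel_measurable_real[OF assms] by auto
  then show ?thesis using that by (auto intro: AE_completion)
qed

lemma lebesgue_integral_borel_representative:
  fixes f f' :: "real ^ 'n::finite \<Rightarrow> real"
  assumes f: "f \<in> borel_measurable lebesgue" and f': "f' \<in> borel_measurable borel" and eq: "AE x in lebesgue. f x = f' x"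
  shows "integrable lebesgue f \<longleftrightarrow> integrable lborel f'" "(LINT x|lebesgue. f x) = (LINT x|lborel. f' x)"
proof -
  have m: "f' \<in> borel_measurable lborel" "f' \<in> borel_measurable lebesgue"
    using f' by (auto intro: measurable_completion)
  show "integrable lebesgue f \<longleftrightarrow> integrable lborel f'"
    using integrable_cong_AE[OF f m(2) eq] integrable_completion[OF m(1)] by simp
  show "(LINT x|lebesgue. f x) = (LINT x|lborel. f' x)"
    using integral_cong_AE[OF f m(2) eq] integral_completion[OF m(1)] by simp
qed

lemma lebesgue_measurable_borel: "f \<in> borel_measurable borel \<Longrightarrow> f \<in> borel_measurable lebesgue"
  for f :: "real ^ 'n::finite \<Rightarrow> real"
  by (auto intro: measurable_completion)

lemma locally_integrableI:
  fixes f f' :: "real ^ 'n::finite \<Rightarrow> real"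
  assumes f: "f \<in> borel_measurable lebesgue" and f': "LpLinf 1 f'" and eq: "AE x in lebesgue. f x = f' x"
  shows "locally_integrable f"
  unfolding locally_integrable_def set_integrable_def
proof (intro allI impI)
  fix K :: "(real ^ 'n) set" assume K: "compact K"
  have [measurable]: "f' \<in> borel_measurable borel" "K \<in> sets borel"
    using f' K by (auto simp: LpLinf_def compact_imp_closed borel_closed)
  note [measurable] = f
  have "integrable lborel (indicator K :: real ^ 'n \<Rightarrow> real)"
    using emeasure_compact_finite[OF K] by (intro integrable_real_indicator) auto
  then have "integrable lborel (\<lambda>x. f' x * indicator K x)"
    by (rule LpLinf_1_times_integrable[OF f', of _ 1]) (auto simp: indicator_def)
  then have i: "integrable lborel (\<lambda>x. indicator K x *\<^sub>R f' x)" by (simp add: mult.commute)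
  show "integrable lebesgue (\<lambda>x. indicator K x *\<^sub>R f x)"
  proof (subst lebesgue_integral_borel_representative(1)[of _ "\<lambda>x. indicator K x *\<^sub>R f' x"])
    have "K \<in> sets lebesgue" using \<open>K \<in> sets borel\<close> by auto
    then show "(\<lambda>x. indicator K x *\<^sub>R f x) \<in> borel_measurable lebesgue" by (intro borel_measurable_scaleR borel_measurable_indicator f)
    show "AE x in lebesgue. indicator K x *\<^sub>R f x = indicator K x *\<^sub>R f' x" using eq by eventually_elim simp
  qed (use i in auto)
qed

lemma locally_integrable_times_test:
  fixes f :: "real ^ 'n::finite \<Rightarrow> real"
  assumes f: "locally_integrable f" and \<phi>: "\<phi> \<in> test_functions"
  shows "integrable lebesgue (\<lambda>x. f x * \<phi> x)"
proof -
  obtain R C where R: "0 < R" "\<And>x. norm x > R \<Longrightarrow> \<phi> x = 0" and C: "0 \<le> C" "\<And>x. \<bar>\<phi> x\<bar> \<le> C"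
    using test_functions_boundedE[OF \<phi>] by metis
  have "integrable lebesgue (\<lambda>x. indicator (cball 0 R) x *\<^sub>R f x)"
    using f unfolding locally_integrable_def set_integrable_def by (meson compact_cball)
  then have "integrable lebesgue (\<lambda>x. (indicator (cball 0 R) x *\<^sub>R f x) * \<phi> x)"
    by (rule integrable_times_bounded[where C=C])
      (use C in \<open>auto intro!: lebesgue_measurable_borel nice_measurable test_functions_nice \<phi>\<close>)
  moreover have "(\<lambda>x. (indicator (cball 0 R) x *\<^sub>R f x) * \<phi> x) = (\<lambda>x. f x * \<phi> x)"
    using R by (force simp: indicator_def)
  ultimately show ?thesis by simp
qed

lemma has_weak_derivI:
  fixes u u' y :: "real ^ 'n::finite \<Rightarrow> real"
  assumes u: "u \<in> borel_measurable lebesgue" and eq: "AE x in lebesgue. u x = u' x"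
    and u': "LpLinf 1 u'" and y: "LpLinf 1 y"
    and weak: "\<And>\<phi>. \<phi> \<in> test_functions \<Longrightarrow>
      (LINT x|lborel. u' x * partials is \<phi> x) = (-1) ^ length is * (LINT x|lborel. y x * \<phi> x)"
  shows "has_weak_deriv u is y"
  unfolding has_weak_deriv_def
proof (intro conjI ballI)
  have [measurable]: "u' \<in> borel_measurable borel" "y \<in> borel_measurable borel" using u' y by (auto simp: LpLinf_def)
  have yl: "y \<in> borel_measurable lebesgue" by (rule lebesgue_measurable_borel) measurable
  show "locally_integrable u" by (rule locally_integrableI[OF u u' eq])
  show "locally_integrable y" by (rule locally_integrableI[OF yl y]) simp
  fix \<phi> :: "real ^ 'n \<Rightarrow> real" assume \<phi>: "\<phi> \<in> test_functions"
  have [measurable]: "\<phi> \<in> borel_measurable borel" "partials is \<phi> \<in> borel_measurable borel"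
    by (intro nice_measurable nice_partials test_functions_nice \<phi>)+
  have "(LINT x|lebesgue. u x * partials is \<phi> x) = (LINT x|lborel. u' x * partials is \<phi> x)"
  proof (rule lebesgue_integral_borel_representative(2))
    show "(\<lambda>x. u x * partials is \<phi> x) \<in> borel_measurable lebesgue"
      by (intro borel_measurable_times u lebesgue_measurable_borel) measurable
    show "AE x in lebesgue. u x * partials is \<phi> x = u' x * partials is \<phi> x" using eq by eventually_elim simp
  qed measurable
  moreover have "(LINT x|lebesgue. y x * \<phi> x) = (LINT x|lborel. y x * \<phi> x)"
    by (rule lebesgue_integral_borel_representative(2)) (auto intro!: lebesgue_measurable_borel)
  ultimately show "(LINT x|lebesgue. u x * partials is \<phi> x) = (-1) ^ length is * (LINT x|lebesgue. y x * \<phi> x)"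
    using weak[OF \<phi>] by simp
qed

lemma Lp_2_iff:
  fixes f f' :: "real ^ 'n::finite \<Rightarrow> real"
  assumes f: "f \<in> borel_measurable lebesgue" and f': "f' \<in> borel_measurable borel" and eq: "AE x in lebesgue. f x = f' x"
  shows "f \<in> Lp 2 \<longleftrightarrow> integrable lborel (\<lambda>x. (f' x)\<^sup>2)"
proof -
  have "integrable lebesgue (\<lambda>x. \<bar>f x\<bar> powr 2) \<longleftrightarrow> integrable lborel (\<lambda>x. (f' x)\<^sup>2)"
  proof (rule lebesgue_integral_borel_representative(1))
    show "(\<lambda>x. \<bar>f x\<bar> powr 2) \<in> borel_measurable lebesgue" using f by measurable
    show "AE x in lebesgue. \<bar>f x\<bar> powr 2 = (f' x)\<^sup>2" using eq by eventually_elim simp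
  qed (use f' in measurable)
  moreover have "enn2real 2 = 2" using enn2real_ennreal[of 2] by simp
  ultimately show ?thesis using f by (simp add: Lp_def)
qed

lemma Lp_of_bounded_square_integrable:
  fixes f f' :: "real ^ 'n::finite \<Rightarrow> real"
  assumes f: "f \<in> borel_measurable lebesgue" and f': "f' \<in> borel_measurable borel" and eq: "AE x in lebesgue. f x = f' x"
    and C: "\<And>x. \<bar>f' x\<bar> \<le> C" and int: "integrable lborel (\<lambda>x. (f' x)\<^sup>2)" and s: "2 \<le> s"
  shows "f \<in> Lp s"
proof (cases "s = \<infinity>")
  case True
  have "AE x in lebesgue. \<bar>f x\<bar> \<le> C" using eq by eventually_elim (simp add: C)
  then show ?thesis using True f by (auto simp: Lp_def)
next
  case False
  define p where "p = enn2real s"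
  have "ennreal 2 \<le> ennreal p" using s False by (simp add: p_def less_top)
  then have p: "2 \<le> p" by (simp add: ennreal_le_iff2)
  note [measurable] = f'
  have C0: "0 \<le> C" using C[of 0] by simp
  have "integrable lborel (\<lambda>x. \<bar>f' x\<bar> powr p)"
  proof (rule Bochner_Integration.integrable_bound)
    show "integrable lborel (\<lambda>x. C powr (p - 2) * (f' x)\<^sup>2)" using int by simp
    show "AE x in lborel. norm (\<bar>f' x\<bar> powr p) \<le> norm (C powr (p - 2) * (f' x)\<^sup>2)"
    proof (intro AE_I2)
      fix x
      have "\<bar>f' x\<bar> powr p = \<bar>f' x\<bar> powr (p - 2) * \<bar>f' x\<bar> powr 2" by (simp only: powr_add[symmetric]) simp
      also have "\<dots> \<le> C powr (p - 2) * \<bar>f' x\<bar> powr 2"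
        using p C by (intro mult_right_mono powr_mono2) auto
      finally show "norm (\<bar>f' x\<bar> powr p) \<le> norm (C powr (p - 2) * (f' x)\<^sup>2)" by simp
    qed
  qed measurable
  moreover have "integrable lebesgue (\<lambda>x. \<bar>f x\<bar> powr p) \<longleftrightarrow> integrable lborel (\<lambda>x. \<bar>f' x\<bar> powr p)"
  proof (rule lebesgue_integral_borel_representative(1))
    show "(\<lambda>x. \<bar>f x\<bar> powr p) \<in> borel_measurable lebesgue" using f by measurable
    show "AE x in lebesgue. \<bar>f x\<bar> powr p = \<bar>f' x\<bar> powr p" using eq by eventually_elim simp
  qed measurable
  ultimately show ?thesis using f False by (simp add: Lp_def p_def)
qed

text \<open>
  Replace \<open>u\<close> by approximations with countably many values and use the continuity in the second
  argument.
\<close>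

lemma caratheodory_measurable:
  fixes g :: "'a \<Rightarrow> real \<Rightarrow> real"
  assumes g: "\<And>t. (\<lambda>x. g x t) \<in> borel_measurable M" and c: "\<And>x. continuous_on UNIV (g x)"
    and [measurable]: "u \<in> borel_measurable M"
  shows "(\<lambda>x. g x (u x)) \<in> borel_measurable M"
proof (rule borel_measurable_LIMSEQ_real)
  define s where "s n x = real_of_int \<lfloor>real (Suc n) * u x\<rfloor> / real (Suc n)" for n x
  show "(\<lambda>x. g x (s n x)) \<in> borel_measurable M" for n
    unfolding s_def
    by (rule measurable_compose_countable[of "\<lambda>j x. g x (real_of_int j / real (Suc n))"]) (use g in auto)
  fix x
  have "(\<lambda>n. s n x - u x) \<longlonglongrightarrow> 0"
  proof (rule Lim_null_comparison[OF _ LIMSEQ_Suc[OF lim_1_over_n]], intro always_eventually allI)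
    fix n
    have "s n x - u x = (real_of_int \<lfloor>real (Suc n) * u x\<rfloor> - real (Suc n) * u x) / real (Suc n)"
      by (simp add: s_def diff_divide_distrib del: of_nat_Suc)
    also have "\<bar>\<dots>\<bar> \<le> 1 / real (Suc n)"
      unfolding abs_divide by (intro frac_le) linarith+
    finally show "norm (s n x - u x) \<le> 1 / real (Suc n)" by simp
  qed
  then have "(\<lambda>n. s n x) \<longlonglongrightarrow> u x" by (rule LIM_zero_cancel)
  moreover have "isCont (g x) (u x)" using c[of x] continuous_on_eq_continuous_at[OF open_UNIV, of "g x"] by blast
  ultimately show "(\<lambda>n. g x (s n x)) \<longlonglongrightarrow> g x (u x)" using isCont_tendsto_compose[of "u x" "g x"] by blast
qed

lemma test_functions_add:
  assumes "v \<in> test_functions" "w \<in> test_functions" shows "(\<lambda>x. v x + w x) \<in> test_functions"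
proof -
  obtain R S where "\<And>x. norm x > R \<Longrightarrow> v x = 0" "\<And>x. norm x > S \<Longrightarrow> w x = 0" using assms by (auto simp: test_functions_iff)
  then have "\<forall>x. norm x > max R S \<longrightarrow> v x + w x = 0" by simp
  then show ?thesis using assms unfolding test_functions_iff smooth_def by (blast intro: C_k_add)
qed

lemma test_functions_sum:
  "(\<And>i. i \<in> A \<Longrightarrow> f i \<in> test_functions) \<Longrightarrow> (\<lambda>x. \<Sum>i\<in>A. f i x) \<in> test_functions"
proof (induction A rule: infinite_finite_induct)
  case (insert a A)
  then show ?case by (simp add: test_functions_add)
qed (auto simp: test_functions_iff smooth_const)

lemma test_functions_laplacian: "v \<in> test_functions \<Longrightarrow> laplacian v \<in> test_functions"
  unfolding laplacian_def[abs_def] by (intro test_functions_sum test_functions_partials)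

section \<open>Iterated Bessel potentials\<close>

definition L2Linf :: "(real ^ 'n::finite \<Rightarrow> real) \<Rightarrow> bool" where
  "L2Linf f \<longleftrightarrow> f \<in> borel_measurable borel \<and> (\<exists>C. \<forall>x. \<bar>f x\<bar> \<le> C) \<and> integrable lborel (\<lambda>x. (f x)\<^sup>2)"

lemma L2Linf_conv:
  fixes K f :: "real ^ 'n::finite \<Rightarrow> real"
  assumes K: "integrable lborel K" and f: "L2Linf f"
  shows "L2Linf (conv K f)" "continuous_on UNIV (conv K f)" "(conv K f \<longlongrightarrow> 0) at_infinity"
proof -
  obtain C where fm: "f \<in> borel_measurable borel" and C: "\<And>x. \<bar>f x\<bar> \<le> C" and f2: "integrable lborel (\<lambda>x. (f x)\<^sup>2)"
    using f by (auto simp: L2Linf_def)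
  have "K \<in> borel_measurable borel" using K borel_measurable_integrable by auto
  then have "conv K f \<in> borel_measurable borel" using fm by measurable
  then show "L2Linf (conv K f)"
    using conv_square_integrable[OF K fm f2] conv_bound[OF K fm C] by (auto simp: L2Linf_def)
  show "continuous_on UNIV (conv K f)" by (rule continuous_conv_bounded[OF K fm C])
  show "(conv K f \<longlongrightarrow> 0) at_infinity" by (rule conv_vanishes_at_infinity[OF K fm C f2])
qed

lemma conv_bessel_derivatives:
  fixes f :: "real ^ 'n::finite \<Rightarrow> real"
  assumes "L2Linf f"
  shows "conv bessel f differentiable (at x)" "partial i (conv bessel f) = conv (dbessel i) f"
proof -
  obtain C where C: "f \<in> borel_measurable borel" "\<And>x. \<bar>f x\<bar> \<le> C" using assms by (auto simp: L2Linf_def)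
  show "conv bessel f differentiable (at x)"
    using conv_bessel_has_derivative[OF C] by (auto simp: differentiable_def)
  show "partial i (conv bessel f) = conv (dbessel i) f" by (rule partial_conv_bessel[OF C])
qed

text \<open>
  One derivative is put on each of the two kernels, so only integrable kernels occur.
\<close>

lemma double_bessel_partials:
  fixes F :: "real ^ 'n::finite \<Rightarrow> real"
  assumes F: "L2Linf F"
  shows "partial i (conv bessel (conv bessel F)) = conv bessel (conv (dbessel i) F)"
    and "partial j (conv bessel (conv (dbessel i) F)) = conv (dbessel j) (conv (dbessel i) F)"
proof -
  obtain C where C: "F \<in> borel_measurable borel" "\<And>x. \<bar>F x\<bar> \<le> C" using F by (auto simp: L2Linf_def)
  show "partial i (conv bessel (conv bessel F)) = conv bessel (conv (dbessel i) F)"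
    using conv_left_commute[OF integrable_dbessel integrable_bessel C]
    by (simp add: conv_bessel_derivatives(2)[OF L2Linf_conv(1)[OF integrable_bessel F]] fun_eq_iff)
  show "partial j (conv bessel (conv (dbessel i) F)) = conv (dbessel j) (conv (dbessel i) F)"
    by (rule conv_bessel_derivatives(2)[OF L2Linf_conv(1)[OF integrable_dbessel F]])
qed

lemma double_bessel_regularity:
  fixes F :: "real ^ 'n::finite \<Rightarrow> real"
  assumes F: "L2Linf F"
  defines "U \<equiv> conv bessel (conv bessel F)"
  shows "C_k 2 U" "(U \<longlongrightarrow> 0) at_infinity" "(laplacian U \<longlongrightarrow> 0) at_infinity"
    "length is \<le> 2 \<Longrightarrow> L2Linf (partials is U)"
proof -
  note L = L2Linf_conv[OF integrable_bessel] L2Linf_conv[OF integrable_dbessel]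
  show "C_k 2 U"
    unfolding numeral_2_eq_2 C_k.simps U_def
    by (simp only: double_bessel_partials[OF F]) (intro conjI allI conv_bessel_derivatives(1) L F)
  show "(U \<longlongrightarrow> 0) at_infinity" unfolding U_def by (intro L F)
  have "((\<lambda>x. \<Sum>i\<in>UNIV. partials [i, i] U x) \<longlongrightarrow> (\<Sum>i\<in>(UNIV::'n set). 0)) at_infinity"
    unfolding U_def partials_Cons partials_Nil double_bessel_partials[OF F]
    by (intro tendsto_sum L F)
  then show "(laplacian U \<longlongrightarrow> 0) at_infinity" by (simp add: laplacian_def[abs_def])
  assume "length is \<le> 2"
  then consider "is = []" | i where "is = [i]" | i j where "is = [i, j]"
    by (cases "is" rule: list.exhaust[case_names n c]; cases "tl is") (auto simp: numeral_2_eq_2 le_Suc_eq)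
  then show "L2Linf (partials is U)"
    by cases (auto simp: U_def double_bessel_partials[OF F] intro!: L F)
qed

section \<open>Weak solutions of the fourth-order equation\<close>

lemma square_integrable_add:
  fixes f g :: "'a \<Rightarrow> real"
  assumes "f \<in> borel_measurable M" "g \<in> borel_measurable M"
    "integrable M (\<lambda>x. (f x)\<^sup>2)" "integrable M (\<lambda>x. (g x)\<^sup>2)"
  shows "integrable M (\<lambda>x. (f x + g x)\<^sup>2)"
  using square_integrable_times[OF assms] assms(3,4) by (simp add: power2_sum mult.assoc)

lemma square_integrable_sum:
  fixes f :: "'i \<Rightarrow> 'a \<Rightarrow> real"
  assumes "\<And>i. i \<in> A \<Longrightarrow> f i \<in> borel_measurable M" "\<And>i. i \<in> A \<Longrightarrow> integrable M (\<lambda>x. (f i x)\<^sup>2)"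
  shows "integrable M (\<lambda>x. (\<Sum>i\<in>A. f i x)\<^sup>2)"
  using assms
proof (induction A rule: infinite_finite_induct)
  case (insert a A)
  then show ?case by (simp add: square_integrable_add)
qed auto

text \<open>
  The chosen function \<open>weak_laplacian u\<close> enters only through its integrals against test functions, and
  these agree with those of the sum \<open>L\<close> of square-integrable weak second derivatives.
\<close>

lemma weak_laplacian_square_integrable:
  fixes u :: "real ^ 'n::finite \<Rightarrow> real"
  assumes u: "u \<in> sobolev_H 2" and U: "U \<in> borel_measurable borel" "AE x in lebesgue. u x = U x"
  obtains L where "L \<in> borel_measurable borel" "integrable lborel (\<lambda>x. (L x)\<^sup>2)"
    "\<And>\<phi>. \<phi> \<in> test_functions \<Longrightarrow> (LINT x|lborel. U x * laplacian \<phi> x) = (LINT x|lborel. L x * \<phi> x)"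
    "\<And>\<phi>. \<phi> \<in> test_functions \<Longrightarrow> (LINT x|lebesgue. weak_laplacian u x * \<phi> x) = (LINT x|lborel. L x * \<phi> x)"
proof -
  have "\<forall>i. \<exists>w\<in>Lp 2. has_weak_deriv u [i, i] w" using u by (auto simp: sobolev_def)
  then obtain w where w: "\<And>i. w i \<in> Lp 2" "\<And>i. has_weak_deriv u [i, i] (w i)" by metis
  have wl: "w i \<in> borel_measurable lebesgue" for i using w(1) by (auto simp: Lp_def)
  have ul: "u \<in> borel_measurable lebesgue" using u by (auto simp: sobolev_def Lp_def)
  have "\<exists>W. W \<in> borel_measurable borel \<and> (AE x in lebesgue. w i x = W x)" for i
    using borel_representative[OF wl] by metis
  then obtain W where W: "\<And>i. W i \<in> borel_measurable borel" "\<And>i. AE x in lebesgue. w i x = W i x" by metis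
  have W2: "integrable lborel (\<lambda>x. (W i x)\<^sup>2)" for i using Lp_2_iff[OF wl W] w(1) by blast
  have "integrable lborel (\<lambda>x. (U x)\<^sup>2)" using Lp_2_iff[OF ul U] u by (auto simp: sobolev_def)
  then have U1: "LpLinf 1 U" by (intro LpLinf_1_of_square_integrable U)
  have W1: "LpLinf 1 (W i)" for i by (intro LpLinf_1_of_square_integrable W W2)
  have toW: "(LINT x|lebesgue. w i x * \<phi> x) = (LINT x|lborel. W i x * \<phi> x)" if \<phi>: "\<phi> \<in> test_functions" for i \<phi>
  proof (rule lebesgue_integral_borel_representative(2))
    have m: "\<phi> \<in> borel_measurable borel" by (intro nice_measurable test_functions_nice \<phi>)
    show "(\<lambda>x. w i x * \<phi> x) \<in> borel_measurable lebesgue" using lebesgue_measurable_borel[OF m] wl by measurable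
    show "(\<lambda>x. W i x * \<phi> x) \<in> borel_measurable borel" using m W by measurable
    show "AE x in lebesgue. w i x * \<phi> x = W i x * \<phi> x" using W(2)[of i] by eventually_elim simp
  qed
  define L where "L x = (\<Sum>i\<in>UNIV. W i x)" for x
  show ?thesis
  proof (rule that[of L])
    show "L \<in> borel_measurable borel" unfolding L_def[abs_def] by (intro borel_measurable_sum W)
    show "integrable lborel (\<lambda>x. (L x)\<^sup>2)" unfolding L_def using W W2 by (intro square_integrable_sum) auto
    fix \<phi> :: "real ^ 'n \<Rightarrow> real" assume \<phi>: "\<phi> \<in> test_functions"
    have Li: "(LINT x|lborel. L x * \<phi> x) = (\<Sum>i\<in>UNIV. LINT x|lborel. W i x * \<phi> x)"
      unfolding L_def sum_distrib_right
      by (intro Bochner_Integration.integral_sum LpLinf_1_times_nice W1 test_functions_nice \<phi>)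
    have eqi: "(LINT x|lborel. U x * partials [i, i] \<phi> x) = (LINT x|lborel. W i x * \<phi> x)" for i
    proof -
      have m: "partials [i, i] \<phi> \<in> borel_measurable borel"
        by (intro nice_measurable nice_partials test_functions_nice \<phi>)
      have "(LINT x|lebesgue. u x * partials [i, i] \<phi> x) = (LINT x|lborel. U x * partials [i, i] \<phi> x)"
      proof (rule lebesgue_integral_borel_representative(2))
        show "(\<lambda>x. u x * partials [i, i] \<phi> x) \<in> borel_measurable lebesgue" using lebesgue_measurable_borel[OF m] ul by measurable
        show "(\<lambda>x. U x * partials [i, i] \<phi> x) \<in> borel_measurable borel" using m U by measurable
        show "AE x in lebesgue. u x * partials [i, i] \<phi> x = U x * partials [i, i] \<phi> x" using U(2) by eventually_elim simp
      qed
      moreover have "(LINT x|lebesgue. u x * partials [i, i] \<phi> x) = (LINT x|lebesgue. w i x * \<phi> x)"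
        using w(2)[of i] \<phi> by (simp add: has_weak_deriv_def)
      ultimately show ?thesis using toW[OF \<phi>] by simp
    qed
    have "(LINT x|lborel. U x * laplacian \<phi> x) = (\<Sum>i\<in>UNIV. LINT x|lborel. U x * partials [i, i] \<phi> x)"
      unfolding laplacian_def sum_distrib_left
      by (intro Bochner_Integration.integral_sum LpLinf_1_times_nice U1 nice_partials test_functions_nice \<phi>)
    then show "(LINT x|lborel. U x * laplacian \<phi> x) = (LINT x|lborel. L x * \<phi> x)"
      using eqi Li by simp
    have wd: "has_weak_deriv u [i, i] (weak_deriv [i, i] u)" for i
      unfolding weak_deriv_def by (rule someI[of _ "w i"]) (rule w)
    have "(LINT x|lebesgue. weak_laplacian u x * \<phi> x) = (\<Sum>i\<in>UNIV. LINT x|lebesgue. weak_deriv [i, i] u x * \<phi> x)"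
      unfolding weak_laplacian_def sum_distrib_right
      using wd by (intro Bochner_Integration.integral_sum locally_integrable_times_test \<phi>) (auto simp: has_weak_deriv_def)
    also have "\<dots> = (\<Sum>i\<in>UNIV. LINT x|lebesgue. w i x * \<phi> x)"
      using wd w(2) \<phi> by (auto simp: has_weak_deriv_def intro!: sum.cong)
    finally show "(LINT x|lebesgue. weak_laplacian u x * \<phi> x) = (LINT x|lborel. L x * \<phi> x)"
      using toW[OF \<phi>] Li by simp
  qed
qed

text \<open>
  The lower bound on \<open>t\<close> is the condition for a gain in \<open>nonlinearity_LpLinf\<close> at \<open>\<rho> = 1/2\<close>, and \<open>t < 2/N\<close>
  is the condition of \<open>bessel_Lq\<close>. They are compatible if and only if \<open>\<sigma> (N - 4) < 8\<close>, which is the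
  subcritical growth condition for \<open>N \<ge> 5\<close> and automatic for \<open>N \<le> 4\<close>.
\<close>

lemma subcritical_gain:
  fixes \<sigma> :: real
  assumes \<sigma>: "0 < \<sigma>" and sub: "CARD('n::finite) \<ge> 5 \<Longrightarrow> \<sigma> + 1 < (real CARD('n) + 4) / (real CARD('n) - 4)"
  obtains t :: real where "0 < t" "t < 1/2" "t * CARD('n) < 2" "\<sigma> / 2 < (\<sigma> + 2) * t"
proof -
  define N where "N = real CARD('n)"
  have N: "1 \<le> N" by (simp add: N_def)
  have lt: "\<sigma> * N < 4 * (\<sigma> + 2)"
  proof (cases "CARD('n) \<ge> 5")
    case True
    then have N5: "5 \<le> N" by (simp add: N_def)
    have "\<sigma> + 1 < (N + 4) / (N - 4)" using sub[OF True] by (simp add: N_def)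
    then have "(\<sigma> + 1) * (N - 4) < N + 4" using N5 by (simp add: pos_less_divide_eq)
    then show ?thesis by (simp add: algebra_simps)
  next
    case False
    then have "N \<le> 4" by (simp add: N_def)
    then have "\<sigma> * N \<le> \<sigma> * 4" using \<sigma> by (intro mult_left_mono) auto
    then show ?thesis by simp
  qed
  have "\<sigma> / (2 * (\<sigma> + 2)) < min (2 / N) (1/2)"
    using lt \<sigma> N by (simp add: field_simps)
  then obtain t where t: "\<sigma> / (2 * (\<sigma> + 2)) < t" "t < min (2 / N) (1/2)" using dense by blast
  show ?thesis
  proof (rule that[of t])
    have "0 < \<sigma> / (2 * (\<sigma> + 2))" using \<sigma> by simp
    then show "0 < t" using t by linarith
    show "t < 1/2" using t by simp
    show "t * CARD('n) < 2" using t N by (simp add: N_def field_simps)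
    show "\<sigma> / 2 < (\<sigma> + 2) * t" using t(1) \<sigma> by (simp add: field_simps)
  qed
qed

theorem theorem1p1:
  fixes a b\<^sub>1 b\<^sub>2 u :: "real ^ 'n::finite \<Rightarrow> real"
    and g :: "real ^ 'n \<Rightarrow> real \<Rightarrow> real"
    and \<sigma> \<delta> k :: real
  assumes g_measurable: "\<And>t. (\<lambda>x. g x t) \<in> borel_measurable lebesgue"
    and g_continuous: "\<And>x. continuous_on UNIV (g x)"
    and g_bounded: "\<And>M. M > 0 \<Longrightarrow> bdd_above {\<bar>g x t\<bar> | x t. 0 \<le> t \<and> t \<le> M}"
    and exponents: "\<sigma> > \<delta>" "\<delta> > 0"
    and b_Linfty: "b\<^sub>1 \<in> Lp \<infinity>" "b\<^sub>2 \<in> Lp \<infinity>"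
    and g_growth: "AE x in lebesgue. \<forall>t. \<bar>g x t\<bar> \<le> b\<^sub>1 x * \<bar>t\<bar> powr (\<delta> + 1) + b\<^sub>2 x * \<bar>t\<bar> powr (\<sigma> + 1)"
    and k_pos: "k > 0"
    and a_limit: "(a \<longlongrightarrow> k\<^sup>2) at_infinity"
    and a_Lp: "(\<lambda>x. k\<^sup>2 - a x) \<in> Lp 2 \<inter> Lp \<infinity>"
    and subcritical: "CARD('n) \<ge> 5 \<Longrightarrow> \<sigma> + 1 < (real CARD('n) + 4) / (real CARD('n) - 4)"
    and sol: "weak_solution a g u"
  shows "u \<in> sobolev_H 4 \<and> (\<forall>s::ennreal. 2 \<le> s \<longrightarrow> u \<in> sobolev 2 s) \<and>
    (\<exists>u'. (AE x in lebesgue. u' x = u x) \<and> C_k 2 u' \<and>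
       (u' \<longlongrightarrow> 0) at_infinity \<and> (laplacian u' \<longlongrightarrow> 0) at_infinity)"
proof -
  have \<sigma>: "0 < \<sigma>" using exponents by simp
  obtain t :: real where t: "0 < t" "t < 1/2" "t * CARD('n) < 2" "\<sigma> / 2 < (\<sigma> + 2) * t"
    by (rule subcritical_gain[OF \<sigma> subcritical]) (assumption, rule that)
  have uH: "u \<in> sobolev_H 2" using sol by (simp add: weak_solution_def)
  then have u2: "u \<in> Lp 2" and ul: "u \<in> borel_measurable lebesgue" by (auto simp: sobolev_def Lp_def)
  obtain U where U: "U \<in> borel_measurable borel" "AE x in lebesgue. u x = U x"
    using borel_representative[OF ul] by blast
  have U2: "integrable lborel (\<lambda>x. (U x)\<^sup>2)" using Lp_2_iff[OF ul U] u2 by blast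
  obtain L where L: "L \<in> borel_measurable borel" "integrable lborel (\<lambda>x. (L x)\<^sup>2)"
    and UL: "\<And>\<phi>. \<phi> \<in> test_functions \<Longrightarrow> (LINT x|lborel. U x * laplacian \<phi> x) = (LINT x|lborel. L x * \<phi> x)"
    and uL: "\<And>\<phi>. \<phi> \<in> test_functions \<Longrightarrow> (LINT x|lebesgue. weak_laplacian u x * \<phi> x) = (LINT x|lborel. L x * \<phi> x)"
    using weak_laplacian_square_integrable[OF uH U] by blast
  have al: "a \<in> borel_measurable lebesgue"
  proof -
    have "(\<lambda>x. k\<^sup>2 - a x) \<in> borel_measurable lebesgue" using a_Lp by (auto simp: Lp_def)
    then have "(\<lambda>x. k\<^sup>2 - (k\<^sup>2 - a x)) \<in> borel_measurable lebesgue" by (rule borel_measurable_diff[OF borel_measurable_const])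
    then show ?thesis by simp
  qed
  obtain a' where a': "a' \<in> borel_measurable borel" "AE x in lebesgue. a x = a' x"
    using borel_representative[OF al] by blast
  obtain A0 where A0: "AE x in lebesgue. \<bar>k\<^sup>2 - a x\<bar> \<le> A0" using a_Lp by (auto simp: Lp_def)
  have a'b: "AE x in lborel. \<bar>a' x\<bar> \<le> \<bar>A0\<bar> + k\<^sup>2"
  proof -
    have "AE x in lebesgue. \<bar>a' x\<bar> \<le> \<bar>A0\<bar> + k\<^sup>2" 
      using A0 a'(2)
    proof eventually_elim
      case (elim x)
      then show ?case using zero_le_power2[of k] by linarith
    qed
    then show ?thesis by (simp add: AE_completion_iff)
  qed
  have gl: "(\<lambda>x. g x (u x)) \<in> borel_measurable lebesgue"
    by (rule caratheodory_measurable[OF g_measurable g_continuous ul])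
  obtain G where G: "G \<in> borel_measurable borel" "AE x in lebesgue. g x (u x) = G x"
    using borel_representative[OF gl] by blast
  obtain B1 B2 where B: "AE x in lebesgue. \<bar>b\<^sub>1 x\<bar> \<le> B1" "AE x in lebesgue. \<bar>b\<^sub>2 x\<bar> \<le> B2"
    using b_Linfty by (auto simp: Lp_def)
  define D where "D = \<bar>B1\<bar> + \<bar>B2\<bar>"
  have D: "0 \<le> D" "\<bar>B1\<bar> \<le> D" by (auto simp: D_def)
  have Gb: "AE x in lborel. \<bar>G x\<bar> \<le> D * \<bar>U x\<bar> + D * \<bar>U x\<bar> powr (\<sigma> + 1)"
  proof -
    have "AE x in lebesgue. \<bar>G x\<bar> \<le> D * \<bar>U x\<bar> + D * \<bar>U x\<bar> powr (\<sigma> + 1)"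
      using B G(2) U(2) g_growth
    proof eventually_elim
      case (elim x)
      let ?p = "\<bar>U x\<bar> powr (\<delta> + 1)" and ?q = "\<bar>U x\<bar> powr (\<sigma> + 1)"
      have pq: "?p \<le> \<bar>U x\<bar> + ?q"
      proof (cases "\<bar>U x\<bar> \<le> 1")
        case True
        then have "\<bar>U x\<bar> powr (\<delta> + 1) \<le> \<bar>U x\<bar> powr 1" using exponents by (intro powr_mono') auto
        then show ?thesis by (simp add: add_increasing2)
      next
        case False
        then have "\<bar>U x\<bar> powr (\<delta> + 1) \<le> \<bar>U x\<bar> powr (\<sigma> + 1)" using exponents by (intro powr_mono) auto
        then show ?thesis by simp
      qed
      have "\<bar>G x\<bar> \<le> b\<^sub>1 x * ?p + b\<^sub>2 x * ?q" using elim(3,4) elim(5)[rule_format, of "u x"] by simp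
      also have "\<dots> \<le> \<bar>B1\<bar> * ?p + \<bar>B2\<bar> * ?q"
        using elim(1,2) by (intro add_mono mult_right_mono) auto
      also have "\<dots> \<le> \<bar>B1\<bar> * (\<bar>U x\<bar> + ?q) + \<bar>B2\<bar> * ?q"
        using pq by (intro add_mono mult_left_mono) auto
      also have "\<dots> = \<bar>B1\<bar> * \<bar>U x\<bar> + D * ?q" by (simp add: D_def algebra_simps)
      also have "\<dots> \<le> D * \<bar>U x\<bar> + D * ?q" using D by (intro add_mono mult_right_mono) auto
      finally show ?case .
    qed
    then show ?thesis by (simp add: AE_completion_iff)
  qed
  \<comment> \<open>\<open>w = u - \<Delta>u\<close>, so that \<open>(1 - \<Delta>) u = w\<close> and \<open>(1 - \<Delta>) w =
    F\<close> with the \<open>F\<close> below.\<close>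
  define w where "w x = U x - L x" for x
  define F where "F x = 2 * w x + ((-1 - a' x) * U x + G x)" for x
  note [measurable] = U(1) L(1) a'(1) G(1)
  have wm [measurable]: "w \<in> borel_measurable borel" unfolding w_def[abs_def] by measurable
  have Fm [measurable]: "F \<in> borel_measurable borel" unfolding F_def[abs_def] by measurable
  have w2: "integrable lborel (\<lambda>x. (w x)\<^sup>2)"
    unfolding w_def by (rule square_integrable_diff) (use U2 L(2) in auto)
  have w1: "LpLinf 1 w" and U1: "LpLinf 1 U" and L1: "LpLinf 1 L"
    using w2 U2 L(2) by (auto intro!: LpLinf_1_of_square_integrable)
  define A where "A = 1 + \<bar>A0\<bar> + k\<^sup>2 + D"
  have A: "0 \<le> A" "D \<le> A" using D by (auto simp: A_def)
  have a1: "AE x in lborel. \<bar>-1 - a' x\<bar> \<le> 1 + \<bar>A0\<bar> + k\<^sup>2" using a'b by eventually_elim auto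
  have Fb: "AE x in lborel. \<bar>F x\<bar> \<le> 2 * \<bar>w x\<bar> + A * \<bar>U x\<bar> + A * \<bar>U x\<bar> powr (\<sigma> + 1)"
    using a1 Gb
  proof eventually_elim
    case (elim x)
    have "\<bar>(-1 - a' x) * U x\<bar> \<le> (1 + \<bar>A0\<bar> + k\<^sup>2) * \<bar>U x\<bar>"
      unfolding abs_mult using elim(1) by (intro mult_right_mono) auto
    moreover have "D * \<bar>U x\<bar> powr (\<sigma> + 1) \<le> A * \<bar>U x\<bar> powr (\<sigma> + 1)" using A by (intro mult_right_mono) auto
    moreover have "A * \<bar>U x\<bar> = (1 + \<bar>A0\<bar> + k\<^sup>2) * \<bar>U x\<bar> + D * \<bar>U x\<bar>" by (simp add: A_def algebra_simps)
    moreover have "\<bar>F x\<bar> \<le> 2 * \<bar>w x\<bar> + \<bar>(-1 - a' x) * U x\<bar> + \<bar>G x\<bar>" unfolding F_def by linarith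
    ultimately show ?case using elim(2) by linarith
  qed
  have Uw: "AE x in lborel. U x = conv bessel w x"
  proof (rule bessel_potential_of_weak_helmholtz[OF U1 w1])
    fix \<phi> :: "real ^ 'n \<Rightarrow> real" assume \<phi>: "\<phi> \<in> test_functions"
    have n: "nice \<phi>" "nice (laplacian \<phi>)" using \<phi> by (auto intro: test_functions_nice test_functions_laplacian)
    show "(LINT x|lborel. U x * (\<phi> x - laplacian \<phi> x)) = (LINT x|lborel. w x * \<phi> x)"
      using UL[OF \<phi>] by (simp add: w_def right_diff_distrib left_diff_distrib LpLinf_1_times_nice U1 L1 n)
  qed
  have w22: "LpLinf 2 w" by (rule LpLinf_of_square_integrable[OF wm w2])
  \<comment> \<open>One use of \<open>u = B * w\<close> puts the nonlinear term into \<open>L\<^sup>1 +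
    L\<^sup>\<infinity>\<close>, where the second equation of the system can be inverted.\<close>
  have G1: "LpLinf 1 G"
  proof -
    define k' where "k' = min t ((\<sigma> + 2) * t - \<sigma> / 2)"
    have k': "0 < k'" "k' \<le> t" "k' \<le> (\<sigma> + 2) * t - \<sigma> / 2" using t by (auto simp: k'_def)
    have Lq: "integrable lborel (\<lambda>x. \<bar>bessel (x :: real ^ 'n)\<bar> powr (1 / (1 - t)))" by (rule bessel_Lq) (use t in auto)
    have "LpLinf (1 / (1/2 - t)) (conv bessel w)"
      by (rule LpLinf_conv[OF integrable_bessel Lq]) (use w22 t in auto)
    then have Ut: "LpLinf (1 / (1/2 - t)) U" by (rule LpLinf_mono_AE) (use Uw t in auto)
    have "LpLinf (1 / (1/2 - k' + t)) G"
    proof (rule nonlinearity_LpLinf[OF G(1) _ A(1) _ Ut \<sigma> t(1) t(2) order_refl k'(2,3)])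
      show "LpLinf (1 / (1/2)) w" using w22 by simp
      show "AE x in lborel. \<bar>G x\<bar> \<le> 2 * \<bar>w x\<bar> + A * \<bar>U x\<bar> + A * \<bar>U x\<bar> powr (\<sigma> + 1)"
        using Gb
      proof eventually_elim
        case (elim x)
        have "D * \<bar>U x\<bar> \<le> A * \<bar>U x\<bar>" "D * \<bar>U x\<bar> powr (\<sigma> + 1) \<le> A * \<bar>U x\<bar> powr (\<sigma> + 1)"
          using A by (auto intro!: mult_right_mono)
        then show ?case using elim abs_ge_zero[of "w x"] by linarith
      qed
    qed
    then show ?thesis by (rule LpLinf_antimono) (use k' t in auto)
  qed
  have aU1: "LpLinf 1 (\<lambda>x. (-1 - a' x) * U x)" by (rule LpLinf_mult_bounded[OF U1 _ a1]) auto
  have w1': "LpLinf 1 (\<lambda>x. 2 * w x)" by (rule LpLinf_cmult[OF w1]) simp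
  have F1: "LpLinf 1 F"
    unfolding F_def[abs_def] by (intro LpLinf_add w1' aU1 G1) auto
  have wF: "AE x in lborel. w x = conv bessel F x"
  proof (rule bessel_potential_of_weak_helmholtz[OF w1 F1])
    fix \<phi> :: "real ^ 'n \<Rightarrow> real" assume \<phi>: "\<phi> \<in> test_functions"
    have \<Delta>\<phi>: "laplacian \<phi> \<in> test_functions" by (rule test_functions_laplacian[OF \<phi>])
    have n: "nice \<phi>" "nice (laplacian \<phi>)" using \<phi> \<Delta>\<phi> by (auto intro: test_functions_nice)
    have \<phi>m [measurable]: "\<phi> \<in> borel_measurable borel" by (rule nice_measurable[OF n(1)])
    have \<phi>l: "\<phi> \<in> borel_measurable lebesgue" by (rule lebesgue_measurable_borel[OF \<phi>m])
    have 1: "(LINT x|lebesgue. a x * u x * \<phi> x) = (LINT x|lborel. a' x * U x * \<phi> x)"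
    proof (rule lebesgue_integral_borel_representative(2))
      show "(\<lambda>x. a x * u x * \<phi> x) \<in> borel_measurable lebesgue" using al ul \<phi>l by measurable
      show "AE x in lebesgue. a x * u x * \<phi> x = a' x * U x * \<phi> x" using a'(2) U(2) by eventually_elim simp
    qed measurable
    have 2: "(LINT x|lebesgue. g x (u x) * \<phi> x) = (LINT x|lborel. G x * \<phi> x)"
    proof (rule lebesgue_integral_borel_representative(2))
      show "(\<lambda>x. g x (u x) * \<phi> x) \<in> borel_measurable lebesgue" using gl \<phi>l by measurable
      show "AE x in lebesgue. g x (u x) * \<phi> x = G x * \<phi> x" using G(2) by eventually_elim simp
    qed measurable
    have "(LINT x|lebesgue. weak_laplacian u x * laplacian \<phi> x) + (LINT x|lebesgue. a x * u x * \<phi> x)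
        = (LINT x|lebesgue. g x (u x) * \<phi> x)"
      using sol \<phi> by (simp add: weak_solution_def)
    \<comment> \<open>The equation, with all functions replaced by Borel representatives.\<close>
    then have eq: "(LINT x|lborel. L x * laplacian \<phi> x) + (LINT x|lborel. a' x * U x * \<phi> x) = (LINT x|lborel. G x * \<phi> x)"
      using uL[OF \<Delta>\<phi>] 1 2 by simp
    note I = LpLinf_1_times_nice
    have "(LINT x|lborel. ((-1 - a' x) * U x) * \<phi> x) = - (LINT x|lborel. U x * \<phi> x) - (LINT x|lborel. a' x * U x * \<phi> x)"
    proof -
      have i: "integrable lborel (\<lambda>x. a' x * U x * \<phi> x)"
        by (rule I[OF LpLinf_mult_bounded[OF U1 _ a'b] n(1)]) auto
      have "(LINT x|lborel. ((-1 - a' x) * U x) * \<phi> x) = (LINT x|lborel. - (U x * \<phi> x) - a' x * U x * \<phi> x)"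
        by (intro Bochner_Integration.integral_cong) (auto simp: algebra_simps)
      then show ?thesis using i I[OF U1 n(1)] by simp
    qed
    moreover have "(LINT x|lborel. F x * \<phi> x) = 2 * (LINT x|lborel. w x * \<phi> x)
        + ((LINT x|lborel. ((-1 - a' x) * U x) * \<phi> x) + (LINT x|lborel. G x * \<phi> x))"
      unfolding F_def distrib_right mult.assoc[of 2]
      using I[OF w1 n(1)] I[OF aU1 n(1)] I[OF G1 n(1)] by simp
    moreover have "(LINT x|lborel. w x * \<phi> x) = (LINT x|lborel. U x * \<phi> x) - (LINT x|lborel. L x * \<phi> x)"
      unfolding w_def left_diff_distrib using I[OF U1 n(1)] I[OF L1 n(1)] by simp
    moreover have "(LINT x|lborel. w x * (\<phi> x - laplacian \<phi> x)) = (LINT x|lborel. w x * \<phi> x)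
        - ((LINT x|lborel. U x * laplacian \<phi> x) - (LINT x|lborel. L x * laplacian \<phi> x))"
    proof -
      have "(LINT x|lborel. w x * (\<phi> x - laplacian \<phi> x)) = (LINT x|lborel. w x * \<phi> x - (U x * laplacian \<phi> x - L x * laplacian \<phi> x))"
        by (intro Bochner_Integration.integral_cong) (auto simp: w_def algebra_simps)
      then show ?thesis using I[OF w1 n(1)] I[OF U1 n(2)] I[OF L1 n(2)] by simp
    qed
    ultimately show "(LINT x|lborel. w x * (\<phi> x - laplacian \<phi> x)) = (LINT x|lborel. F x * \<phi> x)"
      using UL[OF \<phi>] eq by linarith
  qed
  obtain C where C: "AE x in lborel. \<bar>U x\<bar> \<le> C" "AE x in lborel. \<bar>w x\<bar> \<le> C"
    using bessel_system_essentially_bounded[OF Fm U(1) wm Fb A(1) Uw wF w22 \<sigma> t] by blast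
  \<comment> \<open>As \<open>u\<close> is bounded, the nonlinear term is dominated by a multiple of \<open>|u|\<close> and is
    square integrable.\<close>
  define C' where "C' = A + A * \<bar>C\<bar> powr \<sigma>"
  have C'0: "0 \<le> C'" using A by (simp add: C'_def)
  have FC: "AE x in lborel. \<bar>F x\<bar> \<le> 2 * \<bar>w x\<bar> + C' * \<bar>U x\<bar>"
    using Fb C(1)
  proof eventually_elim
    case (elim x)
    have "\<bar>U x\<bar> powr (\<sigma> + 1) = \<bar>U x\<bar> powr \<sigma> * \<bar>U x\<bar>" by (simp add: powr_add)
    also have "\<dots> \<le> \<bar>C\<bar> powr \<sigma> * \<bar>U x\<bar>" using elim \<sigma> by (intro mult_right_mono powr_mono2) auto
    finally have "A * \<bar>U x\<bar> powr (\<sigma> + 1) \<le> A * (\<bar>C\<bar> powr \<sigma> * \<bar>U x\<bar>)" using A by (intro mult_left_mono) auto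
    moreover have "C' * \<bar>U x\<bar> = A * \<bar>U x\<bar> + A * (\<bar>C\<bar> powr \<sigma> * \<bar>U x\<bar>)" by (simp add: C'_def algebra_simps)
    ultimately show ?case using elim(1) by linarith
  qed
  define M where "M = 2 * \<bar>C\<bar> + C' * \<bar>C\<bar>"
  have M0: "0 \<le> M" using C'0 by (simp add: M_def)
  have FM: "AE x in lborel. \<bar>F x\<bar> \<le> M"
    using FC C
  proof eventually_elim
    case (elim x)
    have "C' * \<bar>U x\<bar> \<le> C' * \<bar>C\<bar>" using elim C'0 by (intro mult_left_mono) auto
    then show ?case using elim unfolding M_def by linarith
  qed
  \<comment> \<open>A representative of \<open>F\<close> that is bounded everywhere, so that the potential below is defined and
    regular at every point.\<close>
  define F' where "F' x = max (- M) (min M (F x))" for x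
  have F'm [measurable]: "F' \<in> borel_measurable borel" unfolding F'_def[abs_def] by measurable
  have FF': "AE x in lborel. F x = F' x" using FM by eventually_elim (auto simp: F'_def)
  have "integrable lborel (\<lambda>x. (2 * \<bar>w x\<bar> + C' * \<bar>U x\<bar>)\<^sup>2)"
    by (rule square_integrable_add) (use w2 U2 in \<open>auto simp: power_mult_distrib\<close>)
  then have F'2: "integrable lborel (\<lambda>x. (F' x)\<^sup>2)"
  proof (rule Bochner_Integration.integrable_bound)
    show "AE x in lborel. norm ((F' x)\<^sup>2) \<le> norm ((2 * \<bar>w x\<bar> + C' * \<bar>U x\<bar>)\<^sup>2)"
      using FC FF'
    proof eventually_elim
      case (elim x)
      then show ?case using power_mono[of "\<bar>F x\<bar>" "2 * \<bar>w x\<bar> + C' * \<bar>U x\<bar>" 2] by simp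
    qed
  qed measurable
  have F'b: "\<bar>F' x\<bar> \<le> M" for x using M0 by (auto simp: F'_def)
  have F': "L2Linf F'" using F'm F'2 F'b by (auto simp: L2Linf_def)
  define V where "V = conv bessel (conv bessel F')"
  have "AE x in lborel. U x = V x"
  proof -
    have "AE x in lborel. w x = conv bessel F' x"
      using wF conv_cong_AE[OF bessel_measurable(1) Fm F'm FF'] by simp
    then have "conv bessel w x = V x" for x
      unfolding V_def by (intro conv_cong_AE) auto
    then show ?thesis using Uw by simp
  qed
  then have "AE x in lebesgue. U x = V x" by (rule AE_completion)
  then have uV: "AE x in lebesgue. u x = V x" using U(2) by eventually_elim simp
  note reg = double_bessel_regularity[OF F', folded V_def]
  have VL: "L2Linf V" using reg(4)[of "[]"] by simp
  have L2Linf_LpLinf: "LpLinf 1 f" if "L2Linf f" for f :: "real ^ 'n \<Rightarrow> real"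
    using that by (auto simp: L2Linf_def intro: LpLinf_1_of_square_integrable)
  have "u \<in> sobolev_H 4"
    unfolding sobolev_def
  proof (intro CollectI conjI allI impI u2)
    fix "is" :: "'n list" assume "length is \<le> 4"
    then obtain y where y: "y \<in> borel_measurable borel" "integrable lborel (\<lambda>x. (y x)\<^sup>2)"
      "\<And>\<phi>. \<phi> \<in> test_functions \<Longrightarrow> (LINT x|lborel. V x * partials is \<phi> x) = (-1) ^ length is * (LINT x|lborel. y x * \<phi> x)"
      by (rule bessel_bessel_weak_derivative[OF F'm F'2, folded V_def]) (rule that)
    have "y \<in> Lp 2" using Lp_2_iff[OF lebesgue_measurable_borel[OF y(1)] y(1)] y(2) by simp
    moreover have "has_weak_deriv u is y"
      by (rule has_weak_derivI[OF ul uV L2Linf_LpLinf[OF VL] LpLinf_1_of_square_integrable[OF y(1,2)] y(3)])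
    ultimately show "\<exists>w\<in>Lp 2. has_weak_deriv u is w" by blast
  qed
  moreover have "u \<in> sobolev 2 s" if s: "2 \<le> s" for s :: ennreal
    unfolding sobolev_def
  proof (intro CollectI conjI allI impI)
    have Lps: "f \<in> Lp s" if f: "f \<in> borel_measurable lebesgue" and f': "L2Linf f'" and eq: "AE x in lebesgue. f x = f' x"
      for f f' :: "real ^ 'n \<Rightarrow> real"
      using f' Lp_of_bounded_square_integrable[OF f _ eq _ _ s] by (auto simp: L2Linf_def)
    show "u \<in> Lp s" by (rule Lps[OF ul VL uV])
    fix "is" :: "'n list" assume l: "length is \<le> 2"
    define y where "y = partials (rev is) V"
    have y: "L2Linf y" unfolding y_def by (rule reg(4)) (use l in simp)
    have ym: "y \<in> borel_measurable lebesgue" using y by (auto simp: L2Linf_def intro: lebesgue_measurable_borel)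
    have ck: "C_k (length is) V"
    proof -
      have "length is = 0 \<or> length is = 1 \<or> length is = 2" using l by linarith
      then show ?thesis using reg(1) C_k_SucD[of 1 V] C_k_SucD[of 0 V] by (auto simp: numeral_2_eq_2)
    qed
    have "has_weak_deriv u is y"
      unfolding y_def
      by (rule has_weak_derivI[OF ul uV L2Linf_LpLinf[OF VL] L2Linf_LpLinf[OF y[unfolded y_def]] C_k_weak_derivative[OF ck]])
    moreover have "y \<in> Lp s" by (rule Lps[OF ym y]) simp
    ultimately show "\<exists>w\<in>Lp s. has_weak_deriv u is w" by blast
  qed
  moreover have "AE x in lebesgue. V x = u x" using uV by eventually_elim simp
  ultimately show ?thesis using reg(1-3) by blast
qed

end
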